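(* Let $f\in C_{\lambda}(\mathbb{S}^1)$ be a piecewise $C^2$ topologically mixing map. Then $(f,\mathbb{S}^1,\mathcal{B},\lambda)$ is measure-theoretically exact (thus also strongly and weakly mixing).
   Context: The circle $\mathbb{S}^1$ is identified with $[0,1)$ (i.e. $\mathbb{R}/\mathbb{Z}$), $\lambda$ denotes normalized Lebesgue measure on $\mathbb{S}^1$ and $\mathcal{B}$ the Borel sets of $\mathbb{S}^1$. $C_{\lambda}(\mathbb{S}^1)$ is the set of all continuous maps $f:\mathbb{S}^1\to\mathbb{S}^1$ that preserve $\lambda$. Piecewise $C^2$ has its usual meaning: there is a finite partition of $\mathbb{S}^1$ into arcs such that the restriction of $f$ to the interior of each arc extends to a $C^2$ function on the closed arc. $f$ is topologically mixing if for each pair of nonempty open sets $U,V\subset\mathbb{S}^1$ there is $n_0\ge0$ such that $f^n(U)\cap V\ne\emptyset$ for every $n\ge n_0$. $(f,\mathbb{S}^1,\mathcal{B},\lambda)$ is measure-theoretically exact if every set $A\in\bigcap_{n\ge0}f^{-n}(\mathcal{B})$ satisfies $\lambda(A)\lambda(A^c)=0$. It is weakly mixing if for all $A,B\in\mathcal{B}$, $\lim_{n\to\infty}\frac1n\sum_{j=0}^{n-1}|\lambda(f^{-j}(A)\cap B)-\lambda(A)\lambda(B)|=0$, and strongly mixing if for all $A,B\in\mathcal{B}$, $\lim_{n\to\infty}\lambda(f^{-n}(A)\cap B)=\lambda(A)\lambda(B)$. *)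

theory Defs
  imports "HOL-Analysis.Analysis"
begin

text \<open>
  The circle is \<open>\<real>/\<int>\<close>, with carrier the fundamental domain \<open>{0..<1}\<close>: \<open>frac\<close> is the
  projection, and the topology is the quotient topology, \<^emph>\<open>not\<close> the subspace topology of the
  interval (see \<open>quotient_map_frac\<close> below).
\<close>

definition circle :: "real topology" where
  "circle = topology (\<lambda>U. U \<subseteq> {0..<1} \<and> open (frac -` U))"

lemma openin_circle: "openin circle U \<longleftrightarrow> U \<subseteq> {0..<1} \<and> open (frac -` U)"
proof -
  have "istopology (\<lambda>U. U \<subseteq> {0..<1::real} \<and> open (frac -` U :: real set))"
    unfolding istopology_def by (auto simp: vimage_Union)
  then show ?thesis
    by (simp add: circle_def)
qed

lemma topspace_circle [simp]: "topspace circle = {0..<1}"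
proof -
  have "frac -` {0..<1} = (UNIV :: real set)"
    by (auto simp: frac_lt_1)
  then have "openin circle {0..<1}"
    by (simp add: openin_circle)
  then show ?thesis
    by (metis openin_circle openin_subset openin_topspace subset_antisym)
qed

lemma quotient_map_frac: "quotient_map euclidean circle frac"
proof -
  have "range (frac :: real \<Rightarrow> real) = {0..<1}"
  proof (intro antisym subsetI)
    fix x :: real assume "x \<in> {0..<1}"
    then have "x = frac x" by (simp add: frac_eq)
    then show "x \<in> range frac" by blast
  qed (auto simp: frac_lt_1)
  then show ?thesis
    by (auto simp: quotient_map_def openin_circle vimage_def)
qed

definition circle_measure :: "real measure" where
  "circle_measure = restrict_space lborel {0..<1}"

lemma space_circle_measure [simp]: "space circle_measure = {0..<1}"
  by (simp add: circle_measure_def space_restrict_space)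

lemma sets_circle_measure:
  "sets circle_measure = sigma_sets {0..<1} {U. openin circle U}"
proof (rule antisym)
  have *: "sets circle_measure = sets (restrict_space borel {0..<1::real})"
    by (simp add: circle_measure_def sets_restrict_space)
  let ?S = "sigma_sets {0..<1::real} {U. openin circle U}"
  show "?S \<subseteq> sets circle_measure"
  proof -
    have "U \<in> sets circle_measure" if "openin circle U" for U
    proof -
      have "U \<subseteq> {0..<1}" "open (frac -` U)"
        using that by (auto simp: openin_circle)
      moreover from this have "U = {0..<1} \<inter> frac -` U"
        by (auto simp: frac_eq[THEN iffD2])
      ultimately show ?thesis
        unfolding * sets_restrict_space by (metis borel_open image_eqI)
    qed
    then show ?thesis
      using sets.sigma_sets_subset[of "{U. openin circle U}" circle_measure] by auto
  qed
  have op: "openin circle (V \<inter> {0<..<1})" if "open V" for V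
  proof -
    have "frac -` (V \<inter> {0<..<1}) = (\<Union>n\<in>\<int>. (+) n ` (V \<inter> {0<..<1}))"
    proof (intro antisym subsetI)
      fix x :: real assume "x \<in> frac -` (V \<inter> {0<..<1})"
      moreover have "x = of_int \<lfloor>x\<rfloor> + frac x" by (simp add: frac_def)
      ultimately show "x \<in> (\<Union>n\<in>\<int>. (+) n ` (V \<inter> {0<..<1}))"
        by (metis Ints_of_int UN_iff imageI vimageE)
    next
      fix x :: real assume "x \<in> (\<Union>n\<in>\<int>. (+) n ` (V \<inter> {0<..<1}))"
      then obtain k y where "x = of_int k + y" "y \<in> V \<inter> {0<..<1}"
        by (auto elim!: Ints_cases)
      moreover from this have "frac x = y"
        by (subst frac_unique_iff) auto
      ultimately show "x \<in> frac -` (V \<inter> {0<..<1})" by simp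
    qed
    moreover have "open (\<Union>n\<in>\<int>. (+) n ` (V \<inter> {0<..<1}))"
      using that by (intro open_UN ballI open_translation) auto
    ultimately show ?thesis
      by (auto simp: openin_circle)
  qed
  have zero: "{0} \<in> ?S"
  proof -
    have "{0<..<1} \<in> ?S"
      using op[of UNIV] by (intro sigma_sets.Basic) simp
    then have "{0..<1} - {0<..<1} \<in> ?S"
      by (rule sigma_sets.Compl)
    moreover have "{0..<1} - {0<..<1} = {0::real}" by auto
    ultimately show ?thesis by simp
  qed
  show "sets circle_measure \<subseteq> ?S"
  proof -
    have "sets circle_measure = sigma_sets {0..<1} ((\<inter>) {0..<1} ` {V. open V})"
      unfolding * sets_restrict_space sets_borel
      by (rule sigma_sets_Int) (auto simp flip: sets_borel)
    moreover have "{0..<1} \<inter> V \<in> ?S" if "open V" for V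
    proof -
      have "V \<inter> {0<..<1} \<in> ?S"
        using op[OF that] by (intro sigma_sets.Basic) simp
      moreover have "{0..<1} \<inter> V = (if 0 \<in> V then {0} else {}) \<union> V \<inter> {0<..<1}"
        by (auto simp: less_le)
      moreover have "(if 0 \<in> V then {0} else {}) \<in> ?S"
        using zero by (simp add: sigma_sets.Empty)
      ultimately show ?thesis
        by (simp only: sigma_sets_Un)
    qed
    then have "sigma_sets {0..<1} ((\<inter>) {0..<1} ` {V. open V}) \<subseteq> ?S"
      by (intro sigma_sets_mono) blast
    ultimately show ?thesis
      by simp
  qed
qed

definition measure_preserving_map :: "'a measure \<Rightarrow> ('a \<Rightarrow> 'a) \<Rightarrow> bool" where
  "measure_preserving_map M f \<longleftrightarrow> f \<in> M \<rightarrow>\<^sub>M M \<and>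
     (\<forall>A\<in>sets M. emeasure M (f -` A \<inter> space M) = emeasure M A)"

definition C_lambda :: "(real \<Rightarrow> real) set" where
  "C_lambda = {f. continuous_map circle circle f \<and> measure_preserving_map circle_measure f}"

definition C2_on :: "real \<Rightarrow> real \<Rightarrow> (real \<Rightarrow> real) \<Rightarrow> bool" where
  "C2_on a b g \<longleftrightarrow> (\<exists>g' g''.
     (\<forall>x\<in>{a..b}. (g has_real_derivative g' x) (at x within {a..b})) \<and>
     (\<forall>x\<in>{a..b}. (g' has_real_derivative g'' x) (at x within {a..b})) \<and>
     continuous_on {a..b} g'')"

text \<open>
  The arcs are the images under \<open>frac\<close> of consecutive intervals \<open>[t i, t (i + 1)]\<close> that
  together cover one period. A \<open>C\<^sup>2\<close> map from such an arc to \<open>\<real>/\<int>\<close> is written through a lift,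
  that is, as \<open>x \<mapsto> frac (g x)\<close> with \<open>g\<close> real-valued and \<open>C\<^sup>2\<close>; so a jump of \<open>f\<close> between values
  near 1 and near 0 is not a singularity.
\<close>

definition piecewise_C2 :: "(real \<Rightarrow> real) \<Rightarrow> bool" where
  "piecewise_C2 f \<longleftrightarrow> (\<exists>(m::nat) (t::nat \<Rightarrow> real).
     (\<forall>i<m. t i < t (Suc i)) \<and> t m = t 0 + 1 \<and>
     (\<forall>i<m. \<exists>g. C2_on (t i) (t (Suc i)) g \<and>
        (\<forall>x\<in>{t i<..<t (Suc i)}. f (frac x) = frac (g x))))"

definition topologically_mixing :: "'a topology \<Rightarrow> ('a \<Rightarrow> 'a) \<Rightarrow> bool" where
  "topologically_mixing X f \<longleftrightarrow>
     (\<forall>U V. openin X U \<and> U \<noteq> {} \<and> openin X V \<and> V \<noteq> {} \<longrightarrow>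
        (\<exists>n0. \<forall>n\<ge>n0. (f ^^ n) ` U \<inter> V \<noteq> {}))"

definition measure_exact :: "'a measure \<Rightarrow> ('a \<Rightarrow> 'a) \<Rightarrow> bool" where
  "measure_exact M f \<longleftrightarrow>
     (\<forall>A \<in> (\<Inter>n. {(f ^^ n) -` B \<inter> space M |B. B \<in> sets M}).
        measure M A * measure M (space M - A) = 0)"

definition strongly_mixing :: "'a measure \<Rightarrow> ('a \<Rightarrow> 'a) \<Rightarrow> bool" where
  "strongly_mixing M f \<longleftrightarrow> (\<forall>A\<in>sets M. \<forall>B\<in>sets M.
     (\<lambda>n. measure M ((f ^^ n) -` A \<inter> B)) \<longlonglongrightarrow> measure M A * measure M B)"

definition weakly_mixing :: "'a measure \<Rightarrow> ('a \<Rightarrow> 'a) \<Rightarrow> bool" where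
  "weakly_mixing M f \<longleftrightarrow> (\<forall>A\<in>sets M. \<forall>B\<in>sets M.
     (\<lambda>n. (1 / real n) *
        (\<Sum>j<n. \<bar>measure M ((f ^^ j) -` A \<inter> B) - measure M A * measure M B\<bar>)) \<longlonglongrightarrow> 0)"

end

theory Submission
  imports Defs "HOL-Probability.Conditional_Expectation"
begin

text \<open>
  Lift \<open>f\<close> to \<open>F : \<real> \<rightarrow> \<real>\<close>. Since the reciprocal slopes over a point add up to 1, every smooth
  piece of \<open>F\<close> has either slope \<open>\<plusminus>1\<close> throughout or slope at least \<open>\<gamma> > 1\<close> in absolute value.
  Mixing excludes arbitrarily long itineraries inside the isometric pieces, so some iterate
  \<open>F\<^sup>N\<close> is uniformly expanding off finitely many points modulo 1. Because \<open>\<lambda>\<close> is invariant, the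
  points whose branch of \<open>F\<^sup>n\<^sup>N\<close> has an image shorter than \<open>\<epsilon>\<close> have measure \<open>O(\<epsilon>)\<close>, uniformly
  in \<open>n\<close>. Hence a tail set \<open>A\<close> of positive measure nearly fills a small arc with a long image;
  bounded distortion transports this to the image, and mixing spreads it over the circle.
\<close>

section \<open>Periodic sets and Lebesgue measure\<close>

text \<open>The first obstacle is that invariance alone only gives slopes of absolute value at least
  1. The gap between 1 and \<open>\<gamma>\<close> comes from counting preimages: at a smooth point
  alone in its fibre the slope is 1, whereas a second preimage, of slope at most the Lipschitz
  constant \<open>K\<close>, uses up at least \<open>1 / K\<close> of the reciprocal sum and leaves
  at most \<open>1 - 1 / K = 1 / \<gamma>\<close>. Isometric itineraries are excluded topologically,
  through the closed set of their limit points. The second obstacle is that break points may cut the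
  branches of an iterate into ever shorter pieces; this is controlled only in measure, and uniformly
  in time because preimages do not change \<open>mu\<close>. Distortion is estimated along the orbit
  of \<open>F\<close>, not for the expanding iterate: isometric steps add nothing, so
  \<open>\<Delta>\<close> does not depend on the iterate. Finally, a tail set \<open>A\<close> has
  the same measure as each set \<open>B n\<close> of which it is the preimage, so it suffices that
  some \<open>B n\<close> nearly fills one period. Strong mixing is deduced from exactness in an
  arbitrary probability space.\<close>

lemma lipschitz_funpow:
  fixes G :: "real \<Rightarrow> real"
  assumes "\<And>x y. \<bar>G x - G y\<bar> \<le> K * \<bar>x - y\<bar>" "0 \<le> K"
  shows "\<bar>(G ^^ n) x - (G ^^ n) y\<bar> \<le> K ^ n * \<bar>x - y\<bar>"
proof (induction n)
  case (Suc n)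
  have "\<bar>(G ^^ Suc n) x - (G ^^ Suc n) y\<bar> \<le> K * \<bar>(G ^^ n) x - (G ^^ n) y\<bar>"
    using assms(1) by simp
  also have "\<dots> \<le> K * (K ^ n * \<bar>x - y\<bar>)"
    using Suc assms(2) by (intro mult_left_mono) auto
  finally show ?case by simp
qed simp

text \<open>Indices that belong to no member are padded with the empty set, so that finite families
  too can be fed to countable additivity.\<close>

lemma disjoint_sequence_of_countable:
  assumes "countable \<C>" "disjoint \<C>"
  shows "\<exists>D :: nat \<Rightarrow> 'a set. disjoint_family D \<and> (\<Union>n. D n) = \<Union>\<C> \<and> (\<forall>n. D n = {} \<or> D n \<in> \<C>)"
proof (intro exI conjI allI)
  define D where "D n = (if n \<in> to_nat_on \<C> ` \<C> then from_nat_into \<C> n else {})" for n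
  have D: "D (to_nat_on \<C> C) = C" if "C \<in> \<C>" for C
    using that assms(1) by (simp add: D_def)
  show "D n = {} \<or> D n \<in> \<C>" for n
    using D by (auto simp: D_def assms(1))
  have "D n \<inter> D m = {}" if "n \<noteq> m" for n m
  proof (cases "D n = {} \<or> D m = {}")
    case False
    then obtain C C' where "C \<in> \<C>" "n = to_nat_on \<C> C" "C' \<in> \<C>" "m = to_nat_on \<C> C'"
      by (auto simp: D_def split: if_splits)
    then show ?thesis
      using that D assms(2) by (metis disjointD)
  qed auto
  then show "disjoint_family D"
    by (simp add: disjoint_family_on_def)
  show "(\<Union>n. D n) = \<Union>\<C>"
  proof
    show "(\<Union>n. D n) \<subseteq> \<Union>\<C>" by (auto simp: D_def assms(1) split: if_splits)
    show "\<Union>\<C> \<subseteq> (\<Union>n. D n)" using D by blast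
  qed
qed

lemma open_components_sequence:
  fixes U :: "real set"
  assumes "open U"
  shows "\<exists>D :: nat \<Rightarrow> real set. disjoint_family D \<and> (\<Union>n. D n) = U \<and> (\<forall>n. D n = {} \<or> D n \<in> components U)"
proof -
  have "disjoint (components U)"
    using pairwise_disjoint_components by (auto simp: disjoint_def pairwise_def disjnt_def)
  moreover from this have "countable (components U)"
    using assms open_components by (intro countable_disjoint_open_subsets) auto
  ultimately show ?thesis
    using disjoint_sequence_of_countable[of "components U"] by simp
qed

lemma open_connected_bounded_real:
  fixes C :: "real set"
  assumes "open C" "connected C" "bounded C" "C \<noteq> {}"
  obtains p q where "p < q" "C = {p<..<q}"
proof -
  have bd: "bdd_below C" "bdd_above C"
    using assms(3) by (auto intro: bounded_imp_bdd_below bounded_imp_bdd_above)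
  have ne: "Inf C \<notin> C" "Sup C \<notin> C"
  proof -
    show "Inf C \<notin> C"
    proof
      assume "Inf C \<in> C"
      then obtain e where "e > 0" "ball (Inf C) e \<subseteq> C" using assms(1) openE by blast
      then have "Inf C - e/2 \<in> C" by (auto simp: subset_iff dist_real_def)
      then show False using cInf_lower[OF _ bd(1)] \<open>e > 0\<close> by fastforce
    qed
    show "Sup C \<notin> C"
    proof
      assume "Sup C \<in> C"
      then obtain e where "e > 0" "ball (Sup C) e \<subseteq> C" using assms(1) openE by blast
      then have "Sup C + e/2 \<in> C" by (auto simp: subset_iff dist_real_def)
      then show False using cSup_upper[OF _ bd(2)] \<open>e > 0\<close> by fastforce
    qed
  qed
  have "C = {Inf C<..<Sup C}"
  proof
    show "C \<subseteq> {Inf C<..<Sup C}"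
    proof
      fix x assume "x \<in> C"
      then have "Inf C \<le> x" "x \<le> Sup C" using bd by (auto intro: cInf_lower cSup_upper)
      moreover have "Inf C \<noteq> x" "x \<noteq> Sup C" using \<open>x \<in> C\<close> ne by auto
      ultimately show "x \<in> {Inf C<..<Sup C}" by auto
    qed
    show "{Inf C<..<Sup C} \<subseteq> C"
    proof
      fix x assume x: "x \<in> {Inf C<..<Sup C}"
      then obtain y z where "y \<in> C" "y < x" "z \<in> C" "x < z"
        using cInf_less_iff[OF assms(4) bd(1)] less_cSup_iff[OF assms(4) bd(2)] by auto
      then show "x \<in> C" using connected_contains_Icc[OF assms(2), of y z] by auto
    qed
  qed
  moreover from this assms(4) have "Inf C < Sup C"
    by (metis greaterThanLessThan_empty not_less)
  ultimately show ?thesis using that by blast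
qed

lemma subset_interval_of_diameter:
  fixes S :: "real set"
  assumes "\<And>x y. x \<in> S \<Longrightarrow> y \<in> S \<Longrightarrow> \<bar>x - y\<bar> \<le> d"
  obtains w where "S \<subseteq> {w..w + d}"
proof (cases "S = {}")
  case False
  then obtain z where z: "z \<in> S" by blast
  have bd: "bdd_below S" by (rule bdd_belowI[of _ "z - d"]) (use assms[OF z] in fastforce)
  have "x \<in> {Inf S..Inf S + d}" if "x \<in> S" for x
  proof -
    have "x - d \<le> Inf S"
      by (rule cInf_greatest[OF False]) (use assms[OF that] in fastforce)
    then show ?thesis using cInf_lower[OF that bd] by auto
  qed
  then show ?thesis using that by blast
qed auto

text \<open>Cover the preimage by an open set of almost the same measure. Each component is an
  interval, and its image lies in an interval at most \<open>L\<close> times as long; by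
  \<open>img\<close> these image intervals cover \<open>E \<inter> {u..v}\<close>. With
  \<open>E\<close> the complement of a tail set's image, this carries "nearly full" forward along a
  branch.\<close>

lemma measure_le_Lipschitz_preimage:
  fixes \<phi> :: "real \<Rightarrow> real"
  assumes E: "E \<in> sets borel" and L: "0 \<le> L" and ab: "a < b"
    and lip: "\<And>x y. x \<in> {a<..<b} \<Longrightarrow> y \<in> {a<..<b} \<Longrightarrow> \<bar>\<phi> x - \<phi> y\<bar> \<le> L * \<bar>x - y\<bar>"
    and m: "\<phi> \<in> borel_measurable borel"
    and img: "{u..v} \<subseteq> \<phi> ` {a<..<b}"
  shows "measure lborel (E \<inter> {u..v}) \<le> L * measure lborel ({a<..<b} \<inter> \<phi> -` E)"
proof -
  define P where "P = {a<..<b} \<inter> \<phi> -` E"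
  have P: "P \<in> sets borel" unfolding P_def using measurable_sets[OF m E] by simp
  have Pfin: "emeasure lborel P < \<infinity>"
  proof -
    have "emeasure lborel P \<le> emeasure lborel {a<..<b}" unfolding P_def by (intro emeasure_mono) auto
    then show ?thesis using ab by (simp add: order.strict_trans1)
  qed
  have key: "emeasure lborel (E \<inter> {u..v}) \<le> ennreal L * (emeasure lborel P + ennreal e)" if e: "e > 0" for e
  proof -
    obtain U where U: "open U" "P \<subseteq> U" "emeasure lborel (U - P) < ennreal e"
      using outer_regular_lborel[OF P e] by blast
    define W where "W = U \<inter> {a<..<b}"
    have W: "open W" "P \<subseteq> W" "W \<subseteq> {a<..<b}" using U by (auto simp: W_def P_def)
    have eW: "emeasure lborel W \<le> emeasure lborel P + ennreal e"
    proof -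
      have "emeasure lborel W \<le> emeasure lborel (P \<union> (U - P))"
        by (rule emeasure_mono) (use W_def P U(1) in auto)
      also have "\<dots> \<le> emeasure lborel P + emeasure lborel (U - P)"
        by (rule emeasure_subadditive) (use P U(1) in auto)
      finally show ?thesis using U(3) by (meson add_left_mono order.trans less_imp_le)
    qed
    obtain D :: "nat \<Rightarrow> real set" where "disjoint_family D \<and> (\<Union>n. D n) = W \<and> (\<forall>n. D n = {} \<or> D n \<in> components W)"
      using open_components_sequence[OF W(1)] ..
    then have D: "disjoint_family D" "(\<Union>n. D n) = W" "\<And>n. D n = {} \<or> D n \<in> components W"
      by auto
    have Dm: "D n \<in> sets lborel" for n
      using D(3)[of n] open_components[OF W(1)] by auto
    have "\<exists>w l. \<phi> ` D n \<subseteq> {w..w + L * l} \<and> 0 \<le> l \<and> emeasure lborel (D n) = ennreal l" for n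
    proof (cases "D n = {}")
      case False
      then have c: "D n \<in> components W" using D by blast
      have "bounded (D n)"
        using in_components_subset[OF c] W(3) by (intro bounded_subset[OF bounded_closed_interval[of a b]]) force
      then obtain p q where pq: "p < q" "D n = {p<..<q}"
        using open_connected_bounded_real open_components[OF W(1) c] in_components_connected[OF c] False by metis
      have "\<bar>x - y\<bar> \<le> L * (q - p)" if "x \<in> \<phi> ` D n" "y \<in> \<phi> ` D n" for x y
      proof -
        obtain s t where st: "s \<in> D n" "t \<in> D n" "x = \<phi> s" "y = \<phi> t" using \<open>x \<in> \<phi> ` D n\<close> \<open>y \<in> \<phi> ` D n\<close> by blast
        have "D n \<subseteq> {a<..<b}" using D(2) W(3) by blast
        then have "\<bar>x - y\<bar> \<le> L * \<bar>s - t\<bar>" using lip st by blast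
        also have "\<dots> \<le> L * (q - p)" using st(1,2) pq(2) L by (intro mult_left_mono) auto
        finally show ?thesis .
      qed
      then obtain w where "\<phi> ` D n \<subseteq> {w..w + L * (q - p)}" using subset_interval_of_diameter by blast
      then show ?thesis using pq by (intro exI[of _ w] exI[of _ "q - p"]) auto
    qed (auto intro: exI[of _ 0])
    then obtain w l where wl: "\<And>n. \<phi> ` D n \<subseteq> {w n..w n + L * l n}" "\<And>n. 0 \<le> l n" "\<And>n. emeasure lborel (D n) = ennreal (l n)"
      by metis
    have "E \<inter> {u..v} \<subseteq> (\<Union>n. {w n..w n + L * l n})"
    proof
      fix y assume y: "y \<in> E \<inter> {u..v}"
      then obtain x where x: "x \<in> {a<..<b}" "y = \<phi> x" using img by blast
      then have "x \<in> W" using y W(2) by (auto simp: P_def)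
      then obtain n where "x \<in> D n" using D(2) by blast
      then show "y \<in> (\<Union>n. {w n..w n + L * l n})" using wl(1)[of n] x by blast
    qed
    then have "emeasure lborel (E \<inter> {u..v}) \<le> emeasure lborel (\<Union>n. {w n..w n + L * l n})"
      by (intro emeasure_mono) auto
    also have "\<dots> \<le> (\<Sum>n. emeasure lborel {w n..w n + L * l n})"
      by (rule emeasure_subadditive_countably) auto
    also have "\<dots> = (\<Sum>n. ennreal L * emeasure lborel (D n))"
      using L wl(2,3) by (simp add: ennreal_mult)
    also have "\<dots> = ennreal L * emeasure lborel W"
      using suminf_emeasure[of D lborel] D(1,2) Dm by (simp add: ennreal_suminf_cmult image_subset_iff)
    also have "\<dots> \<le> ennreal L * (emeasure lborel P + ennreal e)"
      using eW by (rule mult_left_mono) simp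
    finally show ?thesis .
  qed
  have fin: "emeasure lborel P = ennreal (measure lborel P)" using Pfin by (simp add: emeasure_eq_ennreal_measure)
  have fin2: "emeasure lborel (E \<inter> {u..v}) = ennreal (measure lborel (E \<inter> {u..v}))"
  proof -
    have "emeasure lborel (E \<inter> {u..v}) \<le> emeasure lborel {u..v}" using E by (intro emeasure_mono) auto
    also have "\<dots> < \<infinity>" by (simp add: emeasure_lborel_Icc_eq)
    finally show ?thesis by (intro emeasure_eq_ennreal_measure) auto
  qed
  have "measure lborel (E \<inter> {u..v}) \<le> L * measure lborel P + e" if e: "e > 0" for e
  proof -
    \<comment> \<open>Dividing by \<open>L + 1\<close> keeps \<open>e'\<close> well defined when
      \<open>L = 0\<close>.\<close>
    define e' where "e' = e / (L + 1)"
    have e': "e' > 0" "L * e' \<le> e" using e L by (auto simp: e'_def field_simps)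
    have "ennreal (measure lborel (E \<inter> {u..v})) \<le> ennreal (L * (measure lborel P + e'))"
      using key[OF e'(1)] L e'(1) unfolding fin fin2 by (simp add: ennreal_mult ennreal_plus)
    then have "measure lborel (E \<inter> {u..v}) \<le> L * (measure lborel P + e')"
      using L e'(1) by (subst (asm) ennreal_le_iff) auto
    then show ?thesis using e'(2) by (simp add: algebra_simps)
  qed
  then show ?thesis unfolding P_def by (rule field_le_epsilon)
qed

lemma measure_mono_interval:
  assumes "A \<in> sets borel" "B \<in> sets borel" "A \<subseteq> B" "B \<subseteq> {u..v::real}"
  shows "measure lborel A \<le> measure lborel B"
proof (rule measure_mono_fmeasurable)
  show "B \<in> fmeasurable lborel"
    by (rule fmeasurableI2[of "{u..v}"]) (use assms in \<open>auto simp: fmeasurable_def emeasure_lborel_Icc_eq\<close>)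
qed (use assms in auto)

text \<open>Subsets of the circle are represented by their full preimages in the line, so that
  preimages under the lift need no reduction modulo 1. Their circle measure is
  \<open>mu\<close>.\<close>

definition periodic :: "real set \<Rightarrow> bool" where
  "periodic E \<longleftrightarrow> (\<forall>x. x + 1 \<in> E \<longleftrightarrow> x \<in> E)"

lemma periodic_add_int:
  assumes "periodic E"
  shows "x + of_int k \<in> E \<longleftrightarrow> x \<in> E"
proof -
  have *: "x + of_nat n \<in> E \<longleftrightarrow> x \<in> E" for x n
  proof (induction n)
    case (Suc n)
    have "x + of_nat (Suc n) = (x + of_nat n) + 1" by simp
    then show ?case using Suc assms unfolding periodic_def by metis
  qed auto
  show ?thesis
  proof (cases k rule: int_cases2)
    case (nonneg n)
    then show ?thesis using * by simp
  next
    case (nonpos n)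
    then show ?thesis using *[of "x + of_int k" n] by simp
  qed
qed

lemma periodic_frac: "periodic E \<Longrightarrow> frac x \<in> E \<longleftrightarrow> x \<in> E"
  using periodic_add_int[of E "frac x" "\<lfloor>x\<rfloor>"] by (simp add: frac_def)

lemma periodic_meets_interval:
  assumes "periodic T" "T \<noteq> {}" "b - a > 1"
  shows "{a<..<b} \<inter> T \<noteq> {}"
proof -
  obtain t where "t \<in> T" using assms(2) by blast
  define s where "s = t + of_int (\<lfloor>a - t\<rfloor> + 1)"
  have "s \<in> T" using \<open>t \<in> T\<close> periodic_add_int[OF assms(1)] by (simp add: s_def del: of_int_add)
  moreover have "s \<in> {a<..<b}" using assms(3) unfolding s_def by (auto; linarith)
  ultimately show ?thesis by blast
qed

lemma locally_finite_imp_closed: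
  fixes T :: "real set"
  assumes "\<And>u v. finite (T \<inter> {u..v})"
  shows "closed T"
  unfolding closed_limpt
proof (intro allI impI)
  fix x assume "x islimpt T"
  then have "infinite (T \<inter> ball x 1)" by (simp add: islimpt_eq_infinite_ball)
  moreover have "T \<inter> ball x 1 \<subseteq> T \<inter> {x-1..x+1}" by (auto simp: dist_real_def)
  ultimately show "x \<in> T" using assms finite_subset by blast
qed

definition mu :: "real set \<Rightarrow> real" where
  "mu E = measure lborel (E \<inter> {0..<1})"

lemma measure_vimage_translation:
  assumes "A \<in> sets borel"
  shows "measure lborel ((\<lambda>x. x + c) -` A) = measure lborel (A :: real set)"
proof -
  have "measure lborel A = measure (distr lborel borel ((+) c)) A"
    by (simp add: lborel_distr_plus)
  also have "\<dots> = measure lborel (((+) c) -` A)"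
    using assms by (simp add: measure_distr)
  also have "((+) c -` A) = ((\<lambda>x. x + c) -` A)"
    by (auto simp: add.commute)
  finally show ?thesis by simp
qed

text \<open>Cut the window at the integer in \<open>(u, u + 1]\<close> and move the part to its
  right back by one period. The freedom in \<open>u\<close> is used to keep the arcs under study
  from wrapping around.\<close>

lemma mu_window:
  assumes E: "E \<in> sets borel" "periodic E"
  shows "measure lborel (E \<inter> {u..<u+1}) = mu E"
proof -
  define k where "k = \<lfloor>u\<rfloor>"
  have k: "of_int k \<le> u" "u < of_int k + 1" unfolding k_def by linarith+
  have fin: "emeasure lborel (E \<inter> {s..<t}) \<noteq> \<infinity>" for s t
  proof -
    have "emeasure lborel (E \<inter> {s..<t}) \<le> emeasure lborel {s..t}" by (intro emeasure_mono) auto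
    also have "\<dots> < \<infinity>" by (simp add: emeasure_lborel_Icc_eq)
    finally show ?thesis by auto
  qed
  have split: "measure lborel (E \<inter> {s..<t}) = measure lborel (E \<inter> {s..<r}) + measure lborel (E \<inter> {r..<t})"
    if "s \<le> r" "r \<le> t" for s r t
  proof -
    have "E \<inter> {s..<t} = (E \<inter> {s..<r}) \<union> (E \<inter> {r..<t})" using that by auto
    then show ?thesis using fin E by (subst measure_Union[symmetric]) auto
  qed
  have shift: "measure lborel (E \<inter> {s + of_int j..<t + of_int j}) = measure lborel (E \<inter> {s..<t})" for s t j
  proof -
    have "(\<lambda>x. x + of_int j) -` (E \<inter> {s + of_int j..<t + of_int j}) = E \<inter> {s..<t}"
      using periodic_add_int[OF E(2)] by auto
    then show ?thesis using measure_vimage_translation[of "E \<inter> {s + of_int j..<t + of_int j}" "of_int j"] E by simp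
  qed
  have "measure lborel (E \<inter> {u..<u+1}) = measure lborel (E \<inter> {u..<of_int k+1}) + measure lborel (E \<inter> {of_int k+1..<u+1})"
    using k by (intro split) auto
  also have "measure lborel (E \<inter> {of_int k+1..<u+1}) = measure lborel (E \<inter> {of_int k..<u})"
    using shift[of "of_int k" 1 u] by simp
  also have "measure lborel (E \<inter> {u..<of_int k+1}) + \<dots> = measure lborel (E \<inter> {of_int k..<of_int k+1})"
    using k split[of "of_int k" u "of_int k + 1"] by simp
  also have "\<dots> = mu E"
    using shift[of 0 k 1] by (simp add: mu_def add.commute)
  finally show ?thesis .
qed

section \<open>Mixing lifts\<close>

lemma fmeasurable_unit_Int: "E \<in> sets borel \<Longrightarrow> E \<inter> {0..<1::real} \<in> fmeasurable lborel"
  by (rule fmeasurableI2[of "{0..<1}"]) (auto simp: fmeasurable_def)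

lemma mu_nonneg: "0 \<le> mu E" by (simp add: mu_def)

lemma mu_mono: "A \<in> sets borel \<Longrightarrow> B \<in> sets borel \<Longrightarrow> A \<subseteq> B \<Longrightarrow> mu A \<le> mu B"
  unfolding mu_def by (rule measure_mono_fmeasurable) (auto intro: fmeasurable_unit_Int)

lemma mu_UNIV: "mu UNIV = 1" by (simp add: mu_def)

lemma mu_le_1: "E \<in> sets borel \<Longrightarrow> mu E \<le> 1"
  using mu_mono[of E UNIV] mu_UNIV by simp

lemma mu_UN_le:
  assumes "finite I" "\<And>i. i \<in> I \<Longrightarrow> E i \<in> sets borel"
  shows "mu (\<Union>i\<in>I. E i) \<le> (\<Sum>i\<in>I. mu (E i))"
proof -
  have "(\<Union>i\<in>I. E i) \<inter> {0..<1} = (\<Union>i\<in>I. E i \<inter> {0..<1})" by auto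
  moreover have "measure lborel (\<Union>i\<in>I. E i \<inter> {0..<1}) \<le> (\<Sum>i\<in>I. measure lborel (E i \<inter> {0..<1}))"
    using assms by (intro measure_UNION_le) auto
  ultimately show ?thesis
    by (simp only: mu_def)
qed

text \<open>A lift of a measure preserving, mixing circle map of degree \<open>d\<close>. The
  assumption \<open>mix\<close> is mixing read modulo 1: the integer \<open>k\<close> brings the
  image point to the chosen copy of the target arc.\<close>

locale circle_lift =
  fixes F :: "real \<Rightarrow> real" and d :: int
  assumes cont: "continuous_on UNIV F"
    and per: "F (x + 1) = F x + of_int d"
    and preserve: "E \<in> sets borel \<Longrightarrow> periodic E \<Longrightarrow> mu (F -` E) = mu E"
    and mix: "a < b \<Longrightarrow> c < e \<Longrightarrow>
      \<exists>n0. \<forall>n\<ge>n0. \<exists>x\<in>{a<..<b}. \<exists>k::int. (F ^^ n) x + of_int k \<in> {c<..<e}"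
begin

lemma continuous_funpow: "continuous_on UNIV (F ^^ n)"
proof (induction n)
  case (Suc n)
  then show ?case
    using continuous_on_compose[OF Suc continuous_on_subset[OF cont]] by simp
qed (simp add: continuous_on_id')

lemma isCont_funpow: "isCont (F ^^ n) x"
  using continuous_funpow by (simp add: continuous_on_eq_continuous_at)

lemma borel_funpow: "(F ^^ n) \<in> borel_measurable borel"
  using continuous_funpow borel_measurable_continuous_onI by blast

lemma vimage_funpow_borel: "E \<in> sets borel \<Longrightarrow> (F ^^ n) -` E \<in> sets borel"
  using measurable_sets[OF borel_funpow] by simp

lemma funpow_add_int: "(F ^^ n) (x + of_int k) = (F ^^ n) x + of_int (d ^ n * k)"
proof (induction n)
  case (Suc n)
  have *: "F (x + of_nat m) = F x + of_int (d * int m)" for x m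
  proof (induction m)
    case (Suc m)
    have "F (x + of_nat (Suc m)) = F ((x + of_nat m) + 1)" by (simp add: add_ac)
    also have "\<dots> = F (x + of_nat m) + of_int d" by (rule per)
    finally show ?case using Suc by (simp add: algebra_simps)
  qed simp
  have **: "F (x + of_int k) = F x + of_int (d * k)" for x k
  proof (cases k rule: int_cases2)
    case (nonneg m)
    then show ?thesis using *[of x m] by simp
  next
    case (nonpos m)
    then show ?thesis using *[of "x + of_int k" m] by simp
  qed
  show ?case
    using **[of "(F ^^ n) x" "d ^ n * k"] Suc by (simp add: mult.assoc)
qed simp

lemma periodic_vimage_funpow: "periodic E \<Longrightarrow> periodic ((F ^^ n) -` E)"
  using funpow_add_int[of n _ 1] periodic_add_int[of E _ "d ^ n"] by (simp add: periodic_def[of "_ -` _"])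

lemma preserve_funpow:
  assumes "E \<in> sets borel" "periodic E"
  shows "mu ((F ^^ n) -` E) = mu E"
proof (induction n)
  case (Suc n)
  have "(F ^^ Suc n) -` E = F -` ((F ^^ n) -` E)"
    by (auto simp: funpow_swap1)
  then show ?case
    using preserve vimage_funpow_borel periodic_vimage_funpow assms Suc by metis
qed simp

lemma Icc_subset_funpow_image:
  assumes "connected S" "x \<in> S" "y \<in> S"
  shows "{(F ^^ n) x..(F ^^ n) y} \<subseteq> (F ^^ n) ` S"
  using assms connected_continuous_image[OF continuous_on_subset[OF continuous_funpow] assms(1)]
  by (intro connected_contains_Icc) auto

text \<open>A preimage found in the closed interval by the intermediate value theorem is not an
  endpoint, because the endpoints go to excluded values. The open form is needed since cut points
  may sit at the ends of a branch.\<close>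

lemma Ioo_subset_funpow_image:
  "{min ((F ^^ k) u) ((F ^^ k) v)<..<max ((F ^^ k) u) ((F ^^ k) v)} \<subseteq> (F ^^ k) ` {min u v<..<max u v}"
proof
  fix p assume p: "p \<in> {min ((F ^^ k) u) ((F ^^ k) v)<..<max ((F ^^ k) u) ((F ^^ k) v)}"
  then have "p \<in> {(F ^^ k) u..(F ^^ k) v} \<or> p \<in> {(F ^^ k) v..(F ^^ k) u}"
    by (auto simp: min_def max_def split: if_splits)
  then have "p \<in> (F ^^ k) ` {min u v..max u v}"
    using Icc_subset_funpow_image[of "{min u v..max u v}" u v k] Icc_subset_funpow_image[of "{min u v..max u v}" v u k]
    by auto
  then obtain t where t: "t \<in> {min u v..max u v}" "p = (F ^^ k) t" by blast
  have "t \<noteq> u" "t \<noteq> v" using t(2) p by auto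
  then have "t \<in> {min u v<..<max u v}" using t(1) by (auto simp: min_def max_def split: if_splits)
  then show "p \<in> (F ^^ k) ` {min u v<..<max u v}" using t(2) by blast
qed

text \<open>Mixing gives a time for each pair of arcs; a finite grid of arcs makes one time
  \<open>M\<close> serve all intervals of length \<open>\<epsilon>\<close>. If the image had
  diameter below \<open>1 - \<epsilon>'\<close>, it would miss, modulo 1, an arc of length
  \<open>\<epsilon>'\<close>, and that arc contains a cell of the second grid, which the image has
  to meet.\<close>

lemma uniform_mixing:
  assumes \<epsilon>: "\<epsilon> > 0" "\<epsilon>' > 0"
  shows "\<exists>M. \<forall>a b. b - a \<ge> \<epsilon> \<longrightarrow>
    (\<exists>x\<in>{a<..<b}. \<exists>y\<in>{a<..<b}. (F ^^ M) y - (F ^^ M) x \<ge> 1 - \<epsilon>')"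
proof -
  have ex: "\<exists>p::nat. p > 0 \<and> 2 / real p < e" if "e > 0" for e
  proof -
    obtain p :: nat where "real p > 2 / e" using reals_Archimedean2 by blast
    moreover from this that have "real p > 0" by (meson divide_pos_pos less_trans zero_less_numeral)
    ultimately show ?thesis using that by (intro exI[of _ p]) (auto simp: field_simps)
  qed
  obtain p :: nat where p: "p > 0" "2 / real p < \<epsilon>" using ex \<epsilon> by blast
  obtain q :: nat where q: "q > 0" "2 / real q < \<epsilon>'" using ex \<epsilon> by blast
  \<comment> \<open>Round \<open>z * r\<close> up to an integer and divide it by \<open>r\<close>
    with remainder: the cell starting there lies within \<open>2 / r\<close> to the right of
    \<open>z\<close>.\<close>
  have grid: "\<exists>(i::nat) (k::int). i < r \<and> z \<le> real i / real r + of_int k \<and> real i / real r + of_int k + 1 / real r < z + 2 / real r"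
    if "r > 0" for r :: nat and z :: real
  proof -
    define m where "m = \<lceil>z * real r\<rceil>"
    have m: "z * real r \<le> of_int m" "of_int m < z * real r + 1" unfolding m_def by linarith+
    define i where "i = nat (m mod int r)"
    define k where "k = m div int r"
    have "int i = m mod int r" using that by (simp add: i_def)
    then have "m = int i + int r * k" by (simp add: k_def)
    then have mi: "real_of_int m = real i + real r * of_int k" by (metis of_int_add of_int_mult of_int_of_nat_eq)
    have "i < r" using \<open>int i = m mod int r\<close> that by (metis of_nat_0_less_iff of_nat_less_iff pos_mod_bound)
    moreover have "real i / real r + of_int k = of_int m / real r"
      using that by (simp add: mi field_simps)
    moreover have "z \<le> of_int m / real r" "of_int m / real r + 1 / real r < z + 2 / real r"
    proof -
      show "z \<le> of_int m / real r" using m(1) that by (simp add: pos_le_divide_eq)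
      have "(of_int m + 1) / real r < (z * real r + 2) / real r"
        using m(2) that by (intro divide_strict_right_mono) auto
      then show "of_int m / real r + 1 / real r < z + 2 / real r"
        using that by (simp add: add_divide_distrib)
    qed
    ultimately show ?thesis by (metis (no_types))
  qed
  have "\<exists>n0. \<forall>n\<ge>n0. \<exists>x\<in>{real i / real p<..<real i / real p + 1 / real p}. \<exists>k::int.
      (F ^^ n) x + of_int k \<in> {real j / real q<..<real j / real q + 1 / real q}" for i j
    using p q by (intro mix) auto
  then obtain n0 where n0: "\<And>i j n. n \<ge> n0 i j \<Longrightarrow>
      \<exists>x\<in>{real i / real p<..<real i / real p + 1 / real p}. \<exists>k::int.
      (F ^^ n) x + of_int k \<in> {real j / real q<..<real j / real q + 1 / real q}"
    by metis
  \<comment> \<open>The sum serves as an upper bound for the finitely many mixing times.\<close>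
  define M where "M = (\<Sum>i<p. \<Sum>j<q. n0 i j)"
  have M: "n0 i j \<le> M" if "i < p" "j < q" for i j
  proof -
    have "n0 i j \<le> (\<Sum>j<q. n0 i j)" using that by (intro member_le_sum) auto
    also have "\<dots> \<le> M" unfolding M_def using that by (intro member_le_sum) auto
    finally show ?thesis .
  qed
  have "\<exists>x\<in>{a<..<b}. \<exists>y\<in>{a<..<b}. (F ^^ M) y - (F ^^ M) x \<ge> 1 - \<epsilon>'" if ab: "b - a \<ge> \<epsilon>" for a b
  proof (rule ccontr)
    assume neg: "\<not> ?thesis"
    have "\<bar>u - v\<bar> \<le> 1 - \<epsilon>'" if uv: "u \<in> (F ^^ M) ` {a<..<b}" "v \<in> (F ^^ M) ` {a<..<b}" for u v
    proof -
      have *: "(F ^^ M) y - (F ^^ M) x < 1 - \<epsilon>'" if "x \<in> {a<..<b}" "y \<in> {a<..<b}" for x y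
        using neg that not_le by blast
      obtain x y where "x \<in> {a<..<b}" "y \<in> {a<..<b}" "u = (F ^^ M) x" "v = (F ^^ M) y"
        using uv by blast
      then show ?thesis using *[of x y] *[of y x] by simp
    qed
    then obtain w where w: "(F ^^ M) ` {a<..<b} \<subseteq> {w..w + (1 - \<epsilon>')}"
      by (rule subset_interval_of_diameter)
    obtain i k where i: "i < p" "a \<le> real i / real p + of_int k" "real i / real p + of_int k + 1 / real p < a + 2 / real p"
      using grid[OF p(1), of a] by blast
    obtain j l where j: "j < q" "w + 1 - \<epsilon>' \<le> real j / real q + of_int l" "real j / real q + of_int l + 1 / real q < w + 1 - \<epsilon>' + 2 / real q"
      using grid[OF q(1), of "w + 1 - \<epsilon>'"] by blast
    obtain x and m :: int where x: "x \<in> {real i / real p<..<real i / real p + 1 / real p}"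
      "(F ^^ M) x + of_int m \<in> {real j / real q<..<real j / real q + 1 / real q}"
      using n0[OF M[OF i(1) j(1)]] by blast
    have "x + of_int k \<in> {a<..<b}" using x(1) i p ab by auto
    then have "(F ^^ M) (x + of_int k) \<in> {w..w + (1 - \<epsilon>')}" using w by blast
    then have 1: "(F ^^ M) x + of_int (d ^ M * k) \<in> {w..w + (1 - \<epsilon>')}" by (simp add: funpow_add_int)
    have 2: "(F ^^ M) x + of_int (m + l) \<in> {w + 1 - \<epsilon>'<..<w + 1}"
      using x(2) j q by auto
    \<comment> \<open>The two memberships leave an integer strictly between 0 and 1.\<close>
    have "0 < real_of_int (m + l - d ^ M * k)" "real_of_int (m + l - d ^ M * k) < 1"
      using 1 2 unfolding of_int_diff by auto
    then show False unfolding of_int_0_less_iff of_int_less_1_iff by simp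
  qed
  then show ?thesis by blast
qed

text \<open>The form in which mixing is contradicted: every scenario without expansion below ends
  with an interval whose images all stay shorter than some \<open>r < 1\<close>.\<close>

lemma no_forever_short:
  assumes "a < b" "r < 1"
    and "\<And>n x y. x \<in> {a<..<b} \<Longrightarrow> y \<in> {a<..<b} \<Longrightarrow> (F ^^ n) y - (F ^^ n) x \<le> r"
  shows False
proof -
  obtain M where "\<forall>a' b'. b' - a' \<ge> b - a \<longrightarrow>
    (\<exists>x\<in>{a'<..<b'}. \<exists>y\<in>{a'<..<b'}. (F ^^ M) y - (F ^^ M) x \<ge> 1 - (1 - r) / 2)"
    using uniform_mixing[of "b - a" "(1 - r)/2"] assms by auto
  then obtain x y where "x \<in> {a<..<b}" "y \<in> {a<..<b}" "(F ^^ M) y - (F ^^ M) x \<ge> 1 - (1 - r) / 2"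
    by blast
  then show False using assms(3)[of x y M] assms(2) by (simp add: field_simps)
qed

end

section \<open>Uniformly expanding lifts\<close>

text \<open>The points at distance at least \<open>1 / (j + 1)\<close> from the complement of
  \<open>V\<close> increase to \<open>V\<close>. Consequently any interval shorter than
  \<open>r\<close> that meets \<open>W\<close> lies inside \<open>V\<close>.\<close>

lemma eroded_open:
  fixes V :: "real set"
  assumes V: "open V" "V \<subseteq> {0<..<1}" and e: "e > 0"
  shows "\<exists>r>0. \<exists>W. W \<in> sets borel \<and> (\<forall>x\<in>W. ball x r \<subseteq> V) \<and> measure lborel W > measure lborel V - e"
proof -
  define W where "W j = - (\<Union>y\<in>- V. ball y (1 / real (Suc j)))" for j
  have Wm: "W j \<in> sets borel" for j
    unfolding W_def by (intro borel_closed) auto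
  have WV: "ball x (1 / real (Suc j)) \<subseteq> V" if "x \<in> W j" for x j
    using that by (force simp: W_def dist_commute)
  have WsubV: "W j \<subseteq> V" for j
    using WV by force
  have "incseq W"
  proof (rule incseq_SucI)
    fix j
    have "ball y (1 / real (Suc (Suc j))) \<subseteq> ball y (1 / real (Suc j))" for y :: real
      by (intro subset_ball) (simp add: field_simps)
    then show "W j \<subseteq> W (Suc j)" unfolding W_def by blast
  qed
  have UW: "(\<Union>j. W j) = V"
  proof
    show "V \<subseteq> (\<Union>j. W j)"
    proof
      fix x assume "x \<in> V"
      then obtain r where r: "r > 0" "ball x r \<subseteq> V" using V(1) openE by blast
      obtain j where "1 / real (Suc j) < r" using r(1) reals_Archimedean by (auto simp: inverse_eq_divide)
      then have "x \<in> W j" using r(2) by (force simp: W_def dist_commute)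
      then show "x \<in> (\<Union>j. W j)" by blast
    qed
  qed (use WsubV in auto)
  have Vf: "V \<in> fmeasurable lborel"
    by (rule fmeasurableI2[of "{0..1}"]) (use V in \<open>auto simp: fmeasurable_def\<close>)
  have "(\<lambda>j. measure lborel (W j)) \<longlonglongrightarrow> measure lborel (\<Union>j. W j)"
    by (rule Lim_measure_incseq) (use \<open>incseq W\<close> Wm UW Vf in \<open>auto simp: fmeasurable_def\<close>)
  then have "(\<lambda>j. measure lborel (W j)) \<longlonglongrightarrow> measure lborel V" by (simp add: UW)
  then have "eventually (\<lambda>j. measure lborel V - e < measure lborel (W j)) sequentially"
    by (rule order_tendstoD) (use e in simp)
  then obtain j where "measure lborel V - e < measure lborel (W j)"
    unfolding eventually_sequentially by blast
  then show ?thesis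
    using WV[of _ j] Wm[of j] by (intro exI[of _ "1 / real (Suc j)"] conjI exI[of _ "W j"]) auto
qed

text \<open>Everything the measure-theoretic argument uses about an expanding iterate. Distortion
  compares two difference quotients, multiplied out, so that neither derivatives nor divisions
  occur.\<close>

locale expanding_lift = circle_lift +
  fixes K \<gamma> \<Delta> :: real and T :: "real set"
  assumes K: "K \<ge> 1" and lip: "\<bar>F x - F y\<bar> \<le> K * \<bar>x - y\<bar>"
    and T_per: "periodic T" and T_fin: "finite (T \<inter> {u..v})" and T_ne: "T \<noteq> {}"
    and \<gamma>: "\<gamma> > 1"
    and expand: "{min a b<..<max a b} \<inter> T = {} \<Longrightarrow> \<gamma> * \<bar>a - b\<bar> \<le> \<bar>F a - F b\<bar>"
    and \<Delta>: "\<Delta> > 0"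
    and distortion: "(\<And>k. k < n \<Longrightarrow> (F ^^ k) ` {a<..<b} \<inter> T = {}) \<Longrightarrow>
      x \<in> {a<..<b} \<Longrightarrow> y \<in> {a<..<b} \<Longrightarrow> x' \<in> {a<..<b} \<Longrightarrow> y' \<in> {a<..<b} \<Longrightarrow>
      \<bar>(F ^^ n) x - (F ^^ n) y\<bar> * \<bar>x' - y'\<bar> \<le> \<Delta> * \<bar>(F ^^ n) x' - (F ^^ n) y'\<bar> * \<bar>x - y\<bar>"
begin

section \<open>Cut points and the growth of branches\<close>

lemma T_closed: "closed T"
  using T_fin by (rule locally_finite_imp_closed)

definition cuts :: "nat \<Rightarrow> real set" where
  "cuts n = {x. \<exists>k<n. (F ^^ k) x \<in> T}"

definition nbhd :: "real \<Rightarrow> real set" where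
  "nbhd r = {x. \<exists>s\<in>T. \<bar>x - s\<bar> < r}"

text \<open>The radius at time \<open>k\<close> is \<open>\<epsilon>\<close> pulled back through the
  \<open>n - k\<close> remaining steps of expansion. Outside this set a branch reaches size
  \<open>\<epsilon>\<close> at time \<open>n\<close> (\<open>growth\<close>), and the radii form a
  geometric series.\<close>

definition near_cut :: "nat \<Rightarrow> real \<Rightarrow> real set" where
  "near_cut n \<epsilon> = (\<Union>k<n. (F ^^ k) -` nbhd (\<epsilon> / \<gamma> ^ (n - k)))"

lemma cuts_Suc: "cuts (Suc n) = cuts n \<union> (F ^^ n) -` T"
  by (auto simp: cuts_def less_Suc_eq)

lemma cuts_closed: "closed (cuts n)"
proof -
  have "cuts n = (\<Union>k<n. (F ^^ k) -` T)" by (auto simp: cuts_def)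
  moreover have "closed ((F ^^ k) -` T)" for k
    using T_closed continuous_funpow by (simp add: continuous_closed_vimage isCont_funpow)
  ultimately show ?thesis by auto
qed

lemma nbhd_open: "open (nbhd r)"
proof -
  have "nbhd r = (\<Union>s\<in>T. ball s r)" by (auto simp: nbhd_def dist_real_def abs_minus_commute)
  then show ?thesis by auto
qed

lemma nbhd_borel: "nbhd r \<in> sets borel"
  using nbhd_open by simp

lemma nbhd_periodic: "periodic (nbhd r)"
  unfolding periodic_def nbhd_def
proof (intro allI iffI; clarsimp)
  fix x s assume "s \<in> T" "\<bar>x + 1 - s\<bar> < r"
  then show "\<exists>s\<in>T. \<bar>x - s\<bar> < r"
    using periodic_add_int[OF T_per, of s "-1"] by (intro bexI[of _ "s - 1"]) auto
next
  fix x s assume "s \<in> T" "\<bar>x - s\<bar> < r"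
  then show "\<exists>s\<in>T. \<bar>x + 1 - s\<bar> < r"
    using periodic_add_int[OF T_per, of s 1] by (intro bexI[of _ "s + 1"]) auto
qed

lemma near_cut_borel: "near_cut n \<epsilon> \<in> sets borel"
  unfolding near_cut_def by (intro sets.finite_UN) (auto intro: vimage_funpow_borel nbhd_borel)

lemma mu_nbhd: "\<exists>c>0. \<forall>r>0. mu (nbhd r) \<le> c * r"
proof -
  define I where "I = T \<inter> {-1..2}"
  have I: "finite I" unfolding I_def by (rule T_fin)
  \<comment> \<open>The summand 1 makes \<open>c\<close> positive and covers \<open>r > 1\<close>,
    where the measure is at most \<open>1 < r\<close>.\<close>
  define c where "c = 2 * real (card I) + 1"
  have "mu (nbhd r) \<le> c * r" if r: "r > 0" for r
  proof (cases "r \<le> 1")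
    case True
    have "nbhd r \<inter> {0..<1} \<subseteq> (\<Union>s\<in>I. ball s r)"
    proof
      fix x assume "x \<in> nbhd r \<inter> {0..<1}"
      then obtain s where "s \<in> T" "\<bar>x - s\<bar> < r" "0 \<le> x" "x < 1" by (auto simp: nbhd_def)
      then show "x \<in> (\<Union>s\<in>I. ball s r)"
        using True by (intro UN_I[of s]) (auto simp: I_def dist_real_def)
    qed
    moreover have "(\<Union>s\<in>I. ball s r) \<in> fmeasurable lborel"
    proof (rule fmeasurable.finite_UN[OF I])
      show "ball s r \<in> fmeasurable lborel" for s
        using emeasure_lborel_ball_finite[of s r] by (simp add: fmeasurable_def)
    qed
    ultimately have "mu (nbhd r) \<le> measure lborel (\<Union>s\<in>I. ball s r)"
      unfolding mu_def using nbhd_borel by (intro measure_mono_fmeasurable) auto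
    also have "\<dots> \<le> (\<Sum>s\<in>I. measure lborel (ball s r))"
      using I by (intro measure_UNION_le) auto
    also have "\<dots> = (\<Sum>s\<in>I. 2 * r)"
      using r by (intro sum.cong) (auto simp: ball_eq_greaterThanLessThan)
    also have "\<dots> \<le> c * r" using r by (simp add: c_def algebra_simps)
    finally show ?thesis .
  next
    case False
    have "mu (nbhd r) \<le> 1" using nbhd_borel by (rule mu_le_1)
    also have "\<dots> \<le> 1 * r" using False by simp
    also have "\<dots> \<le> c * r" using r by (intro mult_right_mono) (auto simp: c_def)
    finally show ?thesis .
  qed
  moreover have "c > 0" by (simp add: c_def)
  ultimately show ?thesis by blast
qed

text \<open>Taking preimages under \<open>F ^^ k\<close> does not change \<open>mu\<close>, so the
  layers have measure at most \<open>c * \<epsilon> / \<gamma> ^ j\<close> for \<open>j\<close> from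
  1 to \<open>n\<close>. Their sum stays below \<open>c * \<epsilon> / (\<gamma> - 1)\<close> for
  every \<open>n\<close>.\<close>

lemma mu_near_cut: "\<exists>c>0. \<forall>n \<epsilon>. \<epsilon> > 0 \<longrightarrow> mu (near_cut n \<epsilon>) \<le> c * \<epsilon>"
proof -
  obtain c where c: "c > 0" "\<And>r. r > 0 \<Longrightarrow> mu (nbhd r) \<le> c * r" using mu_nbhd by blast
  have "mu (near_cut n \<epsilon>) \<le> c / (\<gamma> - 1) * \<epsilon>" if \<epsilon>: "\<epsilon> > 0" for n \<epsilon>
  proof -
    have "mu (near_cut n \<epsilon>) \<le> (\<Sum>k<n. mu ((F ^^ k) -` nbhd (\<epsilon> / \<gamma> ^ (n - k))))"
      unfolding near_cut_def by (intro mu_UN_le) (auto intro: vimage_funpow_borel nbhd_borel)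
    also have "\<dots> = (\<Sum>k<n. mu (nbhd (\<epsilon> / \<gamma> ^ (n - k))))"
      by (simp add: preserve_funpow nbhd_borel nbhd_periodic)
    also have "\<dots> \<le> (\<Sum>k<n. c * (\<epsilon> / \<gamma> ^ (n - k)))"
      using \<epsilon> \<gamma> by (intro sum_mono c) auto
    also have "\<dots> = (\<Sum>k<n. c * (\<epsilon> / \<gamma> ^ Suc k))"
      by (subst sum.nat_diff_reindex[symmetric]) (auto intro!: sum.cong simp: Suc_diff_Suc)
    also have "\<dots> \<le> c * \<epsilon> / (\<gamma> - 1) * (1 - (1 / \<gamma>) ^ n)"
    proof -
      have "(\<Sum>k<n. c * (\<epsilon> / \<gamma> ^ Suc k)) = c * \<epsilon> / (\<gamma> - 1) * (1 - (1 / \<gamma>) ^ n)"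
      proof (induction n)
        case (Suc n)
        have "c * \<epsilon> / (\<gamma> - 1) * (1 - q) + c * (\<epsilon> * (q / \<gamma>)) = c * \<epsilon> / (\<gamma> - 1) * (1 - q / \<gamma>)" for q
          using \<gamma> by (simp add: field_simps)
        from this[of "(1 / \<gamma>) ^ n"] show ?case
          by (simp only: sum.lessThan_Suc Suc.IH) (simp add: power_divide mult.commute)
      qed simp
      then show ?thesis by simp
    qed
    also have "\<dots> \<le> c * \<epsilon> / (\<gamma> - 1) * 1"
      using c \<epsilon> \<gamma> by (intro mult_left_mono) auto
    finally show ?thesis by simp
  qed
  moreover have "c / (\<gamma> - 1) > 0" using c \<gamma> by simp
  ultimately show ?thesis by blast
qed

text \<open>One step less of expansion means replacing \<open>\<epsilon>\<close> by
  \<open>\<epsilon> / \<gamma>\<close>; the induction in \<open>growth\<close> runs on this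
  recursion.\<close>

lemma near_cut_Suc: "x \<notin> near_cut (Suc n) \<epsilon> \<Longrightarrow> x \<notin> near_cut n (\<epsilon> / \<gamma>) \<and> (F ^^ n) x \<notin> nbhd (\<epsilon> / \<gamma>)"
  by (force simp: near_cut_def Suc_diff_le less_Suc_eq)

text \<open>At time \<open>n\<close> the branch reaches size
  \<open>r = \<epsilon> / \<gamma>\<close>; stop it at the first \<open>b'\<close> where the
  distance equals \<open>r\<close>. As \<open>(F ^^ n) x\<close> is at least \<open>r\<close> away
  from \<open>T\<close>, nothing before \<open>b'\<close> is cut, and the next step expands
  \<open>r\<close> to \<open>\<epsilon>\<close>. The interval is half-open because the image of
  \<open>b'\<close> may itself lie in \<open>T\<close>.\<close>

lemma growth:
  assumes "\<epsilon> > 0" "x \<notin> near_cut n \<epsilon>"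
  shows "\<exists>b>x. {x..<b} \<inter> cuts n = {} \<and> \<bar>(F ^^ n) b - (F ^^ n) x\<bar> \<ge> \<epsilon>"
  using assms
proof (induction n arbitrary: \<epsilon>)
  case 0
  then show ?case by (intro exI[of _ "x + \<epsilon>"]) (auto simp: cuts_def)
next
  case (Suc n)
  define r where "r = \<epsilon> / \<gamma>"
  have r: "r > 0" using Suc.prems \<gamma> by (simp add: r_def)
  have x: "x \<notin> near_cut n r" "(F ^^ n) x \<notin> nbhd r"
    using near_cut_Suc Suc.prems by (auto simp: r_def)
  define g where "g t = \<bar>(F ^^ n) t - (F ^^ n) x\<bar>" for t
  have g: "continuous_on A g" for A
    unfolding g_def by (intro continuous_intros continuous_on_subset[OF continuous_funpow]) auto
  obtain b where b: "b > x" "{x..<b} \<inter> cuts n = {}" "g b \<ge> r"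
    using Suc.IH[OF r x(1)] by (auto simp: g_def)
  have gx: "g x = 0" by (simp add: g_def)
  \<comment> \<open>The least element of this compact set is the first point at distance exactly
    \<open>r\<close>.\<close>
  define Z where "Z = {x..b} \<inter> g -` {r}"
  have ivt: "\<exists>t. x \<le> t \<and> t \<le> s \<and> g t = r" if "x \<le> s" "g s \<ge> r" for s
    using IVT'[of g x r s] that gx r g by auto
  have Zne: "Z \<noteq> {}" using ivt[of b] b by (auto simp: Z_def)
  have Zc: "compact Z"
    unfolding Z_def using continuous_closed_preimage[OF g[of "{x..b}"], of "{r}"]
    by (simp add: compact_eq_bounded_closed bounded_Int)
  obtain b' where b': "b' \<in> Z" "\<And>t. t \<in> Z \<Longrightarrow> b' \<le> t"
    using compact_attains_inf[OF Zc Zne] by blast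
  have gb': "g b' = r" "b' \<le> b" "x \<le> b'" using b'(1) by (auto simp: Z_def)
  then have "x < b'" using gx r by (cases "x = b'") auto
  have less: "g t < r" if t: "t \<in> {x..<b'}" for t
  proof (rule ccontr)
    assume "\<not> g t < r"
    then obtain t' where "x \<le> t'" "t' \<le> t" "g t' = r" using ivt[of t] t by auto
    then have "t' \<in> Z" using t gb' by (auto simp: Z_def)
    then show False using b'(2) \<open>t' \<le> t\<close> t by force
  qed
  have far: "\<bar>(F ^^ n) x - s\<bar> \<ge> r" if "s \<in> T" for s
    using x(2) that by (auto simp: nbhd_def not_less)
  have "{x..<b'} \<inter> cuts (Suc n) = {}"
  proof -
    have "(F ^^ n) t \<notin> T" if "t \<in> {x..<b'}" for t
      using less[OF that] far[of "(F ^^ n) t"] by (auto simp: g_def abs_minus_commute)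
    moreover have "{x..<b'} \<subseteq> {x..<b}" using gb' by auto
    ultimately show ?thesis using b(2) unfolding cuts_Suc by blast
  qed
  moreover have "\<bar>(F ^^ Suc n) b' - (F ^^ Suc n) x\<bar> \<ge> \<epsilon>"
  proof -
    have "{min ((F ^^ n) b') ((F ^^ n) x)<..<max ((F ^^ n) b') ((F ^^ n) x)} \<inter> T = {}"
    proof -
      have "s \<notin> T" if "s \<in> {min ((F ^^ n) b') ((F ^^ n) x)<..<max ((F ^^ n) b') ((F ^^ n) x)}" for s
      proof
        assume "s \<in> T"
        then have "\<bar>(F ^^ n) x - s\<bar> \<ge> r" by (rule far)
        moreover have "\<bar>(F ^^ n) x - s\<bar> < g b'" using that by (auto simp: g_def min_def max_def split: if_splits)
        ultimately show False using gb' by simp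
      qed
      then show ?thesis by blast
    qed
    from expand[OF this] have "\<gamma> * r \<le> \<bar>F ((F ^^ n) b') - F ((F ^^ n) x)\<bar>"
      using gb' by (simp add: g_def)
    then show ?thesis using \<gamma> by (simp add: r_def)
  qed
  ultimately show ?case using \<open>x < b'\<close> by blast
qed

lemma image_avoids_T:
  assumes "{a<..<b} \<inter> cuts n = {}" "k < n"
  shows "(F ^^ k) ` {a<..<b} \<inter> T = {}"
  using assms by (auto simp: cuts_def)

lemma between_avoids_T:
  assumes "{a<..<b} \<inter> cuts n = {}" "k < n" "x \<in> {a<..<b}" "y \<in> {a<..<b}"
  shows "{min ((F ^^ k) x) ((F ^^ k) y)<..<max ((F ^^ k) x) ((F ^^ k) y)} \<inter> T = {}"
proof -
  have "{min x y<..<max x y} \<subseteq> {a<..<b}" using assms(3,4) by auto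
  then have "(F ^^ k) ` {min x y<..<max x y} \<subseteq> (F ^^ k) ` {a<..<b}" by blast
  with Ioo_subset_funpow_image[of k x y]
  have "{min ((F ^^ k) x) ((F ^^ k) y)<..<max ((F ^^ k) x) ((F ^^ k) y)} \<subseteq> (F ^^ k) ` {a<..<b}" by blast
  then show ?thesis using image_avoids_T[OF assms(1,2)] by blast
qed

lemma expand_funpow:
  assumes "{a<..<b} \<inter> cuts n = {}" "x \<in> {a<..<b}" "y \<in> {a<..<b}"
  shows "\<gamma> ^ n * \<bar>x - y\<bar> \<le> \<bar>(F ^^ n) x - (F ^^ n) y\<bar>"
  using assms
proof (induction n)
  case (Suc n)
  have c: "{a<..<b} \<inter> cuts n = {}" using Suc.prems(1) by (auto simp: cuts_Suc)
  have "\<gamma> ^ Suc n * \<bar>x - y\<bar> = \<gamma> * (\<gamma> ^ n * \<bar>x - y\<bar>)" by simp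
  also have "\<dots> \<le> \<gamma> * \<bar>(F ^^ n) x - (F ^^ n) y\<bar>"
    using Suc.IH[OF c Suc.prems(2,3)] \<gamma> by (intro mult_left_mono) auto
  also have "\<dots> \<le> \<bar>(F ^^ Suc n) x - (F ^^ Suc n) y\<bar>"
    using expand[OF between_avoids_T[OF Suc.prems(1) lessI Suc.prems(2,3)]] by simp
  finally show ?case .
qed simp

text \<open>One step before time \<open>n\<close> the image still avoids \<open>T\<close>, which
  meets every interval longer than 1; the last step multiplies lengths by at most
  \<open>K\<close>.\<close>

lemma image_short:
  assumes "{a<..<b} \<inter> cuts n = {}" "n \<ge> 1" "x \<in> {a<..<b}" "y \<in> {a<..<b}"
  shows "\<bar>(F ^^ n) x - (F ^^ n) y\<bar> \<le> K"
proof -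
  obtain m where m: "n = Suc m" using assms(2) by (cases n) auto
  have "\<bar>(F ^^ m) x - (F ^^ m) y\<bar> \<le> 1"
  proof -
    have "\<not> max ((F ^^ m) x) ((F ^^ m) y) - min ((F ^^ m) x) ((F ^^ m) y) > 1"
      using periodic_meets_interval[OF T_per T_ne] between_avoids_T[OF assms(1) _ assms(3,4), of m] m by blast
    then show ?thesis by (auto simp: min_def max_def split: if_splits)
  qed
  then have "K * \<bar>(F ^^ m) x - (F ^^ m) y\<bar> \<le> K * 1" using K by (intro mult_left_mono) auto
  then show ?thesis using lip[of "(F ^^ m) x" "(F ^^ m) y"] m by simp
qed

text \<open>
  A substitute for the Lebesgue density theorem: \<open>A\<close> is nearly full in an open \<open>V \<supseteq> A\<close>, hence
  nearly full in one of the disjoint components of \<open>V\<close> minus the cuts with a long image.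
\<close>

lemma dense_long_component:
  assumes A: "A \<in> sets borel" and pos: "mu A > 0" and \<eta>: "\<eta> > 0"
    and \<epsilon>: "\<epsilon> > 0" "\<And>n. mu (near_cut n \<epsilon>) \<le> mu A / 3"
  shows "\<exists>n\<ge>1. \<exists>p q. p < q \<and> {p<..<q} \<inter> cuts n = {} \<and>
    (\<exists>x\<in>{p<..<q}. \<exists>y\<in>{p<..<q}. (F ^^ n) y - (F ^^ n) x \<ge> \<epsilon> / 2) \<and>
    measure lborel ({p<..<q} - A) \<le> \<eta> * (q - p)"
proof (rule ccontr)
  assume neg: "\<not> ?thesis"
  \<comment> \<open>The point 0, of measure zero, is dropped so that the open superset can be taken
    inside \<open>{0<..<1}\<close>, as \<open>eroded_open\<close> requires.\<close>
  define A1 where "A1 = A \<inter> {0<..<1}"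
  have A1: "A1 \<in> sets borel" using A by (simp add: A1_def)
  have mA1: "measure lborel A1 = mu A"
  proof -
    have 1: "A1 \<subseteq> A \<inter> {0..<1}" "A \<inter> {0..<1} \<subseteq> insert 0 A1" by (auto simp: A1_def less_le)
    have f: "A1 \<in> fmeasurable lborel"
      by (rule fmeasurableI2[OF fmeasurable_unit_Int[OF A]]) (use A1 1 in auto)
    have "measure lborel A1 \<le> mu A"
      unfolding mu_def using 1 A A1 by (intro measure_mono_fmeasurable fmeasurable_unit_Int) auto
    moreover have "mu A \<le> measure lborel ({0} \<union> A1)"
      unfolding mu_def using 1 A f by (intro measure_mono_fmeasurable fmeasurable.Un) (auto simp: fmeasurable_def)
    moreover have "measure lborel ({0} \<union> A1) \<le> measure lborel {0::real} + measure lborel A1"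
      using A1 by (intro measure_Un_le) auto
    ultimately show ?thesis by simp
  qed
  \<comment> \<open>The factor 1/4 is chosen to be below the 1/3 that the good components turn out
    to keep.\<close>
  obtain V0 where V0: "open V0" "A1 \<subseteq> V0" "emeasure lborel (V0 - A1) < ennreal (\<eta> * mu A / 4)"
    using outer_regular_lborel[OF A1, of "\<eta> * mu A / 4"] \<eta> pos by auto
  define V where "V = V0 \<inter> {0<..<1}"
  have V: "open V" "A1 \<subseteq> V" "V \<subseteq> {0<..<1}" using V0 by (auto simp: V_def A1_def)
  have Vf: "X \<in> fmeasurable lborel" if "X \<in> sets borel" "X \<subseteq> V" for X
    by (rule fmeasurableI2[of "{0..1}"]) (use V that in \<open>auto simp: fmeasurable_def\<close>)
  have VA: "measure lborel (V - A) < \<eta> * mu A / 4"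
  proof -
    have "V - A \<subseteq> V0 - A1" by (auto simp: V_def A1_def)
    then have "emeasure lborel (V - A) < ennreal (\<eta> * mu A / 4)"
      using V0 A1 by (intro le_less_trans[OF emeasure_mono V0(3)]) auto
    moreover have "emeasure lborel (V - A) = ennreal (measure lborel (V - A))"
      using Vf[of "V - A"] A V by (intro emeasure_eq_ennreal_measure) (auto simp: fmeasurable_def)
    ultimately show ?thesis by (simp add: ennreal_less_iff)
  qed
  \<comment> \<open>Erosion costs at most a third of \<open>mu A\<close>, and the points near cuts
    another third, so at least a third is left to the good components.\<close>
  obtain r W where r: "r > 0" and W: "W \<in> sets borel" "\<And>x. x \<in> W \<Longrightarrow> ball x r \<subseteq> V"
    "measure lborel W > measure lborel V - mu A / 3"
    using eroded_open[OF V(1,3), of "mu A / 3"] pos by auto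
  have WV: "W \<subseteq> V" using W(2) r by force
  \<comment> \<open>Components of the uncut set have length at most \<open>K / \<gamma> ^ n\<close>;
    \<open>n\<close> is taken so large that this is below the erosion radius
    \<open>r\<close>.\<close>
  obtain n0 where n0: "K / r < \<gamma> ^ n0" using real_arch_pow[OF \<gamma>] by blast
  define n where "n = Suc n0"
  have "\<gamma> ^ n0 \<le> \<gamma> ^ n" using \<gamma> by (intro power_increasing) (auto simp: n_def)
  then have "\<gamma> ^ n0 * r \<le> \<gamma> ^ n * r" using r by (intro mult_right_mono) auto
  then have n: "n \<ge> 1" "K < \<gamma> ^ n * r" using n0 r by (auto simp: n_def pos_divide_less_eq)
  have openc: "open (- cuts n)" using cuts_closed by (simp add: open_Compl)
  have comp: "\<exists>p q. p < q \<and> C = {p<..<q} \<and> {p<..<q} \<inter> cuts n = {} \<and> q - p < r"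
    if C: "C \<in> components (- cuts n)" for C
  proof -
    have sub: "C \<subseteq> - cuts n" using C by (rule in_components_subset)
    have conn: "connected C" using C by (rule in_components_connected)
    have diam: "\<bar>x - y\<bar> \<le> K / \<gamma> ^ n" if xy: "x \<in> C" "y \<in> C" for x y
    proof -
      \<comment> \<open>The expansion estimate needs both points strictly inside an uncut interval,
        so the segment between them is enlarged a little within the open set
        \<open>C\<close>.\<close>
      obtain e where e: "e > 0" "ball x e \<subseteq> C" "ball y e \<subseteq> C"
      proof -
        have "open C" using open_components[OF openc C] .
        then obtain e1 e2 where "e1 > 0" "ball x e1 \<subseteq> C" "e2 > 0" "ball y e2 \<subseteq> C"
          using xy by (meson openE)
        then show ?thesis by (intro that[of "min e1 e2"]) auto
      qed
      have "x - e/2 \<in> C" "x + e/2 \<in> C" "y - e/2 \<in> C" "y + e/2 \<in> C"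
        using e by (auto simp: subset_iff dist_real_def)
      then have "{min x y - e/2..max x y + e/2} \<subseteq> C"
        using conn by (intro connected_contains_Icc) (auto simp: min_def max_def)
      then have "{min x y - e/2<..<max x y + e/2} \<inter> cuts n = {}"
        using sub greaterThanLessThan_subseteq_atLeastAtMost_iff[of "min x y - e/2" "max x y + e/2" "min x y - e/2" "max x y + e/2"]
        by blast
      moreover have "x \<in> {min x y - e/2<..<max x y + e/2}" "y \<in> {min x y - e/2<..<max x y + e/2}"
        using e(1) by auto
      ultimately have "\<gamma> ^ n * \<bar>x - y\<bar> \<le> K"
        using expand_funpow image_short n(1) order_trans by meson
      then show ?thesis using \<gamma> by (simp add: field_simps)
    qed
    obtain w where "C \<subseteq> {w..w + K / \<gamma> ^ n}" using subset_interval_of_diameter[OF diam] by blast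
    then have "bounded C" by (rule bounded_subset[OF bounded_closed_interval])
    then obtain p q where pq: "p < q" "C = {p<..<q}"
      using open_connected_bounded_real[OF open_components[OF openc C] conn] in_components_nonempty[OF C] by blast
    have "{p<..<q} \<subseteq> {w..w + K / \<gamma> ^ n}" using pq \<open>C \<subseteq> {w..w + K / \<gamma> ^ n}\<close> by simp
    then have "q - p \<le> K / \<gamma> ^ n"
      using pq(1) by (subst (asm) greaterThanLessThan_subseteq_atLeastAtMost_iff) auto
    also have "\<dots> < r" using n(2) \<gamma> by (simp add: field_simps)
    finally show ?thesis using pq sub by blast
  qed
  \<comment> \<open>The good components: contained in \<open>V\<close> and with a long image. By the
    assumed negation, \<open>A\<close> misses more than the fraction \<open>\<eta>\<close> of each
    of them.\<close>
  define \<C> where "\<C> = {C \<in> components (- cuts n). C \<subseteq> V \<and> (\<exists>x\<in>C. \<exists>y\<in>C. (F ^^ n) y - (F ^^ n) x \<ge> \<epsilon> / 2)}"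
  have each: "ennreal \<eta> * emeasure lborel C \<le> emeasure lborel (C - A)" if CC: "C \<in> \<C>" for C
  proof -
    obtain p q where pq: "p < q" "C = {p<..<q}" "{p<..<q} \<inter> cuts n = {}"
      using comp[of C] CC by (auto simp: \<C>_def)
    have "\<eta> * (q - p) < measure lborel ({p<..<q} - A)"
    proof (rule ccontr)
      assume "\<not> ?thesis"
      then have m: "measure lborel ({p<..<q} - A) \<le> \<eta> * (q - p)" by (simp add: not_less)
      have e: "\<exists>x\<in>{p<..<q}. \<exists>y\<in>{p<..<q}. (F ^^ n) y - (F ^^ n) x \<ge> \<epsilon> / 2"
        using CC pq(2) by (simp add: \<C>_def)
      show False
        by (rule notE[OF neg], intro exI[of _ n] exI[of _ p] exI[of _ q] conjI n(1) pq(1,3) e m)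
    qed
    moreover have "emeasure lborel (C - A) = ennreal (measure lborel (C - A))"
    proof -
      have "C - A \<subseteq> V" using CC by (auto simp: \<C>_def)
      moreover have "C - A \<in> sets borel" using A pq(2) by simp
      ultimately show ?thesis
        using Vf[of "C - A"] by (intro emeasure_eq_ennreal_measure) (auto simp: fmeasurable_def)
    qed
    ultimately show ?thesis using \<eta> pq by (simp add: ennreal_mult'[symmetric] ennreal_leI)
  qed
  have "countable \<C>" "disjoint \<C>"
  proof -
    show "disjoint \<C>"
      using pairwise_disjoint_components[of "- cuts n"] unfolding disjnt_def[abs_def]
      by (rule pairwise_mono) (auto simp: \<C>_def)
    then show "countable \<C>"
      using open_components[OF openc] by (intro countable_disjoint_open_subsets) (auto simp: \<C>_def)
  qed
  from disjoint_sequence_of_countable[OF this]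
  obtain D :: "nat \<Rightarrow> real set" where "disjoint_family D \<and> (\<Union>n. D n) = \<Union>\<C> \<and> (\<forall>n. D n = {} \<or> D n \<in> \<C>)" ..
  then have D: "disjoint_family D" "(\<Union>n. D n) = \<Union>\<C>" "\<And>n. D n = {} \<or> D n \<in> \<C>" by auto
  have Do: "D i \<in> sets lborel" for i
    using D(3)[of i] open_components[OF openc] by (auto simp: \<C>_def)
  have UC: "\<Union>\<C> \<in> sets borel" "\<Union>\<C> \<subseteq> V"
    using open_components[OF openc] by (auto simp: \<C>_def intro!: borel_open open_Union)
  have "ennreal \<eta> * emeasure lborel (\<Union>\<C>) = (\<Sum>i. ennreal \<eta> * emeasure lborel (D i))"
    using suminf_emeasure[of D lborel] D(1,2) Do by (simp add: image_subset_iff)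
  also have "\<dots> \<le> (\<Sum>i. emeasure lborel (D i - A))"
  proof (rule suminf_le)
    show "ennreal \<eta> * emeasure lborel (D i) \<le> emeasure lborel (D i - A)" for i
      using D(3)[of i] each by auto
  qed auto
  also have "\<dots> = emeasure lborel (\<Union>i. D i - A)"
    using D(1) Do A by (intro suminf_emeasure) (auto simp: disjoint_family_on_def)
  also have "\<dots> \<le> emeasure lborel (V - A)"
    using D(2) UC V(1) A by (intro emeasure_mono) auto
  finally have "ennreal \<eta> * emeasure lborel (\<Union>\<C>) \<le> emeasure lborel (V - A)" .
  moreover have "emeasure lborel (\<Union>\<C>) = ennreal (measure lborel (\<Union>\<C>))" "emeasure lborel (V - A) = ennreal (measure lborel (V - A))"
    using Vf[OF UC] Vf[of "V - A"] V(1) A by (auto intro!: emeasure_eq_ennreal_measure simp: fmeasurable_def)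
  ultimately have le: "\<eta> * measure lborel (\<Union>\<C>) \<le> measure lborel (V - A)"
    using \<eta> by (simp add: ennreal_mult'[symmetric])
  have cover: "W \<subseteq> \<Union>\<C> \<union> near_cut n \<epsilon> \<inter> {0..<1}"
  proof
    fix x assume x: "x \<in> W"
    show "x \<in> \<Union>\<C> \<union> near_cut n \<epsilon> \<inter> {0..<1}"
    proof (cases "x \<in> near_cut n \<epsilon>")
      case True
      then show ?thesis using x WV V(3) by force
    next
      case False
      then obtain b where b: "x < b" "{x..<b} \<inter> cuts n = {}" "\<bar>(F ^^ n) b - (F ^^ n) x\<bar> \<ge> \<epsilon>"
        using growth[OF \<epsilon>(1)] by blast
      define C where "C = connected_component_set (- cuts n) x"
      have "x \<in> - cuts n" using b by auto
      then have C: "C \<in> components (- cuts n)" "x \<in> C"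
        by (auto simp: C_def componentsI)
      have bC: "{x..<b} \<subseteq> C"
        unfolding C_def using b by (intro connected_component_maximal) auto
      obtain p q where pq: "p < q" "C = {p<..<q}" "q - p < r" using comp[OF C(1)] by blast
      have "C \<subseteq> ball x r" using pq C(2) by (auto simp: dist_real_def)
      then have "C \<subseteq> V" using W(2)[OF x] by blast
      \<comment> \<open>The point \<open>b\<close> given by \<open>growth\<close> may be a cut and
        lie outside \<open>C\<close>. Points just to its left are in \<open>C\<close>, and by
        continuity they still reach \<open>\<epsilon> / 2\<close>; the loss of a half originates
        here.\<close>
      moreover have "\<exists>y\<in>C. \<bar>(F ^^ n) y - (F ^^ n) x\<bar> \<ge> \<epsilon> / 2"
      proof (rule ccontr)
        assume "\<not> ?thesis"
        then have small: "\<bar>(F ^^ n) y - (F ^^ n) x\<bar> < \<epsilon> / 2" if "y \<in> {x..<b}" for y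
          using bC that by (meson not_le subsetD)
        have "((\<lambda>y. \<bar>(F ^^ n) y - (F ^^ n) x\<bar>) \<longlongrightarrow> \<bar>(F ^^ n) b - (F ^^ n) x\<bar>) (at_left b)"
          using isCont_funpow by (intro tendsto_intros) (simp add: isCont_def filterlim_at_split)
        moreover have "eventually (\<lambda>y. \<bar>(F ^^ n) y - (F ^^ n) x\<bar> \<le> \<epsilon> / 2) (at_left b)"
          unfolding eventually_at_left[OF b(1)]
        proof (intro exI[of _ x] conjI allI impI b(1))
          fix y assume "x < y" "y < b"
          then show "\<bar>(F ^^ n) y - (F ^^ n) x\<bar> \<le> \<epsilon> / 2" using small[of y] by simp
        qed
        ultimately have "\<bar>(F ^^ n) b - (F ^^ n) x\<bar> \<le> \<epsilon> / 2"
          by (intro tendsto_upperbound) auto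
        then show False using b(3) \<epsilon>(1) by linarith
      qed
      then obtain y where y: "y \<in> C" "\<bar>(F ^^ n) y - (F ^^ n) x\<bar> \<ge> \<epsilon> / 2" by blast
      then have "(F ^^ n) y - (F ^^ n) x \<ge> \<epsilon> / 2 \<or> (F ^^ n) x - (F ^^ n) y \<ge> \<epsilon> / 2" by linarith
      then have "\<exists>x\<in>C. \<exists>y\<in>C. (F ^^ n) y - (F ^^ n) x \<ge> \<epsilon> / 2" using C(2) y(1) by blast
      ultimately have "C \<in> \<C>" using C(1) by (auto simp: \<C>_def)
      then show ?thesis using C(2) by blast
    qed
  qed
  have "measure lborel W \<le> measure lborel (\<Union>\<C> \<union> near_cut n \<epsilon> \<inter> {0..<1})"
    using cover W(1) Vf[OF UC] near_cut_borel fmeasurable_unit_Int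
    by (intro measure_mono_fmeasurable fmeasurable.Un) auto
  also have "\<dots> \<le> measure lborel (\<Union>\<C>) + mu (near_cut n \<epsilon>)"
    unfolding mu_def using UC near_cut_borel by (intro measure_Un_le) auto
  also have "mu (near_cut n \<epsilon>) \<le> mu A / 3" by (rule \<epsilon>(2))
  finally have "measure lborel W \<le> measure lborel (\<Union>\<C>) + mu A / 3" by simp
  moreover have "mu A \<le> measure lborel V"
    unfolding mA1[symmetric] using V A1 Vf[of V] by (intro measure_mono_fmeasurable) auto
  ultimately have "mu A / 3 \<le> measure lborel (\<Union>\<C>)" using W(3) by simp
  \<comment> \<open>Together with \<open>le\<close> and \<open>VA\<close> this gives
    \<open>\<eta> * mu A / 3 < \<eta> * mu A / 4\<close>.\<close>
  then have "\<eta> * (mu A / 3) \<le> \<eta> * measure lborel (\<Union>\<C>)" using \<eta> by (intro mult_left_mono) auto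
  moreover have "\<eta> * mu A > 0" using \<eta> pos by simp
  ultimately show False using le VA by simp
qed

text \<open>By invariance \<open>- A\<close> has the measure of \<open>- B N\<close>, which can be
  computed over any period. On a branch \<open>{p<..<q}\<close> that \<open>A\<close> nearly fills,
  \<open>F ^^ N\<close> is Lipschitz with constant of order \<open>1 / (q - p)\<close> and its image
  covers almost a period; so the missing fraction of the branch bounds the missing part of
  \<open>B N\<close>.\<close>

theorem tail_trivial:
  assumes A: "A \<in> sets borel" and pos: "mu A > 0"
    and B: "\<And>n. B n \<in> sets borel" "\<And>n. periodic (B n)" "\<And>n. A = (F ^^ n) -` B n"
  shows "mu (- A) = 0"
proof -
  obtain c where c: "c > 0" "\<And>n \<epsilon>. \<epsilon> > 0 \<Longrightarrow> mu (near_cut n \<epsilon>) \<le> c * \<epsilon>" using mu_near_cut by blast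
  define \<epsilon> where "\<epsilon> = mu A / (3 * c)"
  have \<epsilon>: "\<epsilon> > 0" "mu (near_cut n \<epsilon>) \<le> mu A / 3" for n
    using pos c c(2)[of \<epsilon> n] by (auto simp: \<epsilon>_def)
  have "mu (- A) \<le> e" if e: "e > 0" for e
  proof -
    \<comment> \<open>The spreading time \<open>M\<close> depends only on \<open>\<epsilon>\<close>
      and \<open>e\<close>. It must be fixed before the branch is chosen, because the density
      \<open>\<eta>\<close> demanded of the branch depends on \<open>K ^ M\<close>.\<close>
    obtain M where M: "\<And>a b. b - a \<ge> \<epsilon> / 2 \<Longrightarrow>
        \<exists>x\<in>{a<..<b}. \<exists>y\<in>{a<..<b}. (F ^^ M) y - (F ^^ M) x \<ge> 1 - e / 2"
      using uniform_mixing[of "\<epsilon> / 2" "e / 2"] \<epsilon>(1) e by auto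
    \<comment> \<open>The Lipschitz constant of \<open>F ^^ N\<close> times \<open>q - p\<close>:
      \<open>\<Delta> * K\<close> bounds the stretching up to time \<open>n\<close>, 2 comes from
      reference points half the branch apart, and \<open>K ^ M\<close> from the last
      \<open>M\<close> steps. Then \<open>\<eta>\<close> is set so that
      \<open>S * \<eta> = e / 2\<close>.\<close>
    define S where "S = 2 * \<Delta> * K * K ^ M"
    have S: "S > 0" using K \<Delta> by (simp add: S_def)
    define \<eta> where "\<eta> = e / (2 * S)"
    have \<eta>: "\<eta> > 0" using e S by (simp add: \<eta>_def)
    obtain n p q x0 y0 where n: "n \<ge> 1" and pq: "p < q" "{p<..<q} \<inter> cuts n = {}"
      and xy0: "x0 \<in> {p<..<q}" "y0 \<in> {p<..<q}" "(F ^^ n) y0 - (F ^^ n) x0 \<ge> \<epsilon> / 2"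
      and small: "measure lborel ({p<..<q} - A) \<le> \<eta> * (q - p)"
      using dense_long_component[OF A pos \<eta> \<epsilon>] by blast
    obtain w z where wz: "w \<in> {(F ^^ n) x0<..<(F ^^ n) y0}" "z \<in> {(F ^^ n) x0<..<(F ^^ n) y0}"
      "(F ^^ M) z - (F ^^ M) w \<ge> 1 - e / 2"
      using M[OF xy0(3)] by blast
    have "{(F ^^ n) x0..(F ^^ n) y0} \<subseteq> (F ^^ n) ` {p<..<q}"
      using xy0 by (intro Icc_subset_funpow_image) auto
    then have "w \<in> (F ^^ n) ` {p<..<q}" "z \<in> (F ^^ n) ` {p<..<q}" using wz by auto
    then obtain x1 y1 where xy1: "x1 \<in> {p<..<q}" "y1 \<in> {p<..<q}" "w = (F ^^ n) x1" "z = (F ^^ n) y1"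
      by blast
    define N where "N = n + M"
    have FN: "(F ^^ N) x = (F ^^ M) ((F ^^ n) x)" for x
      unfolding N_def by (metis add.commute comp_apply funpow_add)
    define u where "u = (F ^^ N) x1"
    \<comment> \<open>The image may be longer than one period; it is truncated to one, of which at
      most \<open>e / 2\<close> remains uncovered.\<close>
    define v where "v = min ((F ^^ N) y1) (u + 1)"
    have v: "v \<ge> u + 1 - e / 2" "v \<le> u + 1"
      using wz(3) xy1 e by (auto simp: u_def v_def FN)
    have img: "{u..v} \<subseteq> (F ^^ N) ` {p<..<q}"
      using Icc_subset_funpow_image[of "{p<..<q}" x1 y1 N] xy1 by (auto simp: u_def v_def)
    define L where "L = S / (q - p)"
    have L: "\<bar>(F ^^ N) x - (F ^^ N) y\<bar> \<le> L * \<bar>x - y\<bar>" if "x \<in> {p<..<q}" "y \<in> {p<..<q}" for x y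
    proof -
      \<comment> \<open>Reference points for the distortion bound: their images are at most
        \<open>K\<close> apart by \<open>image_short\<close>, so the difference quotient there is at
        most \<open>2 * K / (q - p)\<close>.\<close>
      define x' y' where "x' = p + (q - p) / 4" and "y' = p + 3 * (q - p) / 4"
      have xy': "x' \<in> {p<..<q}" "y' \<in> {p<..<q}" "\<bar>x' - y'\<bar> = (q - p) / 2"
        using pq(1) by (auto simp: x'_def y'_def field_simps)
      have "\<bar>(F ^^ n) x - (F ^^ n) y\<bar> * \<bar>x' - y'\<bar> \<le> \<Delta> * \<bar>(F ^^ n) x' - (F ^^ n) y'\<bar> * \<bar>x - y\<bar>"
        by (rule distortion[OF image_avoids_T[OF pq(2)] that xy'(1,2)])
      also have "\<dots> \<le> \<Delta> * K * \<bar>x - y\<bar>"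
        using image_short[OF pq(2) n xy'(1,2)] \<Delta> by (intro mult_right_mono mult_left_mono) auto
      finally have "\<bar>(F ^^ n) x - (F ^^ n) y\<bar> \<le> 2 * \<Delta> * K / (q - p) * \<bar>x - y\<bar>"
        using pq(1) unfolding xy'(3) by (simp add: field_simps)
      then have "K ^ M * \<bar>(F ^^ n) x - (F ^^ n) y\<bar> \<le> K ^ M * (2 * \<Delta> * K / (q - p) * \<bar>x - y\<bar>)"
        using K by (intro mult_left_mono) auto
      then have "\<bar>(F ^^ N) x - (F ^^ N) y\<bar> \<le> K ^ M * (2 * \<Delta> * K / (q - p) * \<bar>x - y\<bar>)"
        using lipschitz_funpow[OF lip _, of M "(F ^^ n) x" "(F ^^ n) y"] K by (simp add: FN)
      also have "\<dots> = L * \<bar>x - y\<bar>" by (simp add: L_def S_def field_simps)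
      finally show ?thesis .
    qed
    have nB: "- B N \<in> sets borel" "periodic (- B N)"
      using B(1,2)[of N] by (auto simp: periodic_def)
    have vA: "(F ^^ N) -` (- B N) = - A" using B(3)[of N] by auto
    have "mu (- A) = mu (- B N)"
      using preserve_funpow[OF nB, of N] by (simp add: vA)
    also have "\<dots> = measure lborel (- B N \<inter> {u..<u+1})"
      by (rule mu_window[OF nB, symmetric])
    also have "\<dots> \<le> measure lborel ((- B N \<inter> {u..v}) \<union> {v..u+1})"
    proof (rule measure_mono_fmeasurable)
      show "(- B N \<inter> {u..v}) \<union> {v..u+1} \<in> fmeasurable lborel"
      proof (rule fmeasurableI2)
        show "{min u v..u+1} \<in> fmeasurable lborel" by (simp add: fmeasurable_def emeasure_lborel_Icc_eq)
        show "(- B N \<inter> {u..v}) \<union> {v..u+1} \<subseteq> {min u v..u+1}" using v(2) by force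
        show "(- B N \<inter> {u..v}) \<union> {v..u+1} \<in> sets lborel" using nB(1) by simp
      qed
      show "- B N \<inter> {u..<u+1} \<subseteq> (- B N \<inter> {u..v}) \<union> {v..u+1}" by force
      show "- B N \<inter> {u..<u+1} \<in> sets lborel" using nB(1) by simp
    qed
    also have "\<dots> \<le> measure lborel (- B N \<inter> {u..v}) + measure lborel {v..u+1}"
      using nB(1) by (intro measure_Un_le) auto
    also have "measure lborel {v..u+1} \<le> e / 2" using v by simp
    also have "measure lborel (- B N \<inter> {u..v}) \<le> L * measure lborel ({p<..<q} \<inter> (F ^^ N) -` (- B N))"
    proof (rule measure_le_Lipschitz_preimage[OF nB(1) _ pq(1) _ borel_funpow img])
      show "0 \<le> L" using S pq(1) by (simp add: L_def)
    qed (rule L)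
    also have "{p<..<q} \<inter> (F ^^ N) -` (- B N) = {p<..<q} - A" unfolding vA by blast
    also have "L * measure lborel ({p<..<q} - A) \<le> L * (\<eta> * (q - p))"
      using small S pq(1) by (intro mult_left_mono) (auto simp: L_def)
    also have "\<dots> = e / 2" using S pq(1) by (simp add: L_def \<eta>_def)
    finally show ?thesis by simp
  qed
  then have "mu (- A) \<le> 0" by (rule field_le_epsilon[of "mu (- A)" 0, simplified])
  then show ?thesis using mu_nonneg[of "- A"] by simp
qed

end

section \<open>Slopes of a piecewise smooth lift\<close>

text \<open>Finitely many break points are harmless, since the fundamental theorem of calculus for a
  continuous function tolerates a finite exceptional set.\<close>

lemma abs_diff_le_of_deriv_bound:
  fixes f f' :: "real \<Rightarrow> real"
  assumes "finite E" "x \<le> y" "continuous_on {x..y} f" "0 \<le> B"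
    and "\<And>t. t \<in> {x<..<y} - E \<Longrightarrow> (f has_real_derivative f' t) (at t) \<and> \<bar>f' t\<bar> \<le> B"
  shows "\<bar>f y - f x\<bar> \<le> B * (y - x)"
proof -
  define g where "g t = (if t \<in> {x<..<y} - E then f' t else 0)" for t
  have "(g has_integral (f y - f x)) {x..y}"
    by (rule fundamental_theorem_of_calculus_interior_strong[OF assms(1,2) _ assms(3)])
       (use assms(5) in \<open>auto simp: g_def has_real_derivative_iff_has_vector_derivative\<close>)
  then have "norm (f y - f x) \<le> B * measure lborel (cbox x y)"
    using assms(4,5) by (intro has_integral_bound[where f=g]) (auto simp: g_def)
  then show ?thesis using assms(2) by simp
qed

text \<open>Supplies a single radius strictly below several positive bounds.\<close>

lemma half_Min:
  fixes A :: "real set"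
  assumes "finite A" "A \<noteq> {}" "\<forall>a\<in>A. 0 < a"
  shows "0 < Min A / 2 \<and> (\<forall>a\<in>A. Min A / 2 < a)"
proof -
  have "0 < Min A" using assms by (simp add: Min_in)
  moreover have "Min A / 2 < a" if "a \<in> A" for a
    using Min_le[OF assms(1) that] \<open>0 < Min A\<close> by linarith
  ultimately show ?thesis by simp
qed

section \<open>Slopes tested by invariance on small arcs\<close>

definition circle_ball :: "real \<Rightarrow> real \<Rightarrow> real set" where
  "circle_ball c r = {w. \<exists>k::int. \<bar>w - c - of_int k\<bar> \<le> r}"

lemma circle_ball_periodic: "periodic (circle_ball c r)"
  unfolding periodic_def circle_ball_def
proof (intro allI iffI; clarsimp)
  fix x and k :: int assume "\<bar>x + 1 - c - of_int k\<bar> \<le> r"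
  then show "\<exists>k::int. \<bar>x - c - of_int k\<bar> \<le> r" by (intro exI[of _ "k - 1"]) (simp add: algebra_simps)
next
  fix x and k :: int assume "\<bar>x - c - of_int k\<bar> \<le> r"
  then show "\<exists>k::int. \<bar>x + 1 - c - of_int k\<bar> \<le> r" by (intro exI[of _ "k + 1"]) (simp add: algebra_simps)
qed

lemma circle_ball_borel: "circle_ball c r \<in> sets borel"
proof -
  have "circle_ball c r = (\<Union>k::int. {c + of_int k - r..c + of_int k + r})"
    by (auto simp: circle_ball_def abs_le_iff algebra_simps)
  then show ?thesis by simp
qed

lemma mu_circle_ball:
  assumes "0 \<le> r" "r < 1/2"
  shows "mu (circle_ball c r) = 2 * r"
proof -
  have "circle_ball c r \<inter> {c - 1/2..<c - 1/2 + 1} = {c - r..c + r}"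
  proof (intro antisym subsetI)
    fix w assume w: "w \<in> circle_ball c r \<inter> {c - 1/2..<c - 1/2 + 1}"
    then obtain k :: int where k: "\<bar>w - c - of_int k\<bar> \<le> r" by (auto simp: circle_ball_def)
    have "real_of_int k < 1" "real_of_int k > - 1" using k w assms by auto
    then have "k = 0" by linarith
    then show "w \<in> {c - r..c + r}" using k by (auto simp: abs_le_iff)
  next
    fix w assume "w \<in> {c - r..c + r}"
    then show "w \<in> circle_ball c r \<inter> {c - 1/2..<c - 1/2 + 1}"
      using assms by (auto simp: circle_ball_def intro!: exI[of _ "0::int"])
  qed
  then have "mu (circle_ball c r) = measure lborel {c - r..c + r}"
    using mu_window[OF circle_ball_borel circle_ball_periodic, of c r "c - 1/2"] by simp
  then show ?thesis using assms by simp
qed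

lemma (in circle_lift) mu_vimage_circle_ball:
  assumes "0 \<le> r" "r < 1/2"
  shows "measure lborel (F -` circle_ball c r \<inter> {u..<u+1}) = 2 * r"
proof -
  have "F -` circle_ball c r \<in> sets borel" "periodic (F -` circle_ball c r)"
    using vimage_funpow_borel[OF circle_ball_borel, of 1] periodic_vimage_funpow[OF circle_ball_periodic, of 1] by simp_all
  then show ?thesis
    using mu_window preserve[OF circle_ball_borel circle_ball_periodic] mu_circle_ball[OF assms] by simp
qed

text \<open>\<open>S\<close> lifts the break points, and \<open>h\<close> is the derivative off
  \<open>S\<close>. Of the second derivative only the Lipschitz constant \<open>\<kappa>\<close> of
  \<open>h\<close> on each piece is kept. \<open>K \<ge> 2\<close> ensures \<open>K - 1 > 0\<close>
  in the definition of \<open>\<gamma>\<close>.\<close>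

locale smooth_lift = circle_lift +
  fixes S :: "real set" and h :: "real \<Rightarrow> real" and K \<kappa> :: real
  assumes S_per: "periodic S" and S_fin: "finite (S \<inter> {u..v})" and S_ne: "S \<noteq> {}"
    and K: "K \<ge> 2" and \<kappa>: "\<kappa> \<ge> 0"
    and deriv: "x \<notin> S \<Longrightarrow> (F has_real_derivative h x) (at x)"
    and h_bound: "x \<notin> S \<Longrightarrow> \<bar>h x\<bar> \<le> K"
    and h_lip: "{min x y..max x y} \<inter> S = {} \<Longrightarrow> \<bar>h x - h y\<bar> \<le> \<kappa> * \<bar>x - y\<bar>"
begin

lemma S_closed: "closed S"
  using S_fin by (rule locally_finite_imp_closed)

lemma F_lipschitz: "\<bar>F x - F y\<bar> \<le> K * \<bar>x - y\<bar>"
proof -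
  have *: "\<bar>F y - F x\<bar> \<le> K * (y - x)" if "x \<le> y" for x y
  proof (rule abs_diff_le_of_deriv_bound[OF S_fin[of x y] that])
    show "continuous_on {x..y} F" using cont continuous_on_subset by blast
    show "(F has_real_derivative h t) (at t) \<and> \<bar>h t\<bar> \<le> K" if "t \<in> {x<..<y} - S \<inter> {x..y}" for t
      using that deriv h_bound by auto
  qed (use K in auto)
  show ?thesis using *[of x y] *[of y x] by (cases "x \<le> y") auto
qed

lemma F_upper:
  assumes "x \<notin> S" "\<bar>h x\<bar> < q"
  shows "\<exists>\<rho>>0. \<forall>y. \<bar>y - x\<bar> < \<rho> \<longrightarrow> \<bar>F y - F x\<bar> \<le> q * \<bar>y - x\<bar>"
proof -
  have "((\<lambda>y. (F y - F x) / (y - x)) \<longlongrightarrow> h x) (at x)"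
    using deriv[OF assms(1)] by (simp add: has_field_derivative_iff)
  then have "((\<lambda>y. \<bar>(F y - F x) / (y - x)\<bar>) \<longlongrightarrow> \<bar>h x\<bar>) (at x)"
    by (rule tendsto_rabs)
  then have "eventually (\<lambda>y. \<bar>(F y - F x) / (y - x)\<bar> < q) (at x)"
    using assms(2) by (rule order_tendstoD)
  then obtain \<rho> where "\<rho> > 0" and \<rho>: "\<And>y. y \<noteq> x \<Longrightarrow> dist y x < \<rho> \<Longrightarrow> \<bar>(F y - F x) / (y - x)\<bar> < q"
    by (auto simp: eventually_at)
  have "\<bar>F y - F x\<bar> \<le> q * \<bar>y - x\<bar>" if "\<bar>y - x\<bar> < \<rho>" for y
  proof (cases "y = x")
    case False
    then show ?thesis using \<rho>[of y] that by (simp add: dist_real_def abs_divide field_simps)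
  qed simp
  then show ?thesis using \<open>\<rho> > 0\<close> by blast
qed

lemma F_lower:
  assumes "x \<notin> S" "q < \<bar>h x\<bar>"
  shows "\<exists>\<rho>>0. \<forall>y. \<bar>y - x\<bar> < \<rho> \<longrightarrow> q * \<bar>y - x\<bar> \<le> \<bar>F y - F x\<bar>"
proof -
  have "((\<lambda>y. (F y - F x) / (y - x)) \<longlongrightarrow> h x) (at x)"
    using deriv[OF assms(1)] by (simp add: has_field_derivative_iff)
  then have "((\<lambda>y. \<bar>(F y - F x) / (y - x)\<bar>) \<longlongrightarrow> \<bar>h x\<bar>) (at x)"
    by (rule tendsto_rabs)
  then have "eventually (\<lambda>y. q < \<bar>(F y - F x) / (y - x)\<bar>) (at x)"
    using assms(2) by (rule order_tendstoD)
  then obtain \<rho> where "\<rho> > 0" and \<rho>: "\<And>y. y \<noteq> x \<Longrightarrow> dist y x < \<rho> \<Longrightarrow> q < \<bar>(F y - F x) / (y - x)\<bar>"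
    by (auto simp: eventually_at)
  have "q * \<bar>y - x\<bar> \<le> \<bar>F y - F x\<bar>" if "\<bar>y - x\<bar> < \<rho>" for y
  proof (cases "y = x")
    case False
    then show ?thesis using \<rho>[of y] that by (simp add: dist_real_def abs_divide field_simps)
  qed simp
  then show ?thesis using \<open>\<rho> > 0\<close> by blast
qed

text \<open>If \<open>\<bar>h x\<bar> < q\<close>, a small arc of radius \<open>s\<close> about
  \<open>x\<close> is mapped into the arc of radius \<open>q * s\<close> about \<open>F x\<close>.
  The preimage of the latter has measure \<open>2 * q * s\<close> by invariance, so
  \<open>q \<ge> 1\<close>.\<close>

lemma slope_ge_1:
  assumes "x \<notin> S"
  shows "\<bar>h x\<bar> \<ge> 1"
proof (rule dense_ge)
  fix q assume q: "\<bar>h x\<bar> < q"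
  then have q0: "q > 0" by linarith
  obtain \<rho> where \<rho>: "\<rho> > 0" "\<And>y. \<bar>y - x\<bar> < \<rho> \<Longrightarrow> \<bar>F y - F x\<bar> \<le> q * \<bar>y - x\<bar>"
    using F_upper[OF assms q] by blast
  define s where "s = Min {\<rho>, 1/2, 1 / (2 * q)} / 2"
  have s: "s > 0" "s < \<rho>" "s < 1/2" "s < 1 / (2 * q)" 
  proof -
    have "\<forall>a\<in>{\<rho>, 1/2, 1 / (2 * q)}. 0 < a" using \<rho>(1) q0 by simp
    then have "0 < s \<and> (\<forall>a\<in>{\<rho>, 1/2, 1 / (2 * q)}. s < a)" unfolding s_def by (intro half_Min) simp_all
    then show "s > 0" "s < \<rho>" "s < 1/2" "s < 1 / (2 * q)" by blast+
  qed
  have r: "0 \<le> q * s" "q * s < 1/2" using s q0 by (auto simp: field_simps)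
  have "{x - s..x + s} \<subseteq> F -` circle_ball (F x) (q * s) \<inter> {x - 1/2..<x - 1/2 + 1}"
  proof
    fix y assume y: "y \<in> {x - s..x + s}"
    then have ys: "\<bar>y - x\<bar> \<le> s" by (auto simp: abs_le_iff)
    then have "\<bar>F y - F x\<bar> \<le> q * \<bar>y - x\<bar>" using s by (intro \<rho>) auto
    also have "\<dots> \<le> q * s" using ys q0 by (intro mult_left_mono) auto
    finally have "\<bar>F y - F x - of_int 0\<bar> \<le> q * s" by simp
    then show "y \<in> F -` circle_ball (F x) (q * s) \<inter> {x - 1/2..<x - 1/2 + 1}"
      using y s by (auto simp: circle_ball_def simp del: of_int_0)
  qed
  then have "measure lborel {x - s..x + s} \<le> measure lborel (F -` circle_ball (F x) (q * s) \<inter> {x - 1/2..<x - 1/2 + 1})"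
    using vimage_funpow_borel[OF circle_ball_borel, of 1]
    by (intro measure_mono_interval[of _ _ "x - 1/2" "x + 1/2"]) auto
  then have "2 * s \<le> 2 * (q * s)"
    using s(1) by (subst (asm) mu_vimage_circle_ball[OF r]) simp
  then show "1 \<le> q" using s(1) by simp
qed

text \<open>Here \<open>1 / \<gamma> = 1 - 1 / K\<close>: the share left to one branch when another
  branch over the same point has slope at most \<open>K\<close>.\<close>

definition \<gamma> :: real where "\<gamma> = K / (K - 1)"

lemma \<gamma>_gt_1: "\<gamma> > 1" using K by (simp add: \<gamma>_def)

text \<open>Two branches over the same point have reciprocal slopes adding up to at most 1.\<close>

lemma slope_ge_\<gamma>:
  assumes "x \<notin> S" and z: "x < z" "z < x + 1" "F z - F x \<in> \<int>"
  shows "\<bar>h x\<bar> \<ge> \<gamma>"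
proof (rule dense_ge)
  fix q assume q: "\<bar>h x\<bar> < q"
  then have q0: "q > 0" by linarith
  obtain k :: int where k: "F z - F x = of_int k" using z(3) by (auto elim: Ints_cases)
  obtain \<rho> where \<rho>: "\<rho> > 0" "\<And>y. \<bar>y - x\<bar> < \<rho> \<Longrightarrow> \<bar>F y - F x\<bar> \<le> q * \<bar>y - x\<bar>"
    using F_upper[OF assms(1) q] by blast
  \<comment> \<open>With radii below \<open>\<delta>\<close>, the arcs about \<open>x\<close> and
    \<open>z\<close> are disjoint and fit into the one-period window starting at
    \<open>x - \<delta>\<close>.\<close>
  define \<delta> where "\<delta> = min (z - x) (x + 1 - z) / 2"
  have \<delta>: "\<delta> > 0" "x + \<delta> \<le> z - \<delta>" "z + \<delta> \<le> x + 1 - \<delta>" using z by (auto simp: \<delta>_def min_def field_simps)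
  \<comment> \<open>The four bounds ensure, in order: the slope estimate at \<open>x\<close>, the
    fit of the arc about \<open>x\<close>, \<open>s' < \<delta>\<close>, and a target radius
    \<open>q * s\<close> below \<open>1/2\<close>.\<close>
  define s where "s = Min {\<rho>, \<delta>, K * \<delta> / q, 1 / (2 * q)} / 2"
  have s: "s > 0" "s < \<rho>" "s < \<delta>" "s < K * \<delta> / q" "s < 1 / (2 * q)" 
  proof -
    have "\<forall>a\<in>{\<rho>, \<delta>, K * \<delta> / q, 1 / (2 * q)}. 0 < a" using \<rho>(1) q0 \<delta>(1) K by simp
    then have "0 < s \<and> (\<forall>a\<in>{\<rho>, \<delta>, K * \<delta> / q, 1 / (2 * q)}. s < a)" unfolding s_def by (intro half_Min) simp_all
    then show "s > 0" "s < \<rho>" "s < \<delta>" "s < K * \<delta> / q" "s < 1 / (2 * q)" by blast+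
  qed
  \<comment> \<open>The radius about \<open>z\<close> that the global Lipschitz constant
    \<open>K\<close> guarantees to be mapped into the arc of radius \<open>q * s\<close>.\<close>
  define s' where "s' = q * s / K"
  have s': "s' > 0" "s' < \<delta>" "K * s' = q * s" using s q0 K by (auto simp: s'_def field_simps)
  have r: "0 \<le> q * s" "q * s < 1/2" using s q0 by (auto simp: field_simps)
  let ?V = "F -` circle_ball (F x) (q * s) \<inter> {x - \<delta>..<x - \<delta> + 1}"
  have "{x - s..x + s} \<subseteq> ?V"
  proof
    fix y assume y: "y \<in> {x - s..x + s}"
    then have ys: "\<bar>y - x\<bar> \<le> s" by (auto simp: abs_le_iff)
    then have "\<bar>F y - F x\<bar> \<le> q * \<bar>y - x\<bar>" using s by (intro \<rho>) auto
    also have "\<dots> \<le> q * s" using ys q0 by (intro mult_left_mono) auto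
    finally have "\<bar>F y - F x - of_int 0\<bar> \<le> q * s" by simp
    then show "y \<in> ?V" using y s \<delta> by (auto simp: circle_ball_def simp del: of_int_0)
  qed
  moreover have "{z - s'..z + s'} \<subseteq> ?V"
  proof
    fix y assume y: "y \<in> {z - s'..z + s'}"
    then have ys: "\<bar>y - z\<bar> \<le> s'" by (auto simp: abs_le_iff)
    have "\<bar>F y - F z\<bar> \<le> K * \<bar>y - z\<bar>" by (rule F_lipschitz)
    also have "\<dots> \<le> q * s" using ys K by (subst s'(3)[symmetric], intro mult_left_mono) auto
    finally have "\<bar>F y - F x - of_int k\<bar> \<le> q * s" using k by (simp add: algebra_simps)
    then show "y \<in> ?V" using y s' \<delta> by (auto simp: circle_ball_def)
  qed
  ultimately have "measure lborel ({x - s..x + s} \<union> {z - s'..z + s'}) \<le> measure lborel ?V"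
    using vimage_funpow_borel[OF circle_ball_borel, of 1]
    by (intro measure_mono_interval[of _ _ "x - \<delta>" "x - \<delta> + 1"]) auto
  moreover have "measure lborel ({x - s..x + s} \<union> {z - s'..z + s'}) = measure lborel {x - s..x + s} + measure lborel {z - s'..z + s'}"
    using s(3) s'(2) \<delta>(2) by (intro measure_Union) (auto simp: emeasure_lborel_Icc_eq)
  ultimately have "2 * s + 2 * s' \<le> 2 * (q * s)"
    using s(1) s'(1) mu_vimage_circle_ball[OF r, of "F x" "x - \<delta>"] by simp
  moreover have "s * (1 + q / K) = s + s'" by (simp add: s'_def algebra_simps)
  ultimately have "s * (1 + q / K) \<le> s * q" by (simp add: mult.commute)
  then have "1 + q / K \<le> q" using s(1) by simp
  then show "\<gamma> \<le> q" using K by (simp add: \<gamma>_def field_simps)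
qed

text \<open>If \<open>x\<close> is alone in its fibre and \<open>\<bar>h x\<bar> > q > 1\<close>,
  the preimage of a small arc of radius \<open>r\<close> about \<open>F x\<close> is confined to
  radius \<open>r / q\<close> about \<open>x\<close>: away from \<open>x\<close>, compactness keeps
  \<open>F\<close> at a positive distance from the lifts of that point. Its measure
  \<open>2 * r\<close> would then be at most \<open>2 * r / q\<close>.\<close>

lemma slope_le_1:
  assumes "x \<notin> S" and uniq: "\<And>z. x < z \<Longrightarrow> z < x + 1 \<Longrightarrow> F z - F x \<notin> \<int>"
  shows "\<bar>h x\<bar> \<le> 1"
proof (rule ccontr)
  assume "\<not> ?thesis"
  then obtain q where q: "1 < q" "q < \<bar>h x\<bar>" using dense[of 1 "\<bar>h x\<bar>"] by auto
  obtain \<rho>1 where \<rho>1: "\<rho>1 > 0" "\<And>y. \<bar>y - x\<bar> < \<rho>1 \<Longrightarrow> q * \<bar>y - x\<bar> \<le> \<bar>F y - F x\<bar>"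
    using F_lower[OF assms(1) q(2)] by blast
  \<comment> \<open>The bound \<open>1 / (2 * K)\<close> makes
    \<open>\<bar>F y - F x\<bar> < 1/2\<close> near \<open>x\<close>, which forces the integer
    \<open>k\<close> below to be 0.\<close>
  define \<rho> where "\<rho> = Min {\<rho>1, 1/2, 1 / (2 * K)} / 2"
  have \<rho>: "\<rho> > 0" "\<rho> < \<rho>1" "\<rho> < 1/2" "\<rho> < 1 / (2 * K)" 
  proof -
    have "\<forall>a\<in>{\<rho>1, 1/2, 1 / (2 * K)}. 0 < a" using \<rho>1(1) K by simp
    then have "0 < \<rho> \<and> (\<forall>a\<in>{\<rho>1, 1/2, 1 / (2 * K)}. \<rho> < a)" unfolding \<rho>_def by (intro half_Min) simp_all
    then show "\<rho> > 0" "\<rho> < \<rho>1" "\<rho> < 1/2" "\<rho> < 1 / (2 * K)" by blast+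
  qed
  define Z where "Z = (\<lambda>y. F y - F x) ` {x + \<rho>..x + 1 - \<rho>}"
  have "compact Z"
    unfolding Z_def by (intro compact_continuous_image continuous_intros continuous_on_subset[OF cont]) auto
  moreover have "Z \<inter> \<int> = {}" using uniq \<rho> by (auto simp: Z_def)
  ultimately obtain e where e: "e > 0" "\<And>a b. a \<in> Z \<Longrightarrow> b \<in> \<int> \<Longrightarrow> e \<le> dist a b"
    using separate_compact_closed[of Z \<int>] closed_Ints by blast
  define r where "r = min e (1/2) / 2"
  have r: "r > 0" "r < e" "r < 1/2" using e(1) by (auto simp: r_def min_def)
  have "F -` circle_ball (F x) r \<inter> {x - \<rho>..<x - \<rho> + 1} \<subseteq> {x - r / q..x + r / q}"
  proof
    fix y assume y: "y \<in> F -` circle_ball (F x) r \<inter> {x - \<rho>..<x - \<rho> + 1}"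
    then obtain k :: int where k: "\<bar>F y - F x - of_int k\<bar> \<le> r" by (auto simp: circle_ball_def)
    show "y \<in> {x - r / q..x + r / q}"
    proof (cases "y < x + \<rho>")
      case True
      then have yx: "\<bar>y - x\<bar> \<le> \<rho>" using y by (auto simp: abs_le_iff)
      have "\<bar>F y - F x\<bar> \<le> K * \<bar>y - x\<bar>" by (rule F_lipschitz)
      also have "\<dots> \<le> K * \<rho>" using yx K by (intro mult_left_mono) auto
      also have "\<dots> < 1/2" using \<rho>(4) K by (simp add: field_simps)
      finally have "\<bar>F y - F x\<bar> < 1/2" .
      then have "real_of_int k < 1" "real_of_int k > - 1" using k r(3) by linarith+
      then have "k = 0" by linarith
      then have "q * \<bar>y - x\<bar> \<le> r" using k \<rho>1(2)[of y] yx \<rho>(2) by simp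
      then have "\<bar>y - x\<bar> \<le> r / q" using q by (simp add: field_simps)
      then show ?thesis by (auto simp: abs_le_iff)
    next
      case False
      then have "F y - F x \<in> Z" using y by (auto simp: Z_def)
      then have "e \<le> dist (F y - F x) (of_int k)" by (intro e(2)) auto
      then show ?thesis using k r(2) by (simp add: dist_real_def)
    qed
  qed
  then have "measure lborel (F -` circle_ball (F x) r \<inter> {x - \<rho>..<x - \<rho> + 1}) \<le> measure lborel {x - r / q..x + r / q}"
    using vimage_funpow_borel[OF circle_ball_borel, of 1]
    by (intro measure_mono_interval[of _ _ "x - r / q" "x + r / q"]) auto
  then have "2 * r \<le> 2 * (r / q)"
    using r q by (subst (asm) mu_vimage_circle_ball) simp_all
  then show False using r(1) q by (simp add: field_simps)
qed

text \<open>The cases are whether or not a second point of the period from \<open>x\<close> to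
  \<open>x + 1\<close> has the same image modulo 1.\<close>

lemma slope_dichotomy: "x \<notin> S \<Longrightarrow> \<bar>h x\<bar> = 1 \<or> \<bar>h x\<bar> \<ge> \<gamma>"
  using slope_ge_1 slope_ge_\<gamma> slope_le_1 by (metis order_antisym)

section \<open>The isometric region\<close>

definition I :: "real set" where
  "I = {x. x \<notin> S \<and> \<bar>h x\<bar> = 1}"

text \<open>On a segment free of break points \<open>\<bar>h\<bar>\<close> is continuous and takes
  no value strictly between 1 and \<open>\<gamma>\<close>; a change of type would produce the
  midpoint of these two.\<close>

lemma segment_I:
  assumes "{min x y..max x y} \<inter> S = {}" "x \<in> I"
  shows "y \<in> I"
proof -
  have "y \<in> {min x y..max x y}" by auto
  then have yS: "y \<notin> S" using assms(1) by blast
  have "\<bar>h y\<bar> = 1"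
  proof (rule ccontr)
    assume "\<bar>h y\<bar> \<noteq> 1"
    then have hy: "\<bar>h y\<bar> \<ge> \<gamma>" using slope_dichotomy[OF yS] by blast
    have c: "continuous_on {min x y..max x y} (\<lambda>t. \<bar>h t\<bar>)"
    proof (intro continuous_on_rabs lipschitz_on_continuous_on[of \<kappa>] lipschitz_onI)
      fix s t assume "s \<in> {min x y..max x y}" "t \<in> {min x y..max x y}"
      then have "{min s t..max s t} \<subseteq> {min x y..max x y}" by auto
      then have "{min s t..max s t} \<inter> S = {}" using assms(1) by blast
      then show "dist (h s) (h t) \<le> \<kappa> * dist s t" using h_lip by (simp add: dist_real_def)
    qed (rule \<kappa>)
    have "connected ((\<lambda>t. \<bar>h t\<bar>) ` {min x y..max x y})"
      by (rule connected_continuous_image[OF c]) simp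
    moreover have "\<bar>h x\<bar> \<in> (\<lambda>t. \<bar>h t\<bar>) ` {min x y..max x y}" "\<bar>h y\<bar> \<in> (\<lambda>t. \<bar>h t\<bar>) ` {min x y..max x y}"
      by auto
    ultimately have "{\<bar>h x\<bar>..\<bar>h y\<bar>} \<subseteq> (\<lambda>t. \<bar>h t\<bar>) ` {min x y..max x y}"
      by (rule connected_contains_Icc)
    moreover have "(1 + \<gamma>) / 2 \<in> {\<bar>h x\<bar>..\<bar>h y\<bar>}" using assms(2) hy \<gamma>_gt_1 by (auto simp: I_def)
    ultimately obtain t where t: "t \<in> {min x y..max x y}" "(1 + \<gamma>) / 2 = \<bar>h t\<bar>" by blast
    then have "t \<notin> S" using assms(1) by blast
    then show False using slope_dichotomy[of t] t(2) \<gamma>_gt_1 by auto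
  qed
  then show ?thesis using yS by (simp add: I_def)
qed

lemma mean_value:
  assumes "a < b" "{a<..<b} \<inter> S = {}"
  shows "\<exists>z\<in>{a<..<b}. F b - F a = (b - a) * h z"
proof -
  have "\<exists>l z. a < z \<and> z < b \<and> (F has_real_derivative l) (at z) \<and> F b - F a = (b - a) * l"
  proof (rule MVT[OF assms(1)])
    show "continuous_on {a..b} F" using cont continuous_on_subset by blast
    show "F differentiable (at x)" if "a < x" "x < b" for x
    proof -
      have "x \<notin> S" using assms(2) that by auto
      then show ?thesis using deriv real_differentiable_def by blast
    qed
  qed
  then obtain l z where z: "a < z" "z < b" "(F has_real_derivative l) (at z)" "F b - F a = (b - a) * l" by blast
  have "z \<notin> S" using z assms(2) by auto
  then have "l = h z" using z(3) deriv DERIV_unique by blast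
  then show ?thesis using z by auto
qed

lemma mean_value_abs:
  assumes "{min a b<..<max a b} \<inter> S = {}" "a \<noteq> b"
  shows "\<exists>z\<in>{min a b<..<max a b}. \<bar>F a - F b\<bar> = \<bar>a - b\<bar> * \<bar>h z\<bar>"
proof -
  have "min a b < max a b" using assms(2) by auto
  from mean_value[OF this assms(1)] obtain z
    where z: "z \<in> {min a b<..<max a b}" "F (max a b) - F (min a b) = (max a b - min a b) * h z" by blast
  have "\<bar>F a - F b\<bar> = \<bar>F (max a b) - F (min a b)\<bar>" "\<bar>a - b\<bar> = \<bar>max a b - min a b\<bar>"
    by (auto simp: min_def max_def)
  then show ?thesis using z by (auto simp: abs_mult)
qed

lemma iso_on_I:
  assumes "{min a b<..<max a b} \<subseteq> I"
  shows "\<bar>F a - F b\<bar> = \<bar>a - b\<bar>"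
proof (cases "a = b")
  case False
  have "{min a b<..<max a b} \<inter> S = {}" using assms by (auto simp: I_def)
  from mean_value_abs[OF this False] show ?thesis using assms by (auto simp: I_def)
qed simp

lemma expand_off_I:
  assumes "{min a b<..<max a b} \<inter> S = {}" "{min a b<..<max a b} \<inter> I = {}"
  shows "\<gamma> * \<bar>a - b\<bar> \<le> \<bar>F a - F b\<bar>"
proof (cases "a = b")
  case False
  then obtain z where z: "z \<in> {min a b<..<max a b}" "\<bar>F a - F b\<bar> = \<bar>a - b\<bar> * \<bar>h z\<bar>"
    using mean_value_abs[OF assms(1)] by blast
  then have "z \<notin> S" "z \<notin> I" using assms by blast+
  then have "\<bar>h z\<bar> \<ge> \<gamma>" using slope_dichotomy[of z] by (auto simp: I_def)
  then show ?thesis using z(2) mult_left_mono[of \<gamma> "\<bar>h z\<bar>" "\<bar>a - b\<bar>"] by (simp add: mult.commute)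
qed simp

lemma avoids_S_cases:
  assumes "connected J" "J \<inter> S = {}"
  shows "J \<subseteq> I \<or> J \<inter> I = {}"
proof -
  have "y \<in> I" if "x \<in> J" "x \<in> I" "y \<in> J" for x y
  proof (rule segment_I[OF _ that(2)])
    have "{min x y..max x y} \<subseteq> J"
      using assms(1) that by (intro connected_contains_Icc) (auto simp: min_def max_def)
    then show "{min x y..max x y} \<inter> S = {}" using assms(2) by blast
  qed
  then show ?thesis by blast
qed

lemma h_add_1:
  assumes "x \<notin> S"
  shows "h (x + 1) = h x"
proof -
  have "x + 1 \<notin> S" using assms S_per by (simp add: periodic_def)
  then have "(F has_real_derivative h (x + 1)) (at (x + 1))" by (rule deriv)
  then have "((\<lambda>t. F (t + 1)) has_real_derivative h (x + 1)) (at x)"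
    by (simp add: DERIV_shift)
  moreover have "((\<lambda>t. F (t + 1)) has_real_derivative h x) (at x)"
    unfolding per by (rule derivative_eq_intros deriv[OF assms] refl | simp)+
  ultimately show ?thesis by (rule DERIV_unique)
qed

lemma I_periodic: "periodic I"
proof -
  have "x + 1 \<in> S \<longleftrightarrow> x \<in> S" for x using S_per by (simp add: periodic_def)
  then show ?thesis unfolding periodic_def I_def using h_add_1 by auto
qed

text \<open>Relative to the complement of \<open>S\<close>, the set \<open>I\<close> is both open
  and closed; \<open>I_open\<close> and \<open>closure_I\<close> are the two halves.\<close>

lemma I_nearby:
  assumes "x \<notin> S"
  shows "\<exists>e>0. \<forall>y\<in>ball x e. y \<in> I \<longleftrightarrow> x \<in> I"
proof -
  obtain e where e: "e > 0" "ball x e \<subseteq> - S"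
    using assms S_closed openE[of "- S" x] by auto
  have "y \<in> I \<longleftrightarrow> x \<in> I" if "y \<in> ball x e" for y
  proof -
    have "ball x e \<inter> S = {}" "x \<in> ball x e" using e by auto
    then show ?thesis using avoids_S_cases[of "ball x e"] that connected_ball by blast
  qed
  then show ?thesis using e(1) by blast
qed

lemma I_open: "open I"
  unfolding open_contains_ball
proof
  fix x assume x: "x \<in> I"
  then have "x \<notin> S" by (simp add: I_def)
  then show "\<exists>e>0. ball x e \<subseteq> I" using I_nearby x by blast
qed

lemma closure_I: "x \<in> closure I \<Longrightarrow> x \<notin> S \<Longrightarrow> x \<in> I"
  using I_nearby[of x] by (metis closure_approachable dist_commute mem_ball)

end

section \<open>Isometric itineraries\<close>

text \<open>A pair less than 1 apart can be translated so that one point lies in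
  \<open>{0..<1}\<close> and the other in \<open>{-1..2}\<close>, which leaves finitely many
  distances.\<close>

lemma locally_finite_separated:
  fixes T :: "real set"
  assumes per: "periodic T" and fin: "\<And>u v. finite (T \<inter> {u..v})"
  shows "\<exists>\<delta>>0. \<forall>s\<in>T. \<forall>t\<in>T. s \<noteq> t \<longrightarrow> \<delta> \<le> \<bar>s - t\<bar>"
proof -
  define A where "A = T \<inter> {-1..2}"
  \<comment> \<open>The value 1 handles pairs at least 1 apart and keeps the minimum defined when
    there are no pairs.\<close>
  define B where "B = insert 1 ((\<lambda>(s, t). \<bar>s - t\<bar>) ` {(s, t) \<in> A \<times> A. s \<noteq> t})"
  have "finite A" unfolding A_def by (rule fin)
  then have "finite (A \<times> A)" by simp
  then have "finite {(s, t) \<in> A \<times> A. s \<noteq> t}" by (rule rev_finite_subset) auto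
  then have B: "finite B" unfolding B_def by (intro finite.insertI finite_imageI)
  have "Min B > 0" using B by (subst Min_gr_iff) (auto simp: B_def)
  moreover have "Min B \<le> \<bar>s - t\<bar>" if st: "s \<in> T" "t \<in> T" "s \<noteq> t" for s t
  proof (cases "\<bar>s - t\<bar> < 1")
    case True
    define j where "j = - \<lfloor>s\<rfloor>"
    have s01: "0 \<le> s + of_int j" "s + of_int j < 1" unfolding j_def by linarith+
    then have "s + of_int j \<in> A" "t + of_int j \<in> A"
      using st periodic_add_int[OF per] True by (auto simp: A_def)
    then have "(s + of_int j, t + of_int j) \<in> {(s, t) \<in> A \<times> A. s \<noteq> t}" using st(3) by simp
    then have "\<bar>(s + of_int j) - (t + of_int j)\<bar> \<in> B"
      unfolding B_def by (intro insertI2 image_eqI[of _ _ "(s + of_int j, t + of_int j)"]) auto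
    then show ?thesis using Min_le[OF B] by simp
  next
    case False
    have "Min B \<le> 1" using B by (intro Min_le) (auto simp: B_def)
    then show ?thesis using False by simp
  qed
  ultimately show ?thesis by blast
qed

lemma periodic_closure: "periodic E \<Longrightarrow> periodic (closure E)"
proof -
  assume E: "periodic E"
  have "(+) 1 ` E = E"
  proof (intro antisym subsetI)
    fix x assume "x \<in> E"
    then have "x - 1 \<in> E" using periodic_add_int[OF E, of x "-1"] by simp
    then show "x \<in> (+) 1 ` E" by (intro image_eqI[of _ _ "x - 1"]) auto
  qed (use E in \<open>auto simp: periodic_def add.commute\<close>)
  then have eq: "closure E = (+) 1 ` closure E" by (metis closure_translation)
  show ?thesis
    unfolding periodic_def
  proof (intro allI iffI)
    fix x assume "x + 1 \<in> closure E"
    then have "x + 1 \<in> (+) 1 ` closure E" using eq by blast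
    then show "x \<in> closure E" by auto
  next
    fix x assume "x \<in> closure E"
    then have "1 + x \<in> (+) 1 ` closure E" by blast
    then show "x + 1 \<in> closure E" using eq by (simp add: add.commute)
  qed
qed

context smooth_lift
begin

definition itinerary :: "nat \<Rightarrow> real set" where
  "itinerary n = {x. \<forall>k<n. (F ^^ k) x \<in> I}"

lemma itinerary_open: "open (itinerary n)"
proof -
  have "itinerary n = (\<Inter>k\<in>{..<n}. (F ^^ k) -` I)" by (auto simp: itinerary_def)
  moreover have "open ((F ^^ k) -` I)" for k
    using I_open continuous_funpow by (simp add: continuous_open_vimage isCont_funpow)
  ultimately show ?thesis by auto
qed

lemma itinerary_periodic: "periodic (itinerary n)"
  using periodic_vimage_funpow[OF I_periodic] by (auto simp: itinerary_def periodic_def)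

lemma itinerary_Suc: "x \<in> itinerary (Suc n) \<longleftrightarrow> x \<in> I \<and> F x \<in> itinerary n"
  by (auto simp: itinerary_def less_Suc_eq_0_disj funpow_swap1)

lemma itinerary_mono: "m \<le> n \<Longrightarrow> itinerary n \<subseteq> itinerary m"
  by (auto simp: itinerary_def)

text \<open>Closures are taken because the open sets \<open>itinerary n\<close> may have empty
  intersection even if none is empty, whereas \<open>X\<close> is then nonempty by compactness. The
  price is that points of \<open>X\<close> may lie in \<open>S\<close>, so they are known to be in
  \<open>I\<close> only off \<open>S\<close>.\<close>

definition X :: "real set" where
  "X = (\<Inter>n. closure (itinerary n))"

lemma X_closed: "closed X" by (auto simp: X_def)

lemma X_periodic: "periodic X"
  using periodic_closure[OF itinerary_periodic] by (auto simp: X_def periodic_def)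

lemma X_closure_I: "X \<subseteq> closure I"
proof -
  have "itinerary 1 = I" by (auto simp: itinerary_def)
  moreover have "X \<subseteq> closure (itinerary 1)" by (auto simp: X_def)
  ultimately show ?thesis by simp
qed

lemma X_minus_S: "x \<in> X \<Longrightarrow> x \<notin> S \<Longrightarrow> x \<in> I"
  using X_closure_I closure_I by blast

lemma F_X: "x \<in> X \<Longrightarrow> F x \<in> X"
proof -
  assume x: "x \<in> X"
  have "F x \<in> closure (itinerary n)" for n
  proof -
    have "F ` closure (itinerary (Suc n)) \<subseteq> closure (itinerary n)"
    proof (rule image_closure_subset)
      show "continuous_on (closure (itinerary (Suc n))) F" using cont continuous_on_subset by blast
      show "F ` itinerary (Suc n) \<subseteq> closure (itinerary n)" using itinerary_Suc closure_subset by blast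
    qed simp
    then show ?thesis using x by (auto simp: X_def)
  qed
  then show ?thesis by (simp add: X_def)
qed

lemma funpow_X: "x \<in> X \<Longrightarrow> (F ^^ n) x \<in> X"
  by (induction n) (auto simp: F_X)

text \<open>Near a point \<open>w\<close> of \<open>I\<close> the map is an isometry onto a
  neighbourhood of \<open>F w\<close>. Points near \<open>F w\<close> with long itineraries thus
  pull back to points near \<open>w\<close> with itineraries longer by one.\<close>

lemma F_X_imp_X:
  assumes "w \<in> I" "F w \<in> X"
  shows "w \<in> X"
proof -
  obtain e where e: "e > 0" "ball w e \<subseteq> I" using I_open assms(1) openE by blast
  have "w \<in> closure (itinerary (Suc n))" for n
    unfolding closure_approachable
  proof (intro allI impI)
    fix e' :: real assume e': "e' > 0"
    define r where "r = min e e' / 2"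
    have r: "r > 0" "r < e" "r < e'" using e e' by (auto simp: r_def)
    have sub: "{w - r..w + r} \<subseteq> ball w e" using r by (auto simp: dist_real_def)
    have iso: "\<bar>F s - F t\<bar> = \<bar>s - t\<bar>" if "s \<in> {w - r..w + r}" "t \<in> {w - r..w + r}" for s t
    proof (rule iso_on_I)
      have "{min s t<..<max s t} \<subseteq> {w - r..w + r}" using that by auto
      then show "{min s t<..<max s t} \<subseteq> I" using sub e(2) by blast
    qed
    have 1: "\<bar>F (w - r) - F (w + r)\<bar> = 2 * r" "\<bar>F (w - r) - F w\<bar> = r" "\<bar>F (w + r) - F w\<bar> = r"
      using iso[of "w - r" "w + r"] iso[of "w - r" w] iso[of "w + r" w] r by auto
    \<comment> \<open>The images of the ends are \<open>2 * r\<close> apart and each at distance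
      \<open>r\<close> from \<open>F w\<close>, so \<open>F w\<close> is their midpoint; the cases
      are the two orientations.\<close>
    have img: "{F w - r..F w + r} \<subseteq> F ` {w - r..w + r}"
    proof (cases "F (w - r) \<le> F w")
      case True
      then have "F (w - r) = F w - r" "F (w + r) = F w + r" using 1 r by linarith+
      then show ?thesis using Icc_subset_funpow_image[OF connected_Icc, of "w - r" "w - r" "w + r" "w + r" 1] r by simp
    next
      case False
      then have "F (w - r) = F w + r" "F (w + r) = F w - r" using 1 r by linarith+
      then show ?thesis using Icc_subset_funpow_image[OF connected_Icc, of "w + r" "w - r" "w + r" "w - r" 1] r by simp
    qed
    have "F w \<in> closure (itinerary n)" using assms(2) by (auto simp: X_def)
    then obtain p where p: "p \<in> itinerary n" "dist p (F w) < r" using r by (auto simp: closure_approachable)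
    then have "p \<in> {F w - r..F w + r}" by (auto simp: dist_real_def)
    then obtain v where v: "v \<in> {w - r..w + r}" "p = F v" using img by blast
    have "v \<in> itinerary (Suc n)" using v p sub e(2) by (auto simp: itinerary_Suc)
    moreover have "dist v w < e'" using v r by (auto simp: dist_real_def)
    ultimately show "\<exists>y\<in>itinerary (Suc n). dist y w < e'" by blast
  qed
  then have "w \<in> closure (itinerary n)" for n
    using closure_mono[OF itinerary_mono[of n "Suc n"]] by auto
  then show ?thesis by (simp add: X_def)
qed

lemma X_nonempty:
  assumes "\<And>n. itinerary n \<noteq> {}"
  shows "X \<noteq> {}"
proof -
  have "(\<Inter>n. closure (itinerary n) \<inter> {0..1}) \<noteq> {}"
  proof (rule compact_nest)
    fix n
    obtain x where "x \<in> itinerary n" using assms by blast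
    then have "frac x \<in> itinerary n" using periodic_frac[OF itinerary_periodic] by blast
    moreover have "frac x \<in> {0..1}" using frac_lt_1[of x] by auto
    ultimately have "frac x \<in> closure (itinerary n) \<inter> {0..1}" using closure_subset by blast
    then show "closure (itinerary n) \<inter> {0..1} \<noteq> {}" by blast
    show "compact (closure (itinerary n) \<inter> {0..1})" by (intro closed_Int_compact) auto
  next
    fix m n :: nat assume "m \<le> n"
    then show "closure (itinerary n) \<inter> {0..1} \<subseteq> closure (itinerary m) \<inter> {0..1}"
      using closure_mono[OF itinerary_mono] by blast
  qed
  then show ?thesis by (auto simp: X_def)
qed

text \<open>While the images remain isometric, every point of the image of \<open>{a<..<b}\<close>
  is at a positive distance less than \<open>\<delta>\<close> from the orbit of \<open>y\<close>,
  which stays in \<open>X\<close>. By the separation it is not in \<open>S\<close>. The connected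
  image then lies on one side of the dichotomy, and the orbit of \<open>w\<close> places it in
  \<open>I\<close>.\<close>

lemma isometric_side:
  assumes sep: "\<And>s t. s \<in> X \<union> S \<Longrightarrow> t \<in> X \<union> S \<Longrightarrow> s \<noteq> t \<Longrightarrow> \<delta> \<le> \<bar>s - t\<bar>"
    and y: "y \<in> X" "b = a + \<delta>" "\<delta> > 0" "y = a \<or> y = b" and w: "w \<in> itinerary M" "w \<in> {a<..<b}"
  shows "k \<le> M \<Longrightarrow> u \<in> {a..b} \<Longrightarrow> v \<in> {a..b} \<Longrightarrow> \<bar>(F ^^ k) u - (F ^^ k) v\<bar> = \<bar>u - v\<bar>"
proof (induction k arbitrary: u v)
  case (Suc k)
  have IH: "\<bar>(F ^^ k) u - (F ^^ k) v\<bar> = \<bar>u - v\<bar>" if "u \<in> {a..b}" "v \<in> {a..b}" for u v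
    using Suc that by simp
  let ?J = "(F ^^ k) ` {a<..<b}"
  have "s \<notin> S" if s: "s \<in> ?J" for s
  proof
    assume "s \<in> S"
    obtain t where t: "t \<in> {a<..<b}" "s = (F ^^ k) t" using s by blast
    have "\<bar>s - (F ^^ k) y\<bar> = \<bar>t - y\<bar>" using IH[of t y] t y by auto
    moreover have "0 < \<bar>t - y\<bar>" "\<bar>t - y\<bar> < \<delta>" using t y by auto
    ultimately show False using sep[of s "(F ^^ k) y"] \<open>s \<in> S\<close> funpow_X[OF y(1), of k] by force
  qed
  then have JS: "?J \<inter> S = {}" by blast
  have conn: "connected ?J"
    by (intro connected_continuous_image continuous_on_subset[OF continuous_funpow]) auto
  have "(F ^^ k) w \<in> I" using w(1) Suc.prems(1) by (auto simp: itinerary_def)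
  then have JI: "?J \<subseteq> I" using avoids_S_cases[OF conn JS] w(2) by blast
  have "\<bar>F ((F ^^ k) u) - F ((F ^^ k) v)\<bar> = \<bar>(F ^^ k) u - (F ^^ k) v\<bar>"
  proof (rule iso_on_I)
    have "{min u v<..<max u v} \<subseteq> {a<..<b}" using Suc.prems(2,3) by auto
    then have "(F ^^ k) ` {min u v<..<max u v} \<subseteq> ?J" by blast
    with Ioo_subset_funpow_image[of k u v]
    have "{min ((F ^^ k) u) ((F ^^ k) v)<..<max ((F ^^ k) u) ((F ^^ k) v)} \<subseteq> ?J" by blast
    then show "{min ((F ^^ k) u) ((F ^^ k) v)<..<max ((F ^^ k) u) ((F ^^ k) v)} \<subseteq> I" using JI by blast
  qed
  then show ?case using IH Suc.prems by simp
qed simp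

text \<open>Otherwise \<open>X \<union> S\<close> would be uniformly separated, and
  \<open>isometric_side\<close> would give an interval beside a point of \<open>X\<close> on which
  all iterates are isometric.\<close>

lemma X_not_locally_finite:
  assumes ne: "\<And>n. itinerary n \<noteq> {}"
  shows "\<exists>u v. infinite (X \<inter> {u..v})"
proof (rule ccontr)
  assume "\<not> ?thesis"
  then have fin: "finite ((X \<union> S) \<inter> {u..v})" for u v
    using S_fin[of u v] by (simp add: Int_Un_distrib2)
  have "periodic (X \<union> S)" using X_periodic S_per by (auto simp: periodic_def)
  from locally_finite_separated[OF this fin]
  obtain \<delta>0 where \<delta>0: "\<delta>0 > 0" "\<And>s t. s \<in> X \<union> S \<Longrightarrow> t \<in> X \<union> S \<Longrightarrow> s \<noteq> t \<Longrightarrow> \<delta>0 \<le> \<bar>s - t\<bar>"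
    by blast
  \<comment> \<open>The cap \<open>1/2\<close> keeps the permanent length below 1, as
    \<open>no_forever_short\<close> requires.\<close>
  define \<delta> where "\<delta> = min \<delta>0 (1/2)"
  have \<delta>: "\<delta> > 0" "\<delta> \<le> 1/2" "\<And>s t. s \<in> X \<union> S \<Longrightarrow> t \<in> X \<union> S \<Longrightarrow> s \<noteq> t \<Longrightarrow> \<delta> \<le> \<bar>s - t\<bar>"
    using \<delta>0 by (auto simp: \<delta>_def min_le_iff_disj)
  obtain y where y: "y \<in> X" using X_nonempty[OF ne] by blast
  have near: "(\<exists>w\<in>itinerary M. w \<in> {y<..<y + \<delta>}) \<or> (\<exists>w\<in>itinerary M. w \<in> {y - \<delta><..<y})" for M
  proof -
    have "y \<in> closure (itinerary M)" using y by (auto simp: X_def)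
    then obtain w0 where w0: "w0 \<in> itinerary M" "dist w0 y < \<delta>" using \<delta>(1) by (auto simp: closure_approachable)
    obtain e where e: "e > 0" "ball w0 e \<subseteq> itinerary M" using itinerary_open w0(1) openE by blast
    \<comment> \<open>A nearby point equal to \<open>y\<close> itself is moved slightly, within the
      open itinerary set, so that it falls on a definite side.\<close>
    define w where "w = (if w0 = y then w0 + min e \<delta> / 2 else w0)"
    have "w \<in> itinerary M" using e w0 \<delta>(1) by (auto simp: w_def dist_real_def subset_iff)
    moreover have "w \<in> {y<..<y + \<delta>} \<or> w \<in> {y - \<delta><..<y}"
      using e w0(2) \<delta>(1) by (auto simp: w_def dist_real_def)
    ultimately show ?thesis by blast
  qed
  have stuck: False if ab: "a < b" "b = a + \<delta>" "y = a \<or> y = b" and itin: "\<And>M. \<exists>w\<in>itinerary M. w \<in> {a<..<b}" for a b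
  proof (rule no_forever_short[of a b \<delta>])
    fix n u v assume uv: "u \<in> {a<..<b}" "v \<in> {a<..<b}"
    obtain w where "w \<in> itinerary n" "w \<in> {a<..<b}" using itin by blast
    from isometric_side[OF \<delta>(3) y ab(2) \<delta>(1) ab(3) this order_refl, of v u]
    have "\<bar>(F ^^ n) v - (F ^^ n) u\<bar> = \<bar>v - u\<bar>" using uv by auto
    then show "(F ^^ n) v - (F ^^ n) u \<le> \<delta>" using uv ab(2) by auto
  qed (use ab \<delta> in auto)
  show False
  \<comment> \<open>One side must serve for all lengths: once an itinerary length is absent on the
    right, all longer ones are too, and only the left remains.\<close>
  proof (cases "\<forall>M. \<exists>w\<in>itinerary M. w \<in> {y<..<y + \<delta>}")
    case True
    then show False using stuck[of y "y + \<delta>"] \<delta>(1) by auto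
  next
    case False
    then obtain M0 where M0: "\<not> (\<exists>w\<in>itinerary M0. w \<in> {y<..<y + \<delta>})" by blast
    have "\<exists>w\<in>itinerary M. w \<in> {y - \<delta><..<y}" for M
    proof -
      have "\<not> (\<exists>w\<in>itinerary (max M M0). w \<in> {y<..<y + \<delta>})"
        using M0 itinerary_mono[of M0 "max M M0"] by auto
      then obtain w where "w \<in> itinerary (max M M0)" "w \<in> {y - \<delta><..<y}" using near by blast
      then show ?thesis using itinerary_mono[of M "max M M0"] by auto
    qed
    then show False using stuck[of "y - \<delta>" y] \<delta>(1) by auto
  qed
qed

text \<open>The images of an interval contained in \<open>X\<close> stay in \<open>X\<close>, where
  slopes off \<open>S\<close> are 1 in absolute value. The images may fold at break points but never
  stretch, and a short interval would remain short forever.\<close>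

lemma X_nowhere_dense:
  assumes "a < b"
  shows "\<not> {a<..<b} \<subseteq> X"
proof
  assume sub: "{a<..<b} \<subseteq> X"
  define c where "c = min b (a + 1/2)"
  have c: "a < c" "c \<le> b" "c - a \<le> 1/2" using assms by (auto simp: c_def min_def)
  have "\<bar>(F ^^ n) x - (F ^^ n) y\<bar> \<le> \<bar>x - y\<bar>" if xy: "x \<in> {a<..<c}" "y \<in> {a<..<c}" for n x y
    using xy
  proof (induction n)
    case (Suc n)
    have *: "\<bar>F q - F p\<bar> \<le> 1 * (q - p)" if pq: "p \<le> q" "{p..q} \<subseteq> (F ^^ n) ` {a<..<c}" for p q
    proof (rule abs_diff_le_of_deriv_bound[OF S_fin[of p q] pq(1)])
      show "continuous_on {p..q} F" using cont continuous_on_subset by blast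
      fix t assume t: "t \<in> {p<..<q} - S \<inter> {p..q}"
      then have "t \<in> (F ^^ n) ` {a<..<c}" using pq(2) by auto
      moreover have "{a<..<c} \<subseteq> X" using sub c(2) by force
      ultimately have "t \<in> X" using funpow_X by blast
      moreover have "t \<notin> S" using t by auto
      ultimately have "t \<in> I" by (rule X_minus_S)
      then show "(F has_real_derivative h t) (at t) \<and> \<bar>h t\<bar> \<le> 1"
        using deriv by (auto simp: I_def)
    qed simp
    have "\<bar>F ((F ^^ n) x) - F ((F ^^ n) y)\<bar> \<le> \<bar>(F ^^ n) x - (F ^^ n) y\<bar>"
    proof (cases "(F ^^ n) x \<le> (F ^^ n) y")
      case True
      then show ?thesis
        using *[of "(F ^^ n) x" "(F ^^ n) y"] Icc_subset_funpow_image[of "{a<..<c}" x y n] xy by auto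
    next
      case False
      then show ?thesis
        using *[of "(F ^^ n) y" "(F ^^ n) x"] Icc_subset_funpow_image[of "{a<..<c}" y x n] xy by auto
    qed
    then show ?case using Suc by simp
  qed simp
  then have le: "(F ^^ n) y - (F ^^ n) x \<le> \<bar>y - x\<bar>" if "x \<in> {a<..<c}" "y \<in> {a<..<c}" for n x y
    using that by (meson abs_ge_self order_trans)
  show False
  proof (rule no_forever_short[OF c(1), of "1/2"])
    fix n x y assume "x \<in> {a<..<c}" "y \<in> {a<..<c}"
    then show "(F ^^ n) y - (F ^^ n) x \<le> 1/2" using le[of x y n] c(3) by auto
  qed simp
qed

section \<open>Gaps of the limit set\<close>

definition gap :: "real \<Rightarrow> real \<Rightarrow> bool" where
  "gap a b \<longleftrightarrow> a < b \<and> a \<in> X \<and> b \<in> X \<and> {a<..<b} \<inter> X = {}"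

lemma gap_unique: "gap a b \<Longrightarrow> gap a b' \<Longrightarrow> b = b'" "gap a b \<Longrightarrow> gap a' b \<Longrightarrow> a = a'"
  by (auto simp: gap_def disjoint_iff) (meson linorder_neqE)+

text \<open>A point of \<open>X\<close> can only be an end of gaps, of at most one on each side. A
  point outside \<open>X\<close> has a ball free of \<open>X\<close>, and a gap containing the point
  cannot be shorter than the radius.\<close>

lemma gap_around_bounded_below:
  "\<exists>s>0. \<forall>a b. gap a b \<longrightarrow> e \<in> {a..b} \<longrightarrow> s \<le> b - a"
proof (cases "e \<in> X")
  case False
  then obtain s where s: "s > 0" "ball e s \<subseteq> - X" using X_closed openE[of "- X" e] by auto
  have "s \<le> b - a" if "gap a b" "e \<in> {a..b}" for a b
  proof -
    have "a \<notin> ball e s" using that s(2) by (auto simp: gap_def)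
    then show ?thesis using that(2) by (auto simp: dist_real_def)
  qed
  then show ?thesis using s(1) by blast
next
  case True
  obtain s1 where s1: "s1 > 0" "\<And>b. gap e b \<Longrightarrow> s1 \<le> b - e"
  proof (cases "\<exists>b. gap e b")
    case T: True
    then obtain b where b: "gap e b" by blast
    then show ?thesis using gap_unique(1)[OF b] by (intro that[of "b - e"]) (auto simp: gap_def)
  next
    case False
    then show ?thesis by (intro that[of 1]) auto
  qed
  obtain s2 where s2: "s2 > 0" "\<And>a. gap a e \<Longrightarrow> s2 \<le> e - a"
  proof (cases "\<exists>a. gap a e")
    case T: True
    then obtain a where a: "gap a e" by blast
    then show ?thesis using gap_unique(2)[OF a] by (intro that[of "e - a"]) (auto simp: gap_def)
  next
    case False
    then show ?thesis by (intro that[of 1]) auto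
  qed
  have "min s1 s2 \<le> b - a" if g: "gap a b" "e \<in> {a..b}" for a b
  proof -
    have "e \<notin> {a<..<b}" using g True by (auto simp: gap_def)
    then have "e = a \<or> e = b" using g(2) by auto
    then show ?thesis using s1(2)[of b] s2(2)[of a] g(1) by auto
  qed
  then show ?thesis using s1(1) s2(1) by (intro exI[of _ "min s1 s2"]) auto
qed

lemma gap_shift: "gap a b \<Longrightarrow> gap (a + of_int k) (b + of_int k)"
proof -
  assume g: "gap a b"
  have "x \<notin> X" if "x \<in> {a + of_int k<..<b + of_int k}" for x
  proof
    assume "x \<in> X"
    then have "x + of_int (- k) \<in> X" using periodic_add_int[OF X_periodic] by blast
    then show False using that g by (auto simp: gap_def disjoint_iff)
  qed
  then show ?thesis using g periodic_add_int[OF X_periodic] by (auto simp: gap_def)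
qed

text \<open>Modulo 1 there are finitely many points of \<open>S\<close>, and gaps may be translated
  by integers. Gaps shorter than \<open>s\<close> therefore avoid all break points.\<close>

lemma gap_meeting_S: "\<exists>s>0. \<forall>a b. gap a b \<longrightarrow> {a..b} \<inter> S \<noteq> {} \<longrightarrow> s \<le> b - a"
proof -
  obtain s where s: "\<And>e. s e > 0" "\<And>e a b. gap a b \<Longrightarrow> e \<in> {a..b} \<Longrightarrow> s e \<le> b - a"
    using gap_around_bounded_below by metis
  define A where "A = insert 1 (s ` (S \<inter> {0..1}))"
  have A: "finite A" using S_fin by (simp add: A_def)
  have "Min A > 0" using A s(1) by (subst Min_gr_iff) (auto simp: A_def)
  moreover have "Min A \<le> b - a" if g: "gap a b" "{a..b} \<inter> S \<noteq> {}" for a b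
  proof -
    obtain e where e: "e \<in> {a..b}" "e \<in> S" using g(2) by blast
    define j where "j = - \<lfloor>e\<rfloor>"
    have "0 \<le> e + of_int j" "e + of_int j \<le> 1" unfolding j_def by linarith+
    then have "e + of_int j \<in> S \<inter> {0..1}" using e(2) periodic_add_int[OF S_per] by auto
    then have "Min A \<le> s (e + of_int j)" using A by (intro Min_le) (auto simp: A_def)
    also have "\<dots> \<le> (b + of_int j) - (a + of_int j)"
      using e(1) by (intro s(2) gap_shift g(1)) auto
    finally show ?thesis by simp
  qed
  ultimately show ?thesis by blast
qed

text \<open>Accumulation gives two points of \<open>X\<close> less than \<open>s\<close> apart.
  Nowhere density puts a point outside \<open>X\<close> between them, and the gap around that point
  is trapped.\<close>

lemma small_gap:
  assumes inf: "infinite (X \<inter> {u..v})" and s: "s > 0"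
  shows "\<exists>a b. gap a b \<and> b - a < s"
proof -
  obtain p where "p islimpt (X \<inter> {u..v})"
    using Heine_Borel_imp_Bolzano_Weierstrass[OF compact_Icc inf] by auto
  then have "infinite (X \<inter> {u..v} \<inter> ball p (s/2))"
    using s by (simp add: islimpt_eq_infinite_ball)
  then have "\<not> X \<inter> {u..v} \<inter> ball p (s/2) \<subseteq> {q}" for q
    using finite_subset by blast
  then obtain q q' where q: "q \<in> X \<inter> ball p (s/2)" "q' \<in> X \<inter> ball p (s/2)" "q \<noteq> q'"
    by blast
  define p1 p2 where "p1 = min q q'" and "p2 = max q q'"
  have p12: "p1 < p2" "p2 - p1 < s" "p1 \<in> X" "p2 \<in> X"
  proof -
    have "\<bar>p - q\<bar> < s/2" "\<bar>p - q'\<bar> < s/2" using q by (auto simp: dist_real_def)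
    then have "\<bar>q - q'\<bar> < s" by linarith
    then show "p1 < p2" "p2 - p1 < s" "p1 \<in> X" "p2 \<in> X"
      using q by (auto simp: p1_def p2_def min_def max_def)
  qed
  obtain z where z: "z \<in> {p1<..<p2}" "z \<notin> X" using X_nowhere_dense[OF p12(1)] by blast
  have c1: "compact (X \<inter> {p1..z})" "X \<inter> {p1..z} \<noteq> {}"
    using X_closed p12 z by (auto intro: closed_Int_compact)
  have c2: "compact (X \<inter> {z..p2})" "X \<inter> {z..p2} \<noteq> {}"
    using X_closed p12 z by (auto intro: closed_Int_compact)
  obtain a where a: "a \<in> X \<inter> {p1..z}" "\<And>t. t \<in> X \<inter> {p1..z} \<Longrightarrow> t \<le> a"
    using compact_attains_sup[OF c1] by blast
  obtain b where b: "b \<in> X \<inter> {z..p2}" "\<And>t. t \<in> X \<inter> {z..p2} \<Longrightarrow> b \<le> t"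
    using compact_attains_inf[OF c2] by blast
  have "a \<noteq> z" "b \<noteq> z" using a(1) b(1) z(2) by auto
  moreover have "t \<notin> X" if t: "t \<in> {a<..<b}" for t
  proof
    assume "t \<in> X"
    then show False using a(1) b(1) a(2)[of t] b(2)[of t] t by (cases "t \<le> z") auto
  qed
  ultimately have "gap a b" using a(1) b(1) by (auto simp: gap_def)
  moreover have "b - a < s" using a(1) b(1) p12(2) by auto
  ultimately show ?thesis by blast
qed

text \<open>A point of \<open>X\<close> strictly inside the image would have a preimage inside the
  original gap, and by \<open>F_X_imp_X\<close> that preimage would be in \<open>X\<close>.\<close>

lemma gap_image:
  assumes g: "gap a b" and S: "{a..b} \<inter> S = {}"
  shows "gap (min (F a) (F b)) (max (F a) (F b))" "{a..b} \<subseteq> I"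
proof -
  have ab: "a < b" "a \<in> X" "b \<in> X" using g by (auto simp: gap_def)
  have "a \<in> {a..b}" using ab by simp
  then have "a \<in> I" using ab S by (intro X_minus_S) blast+
  then show sub: "{a..b} \<subseteq> I"
    using avoids_S_cases[OF connected_Icc S] \<open>a \<in> {a..b}\<close> by blast
  have iso: "\<bar>F x - F y\<bar> = \<bar>x - y\<bar>" if "x \<in> {a..b}" "y \<in> {a..b}" for x y
  proof (rule iso_on_I)
    have "{min x y<..<max x y} \<subseteq> {a..b}" using that by auto
    then show "{min x y<..<max x y} \<subseteq> I" using sub by blast
  qed
  have "F a \<noteq> F b" using iso[of a b] ab by auto
  moreover have "p \<notin> X" if p: "p \<in> {min (F a) (F b)<..<max (F a) (F b)}" for p
  proof
    assume pX: "p \<in> X"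
    have "p \<in> {F a..F b} \<or> p \<in> {F b..F a}" using p by (auto simp: min_def max_def split: if_splits)
    then have "p \<in> F ` {a..b}"
      using Icc_subset_funpow_image[of "{a..b}" a b 1] Icc_subset_funpow_image[of "{a..b}" b a 1] ab by auto
    then obtain w where w: "w \<in> {a..b}" "p = F w" by blast
    have "w \<noteq> a" "w \<noteq> b" using w(2) p by auto
    then have "w \<in> {a<..<b}" using w(1) by auto
    moreover have "w \<in> X" using F_X_imp_X w sub pX by blast
    ultimately show False using g by (auto simp: gap_def)
  qed
  ultimately show "gap (min (F a) (F b)) (max (F a) (F b))"
    using F_X[OF ab(2)] F_X[OF ab(3)] by (auto simp: gap_def min_def max_def)
qed

text \<open>
  If isometric itineraries of every length existed, the set \<open>X\<close> of their limits would have
  arbitrarily short gaps; these would stay gaps of constant length forever, against mixing.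
\<close>

theorem itineraries_eventually_empty: "\<exists>N. itinerary N = {}"
proof (rule ccontr)
  assume "\<not> ?thesis"
  then have ne: "itinerary n \<noteq> {}" for n by blast
  obtain u v where inf: "infinite (X \<inter> {u..v})" using X_not_locally_finite[OF ne] by blast
  obtain s where s: "s > 0" "\<And>a b. gap a b \<Longrightarrow> {a..b} \<inter> S \<noteq> {} \<Longrightarrow> s \<le> b - a"
    using gap_meeting_S by blast
  \<comment> \<open>Length below \<open>s\<close> keeps every image of the gap off \<open>S\<close>,
    since the length never changes; length below 1 is what contradicts mixing.\<close>
  obtain a b where ab: "gap a b" "b - a < min s 1" using small_gap[OF inf, of "min s 1"] s(1) by auto
  have "gap (min ((F ^^ n) a) ((F ^^ n) b)) (max ((F ^^ n) a) ((F ^^ n) b)) \<and>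
    (\<forall>x\<in>{a..b}. \<forall>y\<in>{a..b}. \<bar>(F ^^ n) x - (F ^^ n) y\<bar> = \<bar>x - y\<bar>)" for n
  proof (induction n)
    case 0
    then show ?case using ab(1) by (auto simp: gap_def min_def max_def)
  next
    case (Suc n)
    define a' b' where "a' = min ((F ^^ n) a) ((F ^^ n) b)" and "b' = max ((F ^^ n) a) ((F ^^ n) b)"
    have iso: "\<bar>(F ^^ n) x - (F ^^ n) y\<bar> = \<bar>x - y\<bar>" if "x \<in> {a..b}" "y \<in> {a..b}" for x y
      using Suc that by blast
    have g: "gap a' b'" using Suc by (simp add: a'_def b'_def)
    have abl: "a < b" using ab(1) by (simp add: gap_def)
    have len: "b' - a' = b - a" using iso[of a b] abl by (auto simp: a'_def b'_def min_def max_def split: if_splits)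
    have S: "{a'..b'} \<inter> S = {}" using s(2)[OF g] len ab(2) by auto
    note gi = gap_image[OF g S]
    have "gap (min (F a') (F b')) (max (F a') (F b'))" by (rule gi(1))
    then have "gap (min ((F ^^ Suc n) a) ((F ^^ Suc n) b)) (max ((F ^^ Suc n) a) ((F ^^ Suc n) b))"
      by (cases "(F ^^ n) a \<le> (F ^^ n) b") (simp_all add: a'_def b'_def min.commute max.commute)
    moreover have "\<bar>(F ^^ Suc n) x - (F ^^ Suc n) y\<bar> = \<bar>x - y\<bar>" if xy: "x \<in> {a..b}" "y \<in> {a..b}" for x y
    proof -
      have in': "(F ^^ n) x \<in> {a'..b'}" if "x \<in> {a..b}" for x
        using iso[of x a] iso[of x b] iso[of a b] that abl
        by (auto simp: a'_def b'_def min_def max_def abs_if split: if_splits)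
      have "{min ((F ^^ n) x) ((F ^^ n) y)<..<max ((F ^^ n) x) ((F ^^ n) y)} \<subseteq> {a'..b'}"
        using in'[OF xy(1)] in'[OF xy(2)] by auto
      then have "\<bar>F ((F ^^ n) x) - F ((F ^^ n) y)\<bar> = \<bar>(F ^^ n) x - (F ^^ n) y\<bar>"
        using gi(2) by (intro iso_on_I) blast
      then show ?thesis using iso[OF xy] by simp
    qed
    ultimately show ?case by blast
  qed
  then have iso: "\<bar>(F ^^ n) x - (F ^^ n) y\<bar> = \<bar>x - y\<bar>" if "x \<in> {a..b}" "y \<in> {a..b}" for n x y
    using that by blast
  show False
  proof (rule no_forever_short[of a b "b - a"])
    fix n x y assume "x \<in> {a<..<b}" "y \<in> {a<..<b}"
    then show "(F ^^ n) y - (F ^^ n) x \<le> b - a" using iso[of y x n] by auto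
  qed (use ab in \<open>auto simp: gap_def\<close>)
qed

end

section \<open>Expanding iterates and distortion\<close>

lemma (in circle_lift) circle_lift_funpow:
  assumes "N \<ge> 1"
  shows "circle_lift (F ^^ N) (d ^ N)"
proof
  show "continuous_on UNIV (F ^^ N)" by (rule continuous_funpow)
  show "(F ^^ N) (x + 1) = (F ^^ N) x + of_int (d ^ N)" for x
    using funpow_add_int[of N x 1] by simp
  show "mu ((F ^^ N) -` E) = mu E" if "E \<in> sets borel" "periodic E" for E
    using preserve_funpow[OF that] .
  fix a b c e :: real assume "a < b" "c < e"
  then obtain n0 where n0: "\<And>n. n \<ge> n0 \<Longrightarrow> \<exists>x\<in>{a<..<b}. \<exists>k::int. (F ^^ n) x + of_int k \<in> {c<..<e}"
    using mix by blast
  have "\<exists>x\<in>{a<..<b}. \<exists>k::int. ((F ^^ N) ^^ n) x + of_int k \<in> {c<..<e}" if "n \<ge> n0" for n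
  proof -
    have "n \<le> N * n" using assms by (cases N) auto
    then have "N * n \<ge> n0" using that by linarith
    then show ?thesis using n0 by (simp add: funpow_mult mult.commute)
  qed
  then show "\<exists>n0. \<forall>n\<ge>n0. \<exists>x\<in>{a<..<b}. \<exists>k::int. ((F ^^ N) ^^ n) x + of_int k \<in> {c<..<e}" by blast
qed

context smooth_lift
begin

lemma nonexpanding_inverse:
  assumes "{min a b<..<max a b} \<inter> S = {}"
  shows "\<bar>a - b\<bar> \<le> \<bar>F a - F b\<bar>"
proof (cases "{min a b<..<max a b} \<subseteq> I")
  case True
  then show ?thesis using iso_on_I by simp
next
  case False
  then have "{min a b<..<max a b} \<inter> I = {}" using avoids_S_cases[OF _ assms] by auto
  then have "\<gamma> * \<bar>a - b\<bar> \<le> \<bar>F a - F b\<bar>" by (rule expand_off_I[OF assms])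
  moreover have "1 * \<bar>a - b\<bar> \<le> \<gamma> * \<bar>a - b\<bar>" using \<gamma>_gt_1 by (intro mult_right_mono) auto
  ultimately show ?thesis by simp
qed

text \<open>Near an accumulation point \<open>p\<close> the map is injective on each side, as there
  are no break points other than possibly \<open>p\<close>. Infinitely many preimages there would
  yield infinitely many points of \<open>E\<close> in a bounded interval.\<close>

lemma vimage_locally_finite:
  assumes E: "\<And>u v. finite (E \<inter> {u..v})"
  shows "finite (F -` E \<inter> {u..v})"
proof (rule ccontr)
  assume "infinite (F -` E \<inter> {u..v})"
  then obtain p where p: "p islimpt (F -` E \<inter> {u..v})"
    using Heine_Borel_imp_Bolzano_Weierstrass[OF compact_Icc, of "F -` E \<inter> {u..v}" u v] by auto
  obtain r where r: "r > 0" "\<And>s. s \<in> S \<inter> {p - 1..p + 1} \<Longrightarrow> s \<noteq> p \<Longrightarrow> r \<le> dist p s"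
    using finite_set_avoid[OF S_fin[of "p - 1" "p + 1"], of p] by blast
  define q where "q = min r 1"
  have q: "q > 0" using r(1) by (simp add: q_def)
  have noS: "s \<notin> S" if "\<bar>s - p\<bar> < q" "s \<noteq> p" for s
  proof -
    have "s \<in> {p - 1..p + 1}" using that(1) by (auto simp: q_def abs_less_iff)
    then show ?thesis using r(2)[of s] that by (auto simp: q_def dist_real_def abs_minus_commute)
  qed
  define Z where "Z = F -` E \<inter> ball p q"
  have inf: "infinite Z"
  proof
    assume "finite Z"
    then have "finite (F -` E \<inter> {u..v} \<inter> ball p q)" by (rule rev_finite_subset) (auto simp: Z_def)
    then show False using p q by (simp add: islimpt_eq_infinite_ball)
  qed
  have img: "finite (F ` Z)"
  proof (rule finite_subset[OF _ E])
    show "F ` Z \<subseteq> E \<inter> {F p - K * q..F p + K * q}"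
    proof
      fix y assume "y \<in> F ` Z"
      then obtain x where x: "y = F x" "F x \<in> E" "\<bar>x - p\<bar> < q" by (auto simp: Z_def dist_real_def)
      have "\<bar>F x - F p\<bar> \<le> K * \<bar>x - p\<bar>" by (rule F_lipschitz)
      also have "\<dots> \<le> K * q" using x K by (intro mult_left_mono) auto
      finally show "y \<in> E \<inter> {F p - K * q..F p + K * q}" using x by (auto simp: abs_le_iff)
    qed
  qed
  have inj: "inj_on F A" if A: "A = {p - q<..<p} \<or> A = {p<..<p + q}" for A
  proof (rule inj_onI)
    fix x y assume xy: "x \<in> A" "y \<in> A" "F x = F y"
    have "{min x y<..<max x y} \<inter> S = {}"
    proof -
      have "s \<notin> S" if "s \<in> {min x y<..<max x y}" for s
        using noS[of s] that xy(1,2) A by (auto simp: min_def max_def split: if_splits)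
      then show ?thesis by blast
    qed
    then show "x = y" using nonexpanding_inverse[of x y] xy(3) by simp
  qed
  have "finite (Z \<inter> A)" if "A = {p - q<..<p} \<or> A = {p<..<p + q}" for A
  proof (rule finite_imageD)
    show "finite (F ` (Z \<inter> A))" by (rule finite_subset[OF _ img]) auto
    show "inj_on F (Z \<inter> A)" using inj[OF that] by (rule inj_on_subset) auto
  qed
  then have "finite ((Z \<inter> {p - q<..<p}) \<union> (Z \<inter> {p<..<p + q}) \<union> {p})" by simp
  moreover have "Z \<subseteq> (Z \<inter> {p - q<..<p}) \<union> (Z \<inter> {p<..<p + q}) \<union> {p}"
  proof
    fix x assume "x \<in> Z"
    then have "\<bar>x - p\<bar> < q" by (auto simp: Z_def dist_real_def)
    then have "x \<in> {p - q<..<p} \<or> x \<in> {p<..<p + q} \<or> x = p" by (auto simp: abs_less_iff)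
    then show "x \<in> (Z \<inter> {p - q<..<p}) \<union> (Z \<inter> {p<..<p + q}) \<union> {p}" using \<open>x \<in> Z\<close> by blast
  qed
  ultimately have "finite Z" by (rule rev_finite_subset)
  then show False using inf by blast
qed

lemma vimage_funpow_locally_finite: "finite ((F ^^ k) -` S \<inter> {u..v})"
proof -
  have "\<forall>u v. finite ((F ^^ k) -` S \<inter> {u..v})"
  proof (induction k)
    case (Suc k)
    have eq: "(F ^^ Suc k) -` S = F -` ((F ^^ k) -` S)" by (auto simp: funpow_swap1)
    show ?case
      unfolding eq using vimage_locally_finite[of "(F ^^ k) -` S"] Suc by blast
  qed (simp add: S_fin)
  then show ?thesis by blast
qed

section \<open>Distortion of iterates\<close>

definition H :: "nat \<Rightarrow> real \<Rightarrow> real" where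
  "H m x = (\<Prod>k<m. h ((F ^^ k) x))"

lemma deriv_funpow:
  assumes "\<And>k. k < m \<Longrightarrow> (F ^^ k) x \<notin> S"
  shows "((F ^^ m) has_real_derivative H m x) (at x)"
  using assms
proof (induction m)
  case 0
  show ?case using DERIV_ident[of "at x"] by (simp add: H_def id_def)
next
  case (Suc m)
  have "((F ^^ m) has_real_derivative H m x) (at x)" using Suc by simp
  moreover have "(F has_real_derivative h ((F ^^ m) x)) (at ((F ^^ m) x))" using Suc.prems by (intro deriv) simp
  ultimately have "(F \<circ> (F ^^ m) has_real_derivative h ((F ^^ m) x) * H m x) (at x)" by (intro DERIV_chain)
  then show ?case by (simp add: H_def mult.commute o_def)
qed

lemma abs_H_pos:
  assumes "\<And>k. k < m \<Longrightarrow> (F ^^ k) x \<notin> S"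
  shows "\<bar>H m x\<bar> > 0"
proof -
  have "h ((F ^^ k) x) \<noteq> 0" if "k < m" for k
    using slope_ge_1[OF assms[OF that]] by auto
  then show ?thesis by (auto simp: H_def)
qed

text \<open>Slopes have absolute value at least 1, and on that range the logarithm is
  1-Lipschitz.\<close>

lemma ln_h_lipschitz:
  assumes "{min x y..max x y} \<inter> S = {}"
  shows "\<bar>ln \<bar>h x\<bar> - ln \<bar>h y\<bar>\<bar> \<le> \<kappa> * \<bar>x - y\<bar>"
proof -
  have "x \<in> {min x y..max x y}" "y \<in> {min x y..max x y}" by auto
  then have "x \<notin> S" "y \<notin> S" using assms by blast+
  then have ge: "1 \<le> \<bar>h x\<bar>" "1 \<le> \<bar>h y\<bar>" by (auto intro: slope_ge_1)
  have *: "ln a - ln b \<le> \<bar>a - b\<bar>" if ab: "1 \<le> a" "1 \<le> b" for a b :: real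
  proof -
    have "ln a - ln b \<le> (a - b) / b" using ab by (intro ln_diff_le) auto
    also have "\<dots> \<le> \<bar>a - b\<bar> / b" using ab by (intro divide_right_mono) auto
    also have "\<dots> \<le> \<bar>a - b\<bar> / 1" using ab by (intro divide_left_mono) auto
    finally show ?thesis by simp
  qed
  have "\<bar>ln \<bar>h x\<bar> - ln \<bar>h y\<bar>\<bar> \<le> \<bar>\<bar>h x\<bar> - \<bar>h y\<bar>\<bar>"
    using *[OF ge] *[OF ge(2,1)] by linarith
  also have "\<dots> \<le> \<bar>h x - h y\<bar>" by (rule abs_triangle_ineq3)
  also have "\<dots> \<le> \<kappa> * \<bar>x - y\<bar>" by (rule h_lip[OF assms])
  finally show ?thesis .
qed

text \<open>
  Steps inside \<open>I\<close> contribute no distortion, and the others expand by \<open>\<gamma>\<close>; so the distortion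
  is bounded by a geometric series whose last term is the final distance.
\<close>

lemma log_distortion:
  assumes av: "\<And>k. k < m \<Longrightarrow> (F ^^ k) ` {a<..<b} \<inter> S = {}" and xy: "x \<in> {a<..<b}" "y \<in> {a<..<b}"
  shows "\<bar>ln \<bar>H m x\<bar> - ln \<bar>H m y\<bar>\<bar> \<le> \<kappa> / (\<gamma> - 1) * \<bar>(F ^^ m) x - (F ^^ m) y\<bar>"
  using av
proof (induction m)
  case 0
  then show ?case using \<gamma>_gt_1 \<kappa> by (simp add: H_def)
next
  case (Suc m)
  define p q where "p = (F ^^ m) x" and "q = (F ^^ m) y"
  let ?J = "(F ^^ m) ` {a<..<b}"
  have IH: "\<bar>ln \<bar>H m x\<bar> - ln \<bar>H m y\<bar>\<bar> \<le> \<kappa> / (\<gamma> - 1) * \<bar>p - q\<bar>"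
    unfolding p_def q_def using Suc by simp
  have notS: "(F ^^ k) z \<notin> S" if "k < Suc m" "z \<in> {a<..<b}" for k z
    using Suc.prems[OF that(1)] that(2) by blast
  have J: "connected ?J" "?J \<inter> S = {}" "p \<in> ?J" "q \<in> ?J"
    using Suc.prems[of m] xy
    by (auto simp: p_def q_def intro!: connected_continuous_image continuous_on_subset[OF continuous_funpow])
  have seg: "{min p q..max p q} \<subseteq> ?J"
    using J by (intro connected_contains_Icc) (auto simp: min_def max_def)
  then have seg': "{min p q<..<max p q} \<subseteq> ?J"
    using greaterThanLessThan_subseteq_atLeastAtMost_iff[of "min p q" "max p q" "min p q" "max p q"] by blast
  have lnH: "ln \<bar>H (Suc m) z\<bar> = ln \<bar>H m z\<bar> + ln \<bar>h ((F ^^ m) z)\<bar>" if z: "z \<in> {a<..<b}" for z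
  proof -
    have "\<bar>H m z\<bar> > 0" using notS z by (intro abs_H_pos) auto
    moreover have "\<bar>h ((F ^^ m) z)\<bar> > 0" using slope_ge_1[OF notS[OF lessI z]] by linarith
    ultimately have "ln (\<bar>H m z\<bar> * \<bar>h ((F ^^ m) z)\<bar>) = ln \<bar>H m z\<bar> + ln \<bar>h ((F ^^ m) z)\<bar>"
      by (simp add: ln_mult)
    then show ?thesis by (simp add: H_def abs_mult)
  qed
  have tri: "\<bar>ln \<bar>H (Suc m) x\<bar> - ln \<bar>H (Suc m) y\<bar>\<bar> \<le> \<kappa> / (\<gamma> - 1) * \<bar>p - q\<bar> + \<bar>ln \<bar>h p\<bar> - ln \<bar>h q\<bar>\<bar>"
    using IH unfolding lnH[OF xy(1)] lnH[OF xy(2)] p_def q_def by linarith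
  show ?case
  proof (cases "?J \<subseteq> I")
    case True
    then have "\<bar>h p\<bar> = 1" "\<bar>h q\<bar> = 1" using J(3,4) by (auto simp: I_def)
    moreover have "\<bar>F p - F q\<bar> = \<bar>p - q\<bar>" using True seg' by (intro iso_on_I) blast
    ultimately show ?thesis using tri by (simp add: p_def q_def)
  next
    case False
    then have JI: "?J \<inter> I = {}" using avoids_S_cases[OF J(1,2)] by blast
    have "\<gamma> * \<bar>p - q\<bar> \<le> \<bar>F p - F q\<bar>" using JI J(2) seg' by (intro expand_off_I) blast+
    then have "\<kappa> / (\<gamma> - 1) * (\<gamma> * \<bar>p - q\<bar>) \<le> \<kappa> / (\<gamma> - 1) * \<bar>F p - F q\<bar>"
      using \<gamma>_gt_1 \<kappa> by (intro mult_left_mono) auto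
    \<comment> \<open>The constant \<open>C = \<kappa> / (\<gamma> - 1)\<close> is the one with
      \<open>C * \<gamma> = C + \<kappa>\<close>: the expansion of this step pays for its own
      distortion.\<close>
    moreover have "\<kappa> / (\<gamma> - 1) * (\<gamma> * \<bar>p - q\<bar>) = \<kappa> / (\<gamma> - 1) * \<bar>p - q\<bar> + \<kappa> * \<bar>p - q\<bar>"
      using \<gamma>_gt_1 by (simp add: field_simps)
    moreover have "\<bar>ln \<bar>h p\<bar> - ln \<bar>h q\<bar>\<bar> \<le> \<kappa> * \<bar>p - q\<bar>"
      using seg J(2) by (intro ln_h_lipschitz) blast
    ultimately show ?thesis using tri by (simp add: p_def q_def)
  qed
qed

lemma image_at_most_K:
  assumes av: "\<And>k. k < m \<Longrightarrow> (F ^^ k) ` {a<..<b} \<inter> S = {}" and m: "m \<ge> 1"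
    and xy: "x \<in> {a<..<b}" "y \<in> {a<..<b}"
  shows "\<bar>(F ^^ m) x - (F ^^ m) y\<bar> \<le> K"
proof -
  obtain n where n: "m = Suc n" using m by (cases m) auto
  have "{min x y<..<max x y} \<subseteq> {a<..<b}" using xy by auto
  then have "{min ((F ^^ n) x) ((F ^^ n) y)<..<max ((F ^^ n) x) ((F ^^ n) y)} \<inter> S = {}"
    using Ioo_subset_funpow_image[of n x y] av[of n] n by blast
  then have "\<not> max ((F ^^ n) x) ((F ^^ n) y) - min ((F ^^ n) x) ((F ^^ n) y) > 1"
    using periodic_meets_interval[OF S_per S_ne] by blast
  then have "\<bar>(F ^^ n) x - (F ^^ n) y\<bar> \<le> 1" by (auto simp: min_def max_def split: if_splits)
  then have "K * \<bar>(F ^^ n) x - (F ^^ n) y\<bar> \<le> K * 1" using K by (intro mult_left_mono) auto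
  then show ?thesis using F_lipschitz[of "(F ^^ n) x" "(F ^^ n) y"] n by simp
qed

lemma mean_value_funpow:
  assumes av: "\<And>k. k < m \<Longrightarrow> (F ^^ k) ` {a<..<b} \<inter> S = {}" and xy: "x \<in> {a<..<b}" "y \<in> {a<..<b}"
  shows "\<exists>z\<in>{a<..<b}. \<bar>(F ^^ m) x - (F ^^ m) y\<bar> = \<bar>x - y\<bar> * \<bar>H m z\<bar>"
proof -
  have d: "((F ^^ m) has_real_derivative H m z) (at z)" if "z \<in> {a<..<b}" for z
    using av that by (intro deriv_funpow) blast
  have *: "\<exists>z\<in>{a<..<b}. (F ^^ m) y - (F ^^ m) x = (y - x) * H m z" if "x < y" "x \<in> {a<..<b}" "y \<in> {a<..<b}" for x y
    using MVT2[OF that(1), of "F ^^ m" "H m"] d that by fastforce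
  consider "x < y" | "y < x" | "x = y" by linarith
  then show ?thesis
  proof cases
    case 1
    from *[OF 1 xy] show ?thesis by (metis abs_minus_commute abs_mult)
  next
    case 2
    from *[OF 2 xy(2,1)] show ?thesis by (metis abs_mult)
  next
    case 3
    then show ?thesis using xy by auto
  qed
qed

text \<open>The exponential of the bound in \<open>log_distortion\<close> when the final distance is
  at most \<open>K\<close>.\<close>

definition \<Delta> :: real where "\<Delta> = exp (\<kappa> / (\<gamma> - 1) * K)"

text \<open>By the mean value theorem both difference quotients are values of
  \<open>\<bar>H m\<bar>\<close> on the same branch. At \<open>m = 0\<close> the length bound
  \<open>K\<close> is not at hand, but there both values are 1.\<close>

lemma bounded_distortion:
  assumes av: "\<And>k. k < m \<Longrightarrow> (F ^^ k) ` {a<..<b} \<inter> S = {}"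
    and xy: "x \<in> {a<..<b}" "y \<in> {a<..<b}" "x' \<in> {a<..<b}" "y' \<in> {a<..<b}"
  shows "\<bar>(F ^^ m) x - (F ^^ m) y\<bar> * \<bar>x' - y'\<bar> \<le> \<Delta> * \<bar>(F ^^ m) x' - (F ^^ m) y'\<bar> * \<bar>x - y\<bar>"
proof -
  obtain z where z: "z \<in> {a<..<b}" "\<bar>(F ^^ m) x - (F ^^ m) y\<bar> = \<bar>x - y\<bar> * \<bar>H m z\<bar>"
    using mean_value_funpow[OF av xy(1,2)] by blast
  obtain z' where z': "z' \<in> {a<..<b}" "\<bar>(F ^^ m) x' - (F ^^ m) y'\<bar> = \<bar>x' - y'\<bar> * \<bar>H m z'\<bar>"
    using mean_value_funpow[OF av xy(3,4)] by blast
  have pos: "\<bar>H m z\<bar> > 0" "\<bar>H m z'\<bar> > 0"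
    using av z(1) z'(1) by (intro abs_H_pos; blast)+
  have "\<bar>H m z\<bar> \<le> \<Delta> * \<bar>H m z'\<bar>"
  proof (cases "m \<ge> 1")
    case True
    have "ln \<bar>H m z\<bar> - ln \<bar>H m z'\<bar> \<le> \<kappa> / (\<gamma> - 1) * \<bar>(F ^^ m) z - (F ^^ m) z'\<bar>"
      using log_distortion[of m a b z z', OF av z(1) z'(1)] by linarith
    also have "\<dots> \<le> \<kappa> / (\<gamma> - 1) * K"
      using image_at_most_K[OF av True z(1) z'(1)] \<gamma>_gt_1 \<kappa> by (intro mult_left_mono) auto
    finally have "exp (ln \<bar>H m z\<bar>) \<le> exp (\<kappa> / (\<gamma> - 1) * K + ln \<bar>H m z'\<bar>)" by simp
    then show ?thesis using pos by (simp add: exp_add \<Delta>_def)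
  next
    case False
    have "0 \<le> \<kappa> / (\<gamma> - 1) * K" using \<gamma>_gt_1 \<kappa> K by (intro mult_nonneg_nonneg divide_nonneg_nonneg) auto
    then show ?thesis using False by (simp add: H_def \<Delta>_def not_le)
  qed
  then have "(\<bar>x - y\<bar> * \<bar>x' - y'\<bar>) * \<bar>H m z\<bar> \<le> (\<bar>x - y\<bar> * \<bar>x' - y'\<bar>) * (\<Delta> * \<bar>H m z'\<bar>)"
    by (intro mult_left_mono) auto
  then show ?thesis unfolding z(2) z'(2) by (simp add: mult_ac)
qed

text \<open>A branch of \<open>F ^^ N\<close> cannot stay in \<open>I\<close> for \<open>N\<close>
  steps; in the step that starts off \<open>I\<close> it gains the factor \<open>\<gamma>\<close>,
  and no other step contracts. Its cut set gathers the preimages of \<open>S\<close> at all times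
  below \<open>N\<close>, so the distortion bound for \<open>F\<close> applies with the same
  \<open>\<Delta>\<close>.\<close>

lemma uniformly_expanding_iterate:
  "\<exists>N T. expanding_lift (F ^^ N) (d ^ N) (K ^ N) \<gamma> \<Delta> T"
proof -
  obtain N where N: "itinerary N = {}" using itineraries_eventually_empty by blast
  have N1: "N \<ge> 1"
  proof (rule ccontr)
    assume "\<not> N \<ge> 1"
    then have "N = 0" by simp
    then show False using N by (simp add: itinerary_def)
  qed
  define T where "T = (\<Union>k<N. (F ^^ k) -` S)"
  have expand: "\<gamma> * \<bar>a - b\<bar> \<le> \<bar>(F ^^ N) a - (F ^^ N) b\<bar>" if ab: "{min a b<..<max a b} \<inter> T = {}" for a b
  proof (cases "a = b")
    case False
    let ?J = "{min a b<..<max a b}"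
    \<comment> \<open>One point of the branch that leaves \<open>I\<close> at some time
      \<open>k0\<close> suffices: by \<open>avoids_S_cases\<close> the whole image is then off
      \<open>I\<close> at that time.\<close>
    have "(a + b) / 2 \<in> ?J" using False by (auto simp: min_def max_def field_simps)
    moreover have "(a + b) / 2 \<notin> itinerary N" using N by simp
    ultimately obtain k0 where k0: "k0 < N" "\<not> (F ^^ k0) ` ?J \<subseteq> I" by (force simp: itinerary_def)
    have av: "(F ^^ k) ` ?J \<inter> S = {}" if "k < N" for k
      using ab that by (auto simp: T_def)
    have conn: "connected ((F ^^ k) ` ?J)" for k
      by (intro connected_continuous_image continuous_on_subset[OF continuous_funpow]) auto
    have step: "\<bar>(F ^^ k) a - (F ^^ k) b\<bar> \<le> \<bar>(F ^^ Suc k) a - (F ^^ Suc k) b\<bar>" if "k < N" for k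
    proof -
      have "{min ((F ^^ k) a) ((F ^^ k) b)<..<max ((F ^^ k) a) ((F ^^ k) b)} \<inter> S = {}"
        using Ioo_subset_funpow_image[of k a b] av[OF that] by blast
      then show ?thesis using nonexpanding_inverse by simp
    qed
    have "\<bar>a - b\<bar> \<le> \<bar>(F ^^ k) a - (F ^^ k) b\<bar> \<and>
      (k0 < k \<longrightarrow> \<gamma> * \<bar>a - b\<bar> \<le> \<bar>(F ^^ k) a - (F ^^ k) b\<bar>)" if "k \<le> N" for k
      using that
    proof (induction k)
      case (Suc k)
      show ?case
      proof (cases "k = k0")
        case True
        have "(F ^^ k) ` ?J \<inter> I = {}" using avoids_S_cases[OF conn av] k0 True by blast
        then have "\<gamma> * \<bar>(F ^^ k) a - (F ^^ k) b\<bar> \<le> \<bar>F ((F ^^ k) a) - F ((F ^^ k) b)\<bar>"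
          using Ioo_subset_funpow_image[of k a b] av[of k] Suc.prems by (intro expand_off_I) auto
        moreover have "\<gamma> * \<bar>a - b\<bar> \<le> \<gamma> * \<bar>(F ^^ k) a - (F ^^ k) b\<bar>"
          using Suc \<gamma>_gt_1 by (intro mult_left_mono) auto
        moreover have "\<bar>a - b\<bar> \<le> \<bar>(F ^^ Suc k) a - (F ^^ Suc k) b\<bar>"
          using Suc step[of k] by simp
        ultimately show ?thesis by simp
      next
        case False
        then show ?thesis using Suc step[of k] by force
      qed
    qed simp
    then show ?thesis using k0(1) by blast
  qed simp
  interpret G: circle_lift "F ^^ N" "d ^ N" by (rule circle_lift_funpow[OF N1])
  have "expanding_lift (F ^^ N) (d ^ N) (K ^ N) \<gamma> \<Delta> T"
  proof
    show "1 \<le> K ^ N" using K by simp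
    show "\<bar>(F ^^ N) x - (F ^^ N) y\<bar> \<le> K ^ N * \<bar>x - y\<bar>" for x y by (rule lipschitz_funpow[OF F_lipschitz]) (use K in simp)
    show "periodic T"
      using periodic_vimage_funpow[OF S_per] by (auto simp: T_def periodic_def)
    show "finite (T \<inter> {u..v})" for u v
    proof -
      have eq: "T \<inter> {u..v} = (\<Union>k<N. (F ^^ k) -` S \<inter> {u..v})" by (auto simp: T_def)
      show ?thesis unfolding eq using vimage_funpow_locally_finite by (intro finite_UN_I) auto
    qed
    show "T \<noteq> {}"
    proof -
      have "(F ^^ 0) -` S \<subseteq> T" unfolding T_def using N1 by (intro UN_upper) simp
      then show ?thesis using S_ne by auto
    qed
    show "\<gamma> * \<bar>a - b\<bar> \<le> \<bar>(F ^^ N) a - (F ^^ N) b\<bar>" if "{min a b<..<max a b} \<inter> T = {}" for a b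
      using expand that .
    show "1 < \<gamma>" by (rule \<gamma>_gt_1)
    show "0 < \<Delta>" by (simp add: \<Delta>_def)
    fix n :: nat and a b x y x' y' :: real
    assume av: "\<And>k. k < n \<Longrightarrow> ((F ^^ N) ^^ k) ` {a<..<b} \<inter> T = {}"
      and xy: "x \<in> {a<..<b}" "y \<in> {a<..<b}" "x' \<in> {a<..<b}" "y' \<in> {a<..<b}"
    \<comment> \<open>Time \<open>k\<close> of \<open>F\<close> is \<open>k div N\<close> steps of
      the iterate followed by \<open>k mod N\<close> steps of \<open>F\<close>, and the latter are
      what \<open>T\<close> accounts for.\<close>
    have "(F ^^ k) ` {a<..<b} \<inter> S = {}" if k: "k < N * n" for k
    proof -
      have "k div N < n" using k N1 by (simp add: less_mult_imp_div_less mult.commute)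
      then have "((F ^^ N) ^^ (k div N)) ` {a<..<b} \<inter> T = {}" by (rule av)
      moreover have "k mod N < N" using N1 by simp
      moreover have "(F ^^ k) z = (F ^^ (k mod N)) (((F ^^ N) ^^ (k div N)) z)" for z
      proof -
        have "(F ^^ k) z = (F ^^ (k mod N + N * (k div N))) z" by simp
        also have "\<dots> = (F ^^ (k mod N)) ((F ^^ (N * (k div N))) z)" by (simp only: funpow_add comp_apply)
        finally show ?thesis by (simp only: funpow_mult)
      qed
      ultimately show ?thesis by (auto simp: T_def)
    qed
    from bounded_distortion[OF this xy]
    show "\<bar>((F ^^ N) ^^ n) x - ((F ^^ N) ^^ n) y\<bar> * \<bar>x' - y'\<bar> \<le> \<Delta> * \<bar>((F ^^ N) ^^ n) x' - ((F ^^ N) ^^ n) y'\<bar> * \<bar>x - y\<bar>"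
      by (simp only: funpow_mult)
  qed
  then show ?thesis by blast
qed

theorem smooth_tail_trivial:
  assumes A: "A \<in> sets borel" "mu A > 0"
    and B: "\<And>n. B n \<in> sets borel" "\<And>n. periodic (B n)" "\<And>n. A = (F ^^ n) -` B n"
  shows "mu (- A) = 0"
proof -
  obtain N T where "expanding_lift (F ^^ N) (d ^ N) (K ^ N) \<gamma> \<Delta> T"
    using uniformly_expanding_iterate by blast
  then interpret G: expanding_lift "F ^^ N" "d ^ N" "K ^ N" \<gamma> \<Delta> T .
  show ?thesis
    by (rule G.tail_trivial[OF A, of "\<lambda>n. B (N * n)"]) (use B in \<open>auto simp: funpow_mult\<close>)
qed

end

section \<open>Exactness implies mixing\<close>

lemma measure_preserving_map_funpow:
  assumes "measure_preserving_map M f"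
  shows "measure_preserving_map M (f ^^ n)"
proof (induction n)
  case 0
  then show ?case by (auto simp: measure_preserving_map_def Int_absorb2 dest: sets.sets_into_space)
next
  case (Suc n)
  have f: "f \<in> M \<rightarrow>\<^sub>M M" "\<And>A. A \<in> sets M \<Longrightarrow> emeasure M (f -` A \<inter> space M) = emeasure M A"
    and fn: "f ^^ n \<in> M \<rightarrow>\<^sub>M M" "\<And>A. A \<in> sets M \<Longrightarrow> emeasure M ((f ^^ n) -` A \<inter> space M) = emeasure M A"
    using assms Suc by (auto simp: measure_preserving_map_def)
  have "emeasure M ((f ^^ Suc n) -` A \<inter> space M) = emeasure M A" if A: "A \<in> sets M" for A
  proof -
    have "(f ^^ Suc n) -` A \<inter> space M = (f ^^ n) -` (f -` A \<inter> space M) \<inter> space M"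
      using measurable_space[OF fn(1)] by (auto simp: funpow_swap1)
    then show ?thesis
      using f(2)[OF A] fn(2)[OF measurable_sets[OF f(1) A]] by simp
  qed
  moreover have "f ^^ Suc n \<in> M \<rightarrow>\<^sub>M M"
    using f(1) fn(1) by (simp add: measurable_comp)
  ultimately show ?case
    by (auto simp: measure_preserving_map_def simp del: comp_apply funpow.simps)
qed

text \<open>Take the mean as threshold. Exceeding it almost surely would make the mean larger than
  itself; so \<open>L\<close> is almost surely at most its mean, and having the same integral it
  equals it.\<close>

lemma (in prob_space) zero_one_imp_AE_const:
  fixes L :: "'a \<Rightarrow> real"
  assumes [measurable]: "integrable M L"
    and zo: "\<And>c. prob {x \<in> space M. L x > c} = 0 \<or> prob {x \<in> space M. L x > c} = 1"
  shows "AE x in M. L x = expectation L"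
proof -
  let ?c = "expectation L"
  have m[measurable]: "L \<in> borel_measurable M" using assms(1) by auto
  have "AE x in M. L x \<le> ?c"
  proof -
    have "prob {x \<in> space M. L x > ?c} \<noteq> 1"
    proof
      assume "prob {x \<in> space M. L x > ?c} = 1"
      then have "AE x in M. L x > ?c"
        by (subst (asm) prob_Collect_eq_1) auto
      then have "integral\<^sup>L M (\<lambda>x. ?c) < integral\<^sup>L M L"
        by (intro integral_less_AE_space) (use assms(1) emeasure_space_1 in \<open>auto\<close>)
      then show False by (simp add: prob_space)
    qed
    then have "prob {x \<in> space M. L x > ?c} = 0" using zo by blast
    then have "AE x in M. \<not> (L x > ?c)"
      by (subst (asm) prob_Collect_eq_0) auto
    then show ?thesis by (simp add: not_less)
  qed
  moreover have "integral\<^sup>L M (\<lambda>x. ?c - L x) = 0"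
    using assms(1) by (simp add: prob_space)
  ultimately have "AE x in M. ?c - L x = 0"
    using assms(1) by (subst (asm) integral_nonneg_eq_0_iff_AE) auto
  then show ?thesis by auto
qed

text \<open>
  The conditional expectations of an indicator with respect to the decreasing algebras
  \<open>f\<^sup>-\<^sup>n(sets M)\<close> have decreasing \<open>L\<^sup>2\<close> norms, hence converge; by exactness the limit,
  being measurable with respect to the tail, is constant.
\<close>

lemma (in prob_space) exact_imp_strongly_mixing:
  assumes mp: "measure_preserving_map M f" and ex: "measure_exact M f"
  shows "strongly_mixing M f"
proof -
  have fn[measurable]: "f ^^ n \<in> M \<rightarrow>\<^sub>M M"
    and mpn: "\<And>A. A \<in> sets M \<Longrightarrow> emeasure M ((f ^^ n) -` A \<inter> space M) = emeasure M A" for n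
    using measure_preserving_map_funpow[OF mp] by (auto simp: measure_preserving_map_def)
  \<comment> \<open>The events that depend only on the state at time \<open>n\<close>; these
    algebras decrease with \<open>n\<close>.\<close>
  define F where "F n = vimage_algebra (space M) (f ^^ n) M" for n
  have fsp: "f ^^ n \<in> space M \<rightarrow> space M" for n
    using measurable_space[OF fn] by auto
  have setsF: "sets (F n) = {(f ^^ n) -` A \<inter> space M |A. A \<in> sets M}" for n
    unfolding F_def by (rule sets_vimage_algebra2[OF fsp])
  have spF[simp]: "space (F n) = space M" for n by (simp add: F_def)
  have sub: "subalgebra M (F n)" for n
    unfolding subalgebra_def setsF using measurable_sets[OF fn] by auto
  have fst: "sets (F m) \<subseteq> sets (F n)" if "n \<le> m" for n m
  proof
    fix E assume "E \<in> sets (F m)"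
    then obtain A where A: "A \<in> sets M" "E = (f ^^ m) -` A \<inter> space M" by (auto simp: setsF)
    have "(f ^^ m) x = (f ^^ (m - n)) ((f ^^ n) x)" for x
      using that by (metis funpow_add le_add_diff_inverse2 o_apply)
    then have "E = (f ^^ n) -` ((f ^^ (m - n)) -` A \<inter> space M) \<inter> space M"
      using A(2) fsp[of n] by auto
    then show "E \<in> sets (F n)"
      unfolding setsF using A(1) measurable_sets[OF fn] by blast
  qed
  have subF: "subalgebra (F n) (F m)" if "n \<le> m" for n m
    using fst[OF that] by (auto simp: subalgebra_def)
  have sfs: "sigma_finite_subalgebra M (F n)" for n
    using sub by (intro finite_measure_subalgebra_is_sigma_finite)
      (simp add: finite_measure_subalgebra_def finite_measure_subalgebra_axioms_def finite_measure_axioms)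
  show ?thesis
    unfolding strongly_mixing_def
  proof (intro ballI)
    fix A B assume A[measurable]: "A \<in> sets M" and B[measurable]: "B \<in> sets M"
    define \<phi> :: "'a \<Rightarrow> real" where "\<phi> = indicator B"
    have \<phi>i: "integrable M \<phi>" by (simp add: \<phi>_def emeasure_eq_measure)
    define X where "X n = real_cond_exp M (F n) \<phi>" for n
    have XF: "X n \<in> borel_measurable (F n)" for n by (simp add: X_def)
    have XFn: "X m \<in> borel_measurable (F n)" if "n \<le> m" for n m
      by (rule measurable_from_subalg[OF subF[OF that] XF])
    have XM[measurable]: "X n \<in> borel_measurable M" for n
      by (rule measurable_from_subalg[OF sub XF])
    have X0: "AE x in M. 0 \<le> X n x" for n
      unfolding X_def by (rule sigma_finite_subalgebra.real_cond_exp_pos[OF sfs]) (auto simp: \<phi>_def)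
    have X1: "AE x in M. X n x \<le> 1" for n
      unfolding X_def by (rule sigma_finite_subalgebra.real_cond_exp_le_c[OF sfs \<phi>i]) (auto simp: \<phi>_def indicator_def)
    have Xb: "AE x in M. \<bar>X n x\<bar> \<le> 1" for n using X0[of n] X1[of n] by eventually_elim auto
    have Xi: "integrable M (X n)" for n
      by (rule integrable_const_bound[where B=1]) (use Xb in auto)
    have XXi: "integrable M (\<lambda>x. X m x * X n x)" for m n
    proof (rule integrable_const_bound[where B=1])
      show "AE x in M. norm (X m x * X n x) \<le> 1"
        using Xb[of m] Xb[of n] by eventually_elim (simp add: abs_mult mult_le_one)
    qed auto
    define q where "q n = (\<integral>x. X n x * X n x \<partial>M)" for n
    \<comment> \<open>For \<open>n \<le> m\<close>, projecting \<open>X n\<close> to the smaller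
      algebra \<open>F m\<close> gives \<open>X m\<close>. Pythagoras then expresses squared
      distances as differences of \<open>q\<close>.\<close>
    have cross: "(\<integral>x. X m x * X n x \<partial>M) = q m" if "n \<le> m" for n m
    proof -
      have "(\<integral>x. X m x * X n x \<partial>M) = (\<integral>x. X m x * real_cond_exp M (F m) (X n) x \<partial>M)"
        by (rule sigma_finite_subalgebra.real_cond_exp_intg(2)[OF sfs, symmetric]) (use XXi XF in auto)
      also have "\<dots> = q m"
        unfolding q_def
      proof (rule integral_cong_AE)
        have "AE x in M. real_cond_exp M (F m) (X n) x = X m x"
          unfolding X_def
          by (rule sigma_finite_subalgebra.real_cond_exp_nested_subalg[OF sfs sub subF[OF that] \<phi>i])
        then show "AE x in M. X m x * real_cond_exp M (F m) (X n) x = X m x * X m x"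
          by eventually_elim simp
      qed auto
      finally show ?thesis .
    qed
    have sq: "(\<integral>x. (X n x - X m x)\<^sup>2 \<partial>M) = q n - q m" if "n \<le> m" for n m
    proof -
      have "(\<integral>x. (X n x - X m x)\<^sup>2 \<partial>M) = (\<integral>x. X n x * X n x - 2 * (X m x * X n x) + X m x * X m x \<partial>M)"
        by (rule Bochner_Integration.integral_cong) (auto simp: power2_eq_square algebra_simps)
      also have "\<dots> = q n - 2 * q m + q m"
        using XXi cross[OF that] by (simp add: q_def)
      finally show ?thesis by simp
    qed
    have "decseq q"
    proof (rule decseq_SucI)
      fix n have "0 \<le> (\<integral>x. (X n x - X (Suc n) x)\<^sup>2 \<partial>M)" by simp
      then show "q (Suc n) \<le> q n" using sq[of n "Suc n"] by simp
    qed
    moreover have q0: "0 \<le> q n" for n by (simp add: q_def)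
    ultimately obtain l where l: "q \<longlonglongrightarrow> l" "\<And>i. l \<le> q i"
      using decseq_convergent[of q 0] by blast
    have "\<exists>n. \<forall>i\<ge>n. q i - l < (1/4)^k" for k :: nat
    proof -
      have "eventually (\<lambda>i. q i < l + (1/4)^k) sequentially"
        by (rule order_tendstoD(2)[OF l(1)]) simp
      then show ?thesis unfolding eventually_sequentially by (simp add: algebra_simps)
    qed
    then obtain N where N: "\<And>k i. i \<ge> N k \<Longrightarrow> q i - l < (1/4)^k" by metis
    \<comment> \<open>A monotone subsequence along which consecutive \<open>L\<^sup>2\<close>
      distances squared are at most \<open>(1/4)^k\<close>. The summand \<open>k\<close> gives
      \<open>r k \<ge> k\<close>, needed for the limit to be tail measurable.\<close>
    define r where "r k = (\<Sum>j\<le>k. N j) + k" for k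
    have rN: "r k \<ge> N k" "r k \<ge> k" for k
      using member_le_sum[of k "{..k}" N] by (auto simp: r_def)
    have rmono: "r j \<le> r k" if "j \<le> k" for j k
      unfolding r_def using that by (intro add_mono sum_mono2[OF finite_atMost]) (simp_all add: atMost_subset_iff)
    define u where "u k x = X (r (Suc k)) x - X (r k) x" for k x
    have um[measurable]: "u k \<in> borel_measurable M" for k unfolding u_def by measurable
    have ui: "integrable M (u k)" for k unfolding u_def using Xi by auto
    have u1: "(\<integral>x. \<bar>u k x\<bar> \<partial>M) \<le> (1/2)^k" for k
    proof -
      have i2: "integrable M (\<lambda>x. (u k x)\<^sup>2)"
        unfolding u_def power2_diff using XXi by (auto simp: power2_eq_square mult.assoc)
      \<comment> \<open>The arithmetic-geometric mean inequality in place of Cauchy-Schwarz; the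
        weights balance because the integral of the square is at most
        \<open>(1/4)^k\<close>.\<close>
      have "\<bar>u k x\<bar> \<le> ((1/2)^k + 2^k * (u k x)\<^sup>2) / 2" for x
      proof -
        have "0 \<le> (1/2)^k * (1 - 2^k * \<bar>u k x\<bar>)\<^sup>2" by simp
        also have "\<dots> = (1/2)^k - 2 * \<bar>u k x\<bar> + 2^k * (u k x)\<^sup>2"
          by (simp add: power2_eq_square field_simps power_one_over flip: power_mult_distrib)
        finally show ?thesis by simp
      qed
      then have "(\<integral>x. \<bar>u k x\<bar> \<partial>M) \<le> (\<integral>x. ((1/2)^k + 2^k * (u k x)\<^sup>2) / 2 \<partial>M)"
        using ui i2 by (intro integral_mono) auto
      also have "\<dots> = ((1/2)^k + 2^k * (\<integral>x. (u k x)\<^sup>2 \<partial>M)) / 2"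
        using i2 by (simp add: prob_space)
      also have "(\<integral>x. (u k x)\<^sup>2 \<partial>M) = q (r k) - q (r (Suc k))"
        using sq[OF rmono[of k "Suc k"]] by (simp add: u_def power2_commute)
      also have "\<dots> \<le> (1/4)^k"
        using N[OF rN(1)[of k]] l(2)[of "r (Suc k)"] by simp
      also have "((1/2)^k + 2^k * (1/4::real)^k) / 2 = (1/2)^k"
        by (simp flip: power_mult_distrib)
      finally show ?thesis by (simp add: divide_right_mono)
    qed
    have "AE x in M. summable (\<lambda>k. u k x)"
    proof -
      have "(\<integral>\<^sup>+x. (\<Sum>k. ennreal \<bar>u k x\<bar>) \<partial>M) = (\<Sum>k. \<integral>\<^sup>+x. ennreal \<bar>u k x\<bar> \<partial>M)"
        by (rule nn_integral_suminf) auto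
      also have "\<dots> = (\<Sum>k. ennreal (\<integral>x. \<bar>u k x\<bar> \<partial>M))"
        using ui by (subst nn_integral_eq_integral) auto
      also have "\<dots> \<le> (\<Sum>k. ennreal ((1/2)^k))"
        by (intro suminf_le ennreal_leI u1) auto
      also have "\<dots> < \<infinity>"
        by (subst suminf_ennreal2) auto
      finally have "(\<integral>\<^sup>+x. (\<Sum>k. ennreal \<bar>u k x\<bar>) \<partial>M) \<noteq> \<infinity>" by simp
      then have "AE x in M. (\<Sum>k. ennreal \<bar>u k x\<bar>) \<noteq> \<infinity>"
        by (intro nn_integral_PInf_AE) auto
      then show ?thesis
      proof eventually_elim
        fix x assume "(\<Sum>k. ennreal \<bar>u k x\<bar>) \<noteq> \<infinity>"
        then have "summable (\<lambda>k. \<bar>u k x\<bar>)"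
          by (intro summable_suminf_not_top) auto
        then show "summable (\<lambda>k. u k x)" by (rule summable_rabs_cancel)
      qed
    qed
    define L where "L x = lim (\<lambda>k. X (r k) x)" for x
    have XL: "AE x in M. (\<lambda>k. X (r k) x) \<longlonglongrightarrow> L x"
      using \<open>AE x in M. summable (\<lambda>k. u k x)\<close>
    proof eventually_elim
      fix x assume "summable (\<lambda>k. u k x)"
      then have "(\<lambda>n. X (r 0) x + (\<Sum>k<n. u k x)) \<longlonglongrightarrow> X (r 0) x + suminf (\<lambda>k. u k x)"
        by (intro tendsto_intros summable_LIMSEQ)
      then have "(\<lambda>n. X (r n) x) \<longlonglongrightarrow> X (r 0) x + suminf (\<lambda>k. u k x)"
        unfolding u_def sum_lessThan_telescope[of "\<lambda>k. X (r k) x"] by simp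
      then show "(\<lambda>k. X (r k) x) \<longlonglongrightarrow> L x"
        unfolding L_def by (simp add: limI)
    qed
    \<comment> \<open>A limit ignores its first \<open>n\<close> terms, and all later ones are
      measurable with respect to \<open>F n\<close>. This also covers points without convergence,
      since \<open>lim\<close> then still depends only on the tail of the sequence.\<close>
    have LF: "L \<in> borel_measurable (F n)" for n
    proof -
      have "L = (\<lambda>x. lim (\<lambda>k. X (r (k + n)) x))"
        unfolding L_def lim_def
        by (intro ext arg_cong[where f=The]) (auto intro: LIMSEQ_ignore_initial_segment LIMSEQ_offset[where k=n])
      moreover have "X (r (k + n)) \<in> borel_measurable (F n)" for k
        by (rule XFn) (use rN(2)[of "k+n"] in simp)
      ultimately show ?thesis
        by (simp add: borel_measurable_lim_metric)
    qed
    have LM[measurable]: "L \<in> borel_measurable M"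
      by (rule measurable_from_subalg[OF sub LF])
    have Xball: "AE x in M. \<forall>k. \<bar>X (r k) x\<bar> \<le> 1"
      using Xb by (simp add: AE_all_countable)
    have Lb: "AE x in M. \<bar>L x\<bar> \<le> 1"
      using XL Xball by eventually_elim (rule LIMSEQ_le_const2[OF tendsto_rabs], auto)
    have Li: "integrable M L"
      by (rule integrable_const_bound[where B=1]) (use Lb in auto)
    have zo: "prob {x \<in> space M. L x > c} = 0 \<or> prob {x \<in> space M. L x > c} = 1" for c
    proof -
      have "{x \<in> space M. L x > c} \<in> sets (F n)" for n
        using measurable_sets[OF LF[of n], of "{c<..}"] by (simp add: vimage_def Int_def conj_commute)
      then have "{x \<in> space M. L x > c} \<in> (\<Inter>n. {(f ^^ n) -` B \<inter> space M |B. B \<in> sets M})"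
        unfolding setsF by blast
      then have "prob {x \<in> space M. L x > c} * prob (space M - {x \<in> space M. L x > c}) = 0"
        using ex unfolding measure_exact_def by blast
      then show ?thesis by (auto simp: prob_compl)
    qed
    define c where "c = expectation L"
    have Lc: "AE x in M. L x = c"
      unfolding c_def by (rule zero_one_imp_AE_const[OF Li zo])
    have XLi: "(\<lambda>k. \<integral>x. X (r k) x \<partial>M) \<longlonglongrightarrow> (\<integral>x. L x \<partial>M)"
      by (rule integral_dominated_convergence[where w="\<lambda>_. 1"]) (use XL Xb in auto)
    have "(\<integral>x. X n x \<partial>M) = prob B" for n
      unfolding X_def using sigma_finite_subalgebra.real_cond_exp_int(2)[OF sfs \<phi>i]
      by (simp add: \<phi>_def)
    then have cB: "c = prob B"
      using XLi by (simp add: c_def LIMSEQ_const_iff)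
    have X1lim: "(\<lambda>k. \<integral>x. \<bar>X (r k) x - c\<bar> \<partial>M) \<longlonglongrightarrow> (\<integral>x. 0 \<partial>M)"
    proof (rule integral_dominated_convergence[where w="\<lambda>_. 1 + \<bar>c\<bar>"])
      show "AE x in M. (\<lambda>k. \<bar>X (r k) x - c\<bar>) \<longlonglongrightarrow> 0"
        using XL Lc by eventually_elim (auto intro!: tendsto_rabs_zero simp: LIM_zero)
      show "AE x in M. norm \<bar>X (r k) x - c\<bar> \<le> 1 + \<bar>c\<bar>" for k
        using Xb[of "r k"] by eventually_elim auto
    qed auto
    \<comment> \<open>For \<open>n \<ge> r k\<close> the event at time \<open>n\<close> already
      belongs to \<open>F (r k)\<close>, so the indicator of \<open>B\<close> may be replaced by its
      conditional expectation. Thus convergence along the subsequence controls every later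
      \<open>n\<close>.\<close>
    have key: "\<bar>prob ((f ^^ n) -` A \<inter> B) - prob A * prob B\<bar> \<le> (\<integral>x. \<bar>X (r k) x - c\<bar> \<partial>M)" if "n \<ge> r k" for n k
    proof -
      define a :: "'a \<Rightarrow> real" where "a = indicator ((f ^^ n) -` A \<inter> space M)"
      have am: "a \<in> borel_measurable (F (r k))"
      proof -
        have "(f ^^ n) -` A \<inter> space M \<in> sets (F n)"
          unfolding setsF using A by blast
        then show ?thesis
          unfolding a_def using fst[OF that] by (intro borel_measurable_indicator) blast
      qed
      have aM[measurable]: "a \<in> borel_measurable M" by (rule measurable_from_subalg[OF sub am])
      have pA: "(\<integral>x. a x \<partial>M) = prob A"
        using mpn[OF A, of n] measurable_sets[OF fn A, of n] by (simp add: a_def measure_def)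
      have ai: "integrable M (\<lambda>x. a x * g x)" if "integrable M g" for g
        using integrable_real_mult_indicator[OF measurable_sets[OF fn A, of n] that] by (simp add: a_def mult.commute)
      have "prob ((f ^^ n) -` A \<inter> B) = (\<integral>x. a x * \<phi> x \<partial>M)"
      proof -
        have "(\<lambda>x. a x * \<phi> x) = indicator ((f ^^ n) -` A \<inter> B)"
          using sets.sets_into_space[OF B] by (auto simp: a_def \<phi>_def indicator_def fun_eq_iff)
        moreover have "(f ^^ n) -` A \<inter> B = ((f ^^ n) -` A \<inter> space M) \<inter> B"
          using sets.sets_into_space[OF B] by auto
        then have "(f ^^ n) -` A \<inter> B \<in> sets M" using measurable_sets[OF fn A, of n] B by auto
        ultimately show ?thesis by simp
      qed
      also have "\<dots> = (\<integral>x. a x * X (r k) x \<partial>M)"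
        unfolding X_def
        by (rule sigma_finite_subalgebra.real_cond_exp_intg(2)[OF sfs, symmetric]) (use ai \<phi>i am in auto)
      finally have "prob ((f ^^ n) -` A \<inter> B) - prob A * prob B = (\<integral>x. a x * X (r k) x \<partial>M) - (\<integral>x. a x * c \<partial>M)"
        by (simp add: pA cB)
      also have "\<dots> = (\<integral>x. a x * (X (r k) x - c) \<partial>M)"
        using ai[OF Xi] ai[of "\<lambda>_. c"] by (subst Bochner_Integration.integral_diff[symmetric]) (auto simp: algebra_simps)
      finally have "\<bar>prob ((f ^^ n) -` A \<inter> B) - prob A * prob B\<bar> \<le> (\<integral>x. \<bar>a x * (X (r k) x - c)\<bar> \<partial>M)"
        by (simp add: integral_abs_bound)
      also have "\<dots> \<le> (\<integral>x. \<bar>X (r k) x - c\<bar> \<partial>M)"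
        by (rule integral_mono) (use ai Xi in \<open>auto simp: a_def indicator_def\<close>)
      finally show ?thesis .
    qed
    show "(\<lambda>n. prob ((f ^^ n) -` A \<inter> B)) \<longlonglongrightarrow> prob A * prob B"
    proof (rule LIMSEQ_I)
      fix e :: real assume "0 < e"
      then have "eventually (\<lambda>k. (\<integral>x. \<bar>X (r k) x - c\<bar> \<partial>M) < e) sequentially"
        using order_tendstoD(2)[OF X1lim] by simp
      then obtain k where "(\<integral>x. \<bar>X (r k) x - c\<bar> \<partial>M) < e"
        unfolding eventually_sequentially by blast
      then have "\<forall>n\<ge>r k. norm (prob ((f ^^ n) -` A \<inter> B) - prob A * prob B) < e"
        by (intro allI impI) (simp only: real_norm_def, rule le_less_trans[OF key])
      then show "\<exists>N. \<forall>n\<ge>N. norm (prob ((f ^^ n) -` A \<inter> B) - prob A * prob B) < e" by blast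
    qed
  qed
qed

lemma cesaro_zero:
  fixes a :: "nat \<Rightarrow> real"
  assumes "a \<longlonglongrightarrow> 0"
  shows "(\<lambda>n. (1 / real n) * (\<Sum>j<n. a j)) \<longlonglongrightarrow> 0"
proof (rule LIMSEQ_I)
  fix e :: real assume e: "0 < e"
  then obtain N where N: "\<And>j. j \<ge> N \<Longrightarrow> \<bar>a j\<bar> < e/2"
    using assms by (metis LIMSEQ_D diff_zero half_gt_zero real_norm_def)
  define C where "C = (\<Sum>j<N. \<bar>a j\<bar>)"
  obtain N' :: nat where N': "real N' > 2 * C / e" using reals_Archimedean2 by blast
  have "norm ((1 / real n) * (\<Sum>j<n. a j) - 0) < e" if n: "n \<ge> max (Suc N) (Suc N')" for n
  proof -
    have n0: "real n > 0" using n by simp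
    have "\<bar>\<Sum>j<n. a j\<bar> \<le> (\<Sum>j<n. \<bar>a j\<bar>)" by simp
    also have "\<dots> = C + (\<Sum>j\<in>{N..<n}. \<bar>a j\<bar>)"
      unfolding C_def using n by (subst sum.union_disjoint[symmetric]) (auto intro!: sum.cong)
    also have "(\<Sum>j\<in>{N..<n}. \<bar>a j\<bar>) \<le> real (card {N..<n}) * (e/2)"
      by (rule sum_bounded_above) (use N in \<open>auto intro: less_imp_le\<close>)
    also have "\<dots> \<le> real n * (e/2)" using e by (intro mult_right_mono) auto
    finally have "\<bar>\<Sum>j<n. a j\<bar> \<le> C + real n * (e/2)" by simp
    moreover have "C < real n * (e/2)"
    proof -
      have "2 * C / e < real n" using N' n by linarith
      then show ?thesis using e by (simp add: field_simps)
    qed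
    ultimately have "\<bar>\<Sum>j<n. a j\<bar> < real n * e" by linarith
    then show ?thesis using n0 by (simp add: abs_mult field_simps)
  qed
  then show "\<exists>no. \<forall>n\<ge>no. norm ((1 / real n) * (\<Sum>j<n. a j) - 0) < e" by blast
qed

lemma strongly_imp_weakly_mixing:
  "strongly_mixing M f \<Longrightarrow> weakly_mixing M f"
  unfolding strongly_mixing_def weakly_mixing_def
  by (intro ballI cesaro_zero tendsto_rabs_zero LIM_zero) auto

section \<open>Lifting circle maps\<close>

lemma cis_2pi_add_int: "cis (2 * pi * (x + of_int k)) = cis (2 * pi * x)"
proof -
  have "cis (2 * pi * (x + of_int k)) = cis (2 * pi * x) * cis (2 * pi * of_int k)"
    by (simp add: cis_mult algebra_simps)
  then show ?thesis by simp
qed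

lemma cis_2pi_frac: "cis (2 * pi * frac x) = cis (2 * pi * x)"
  using cis_2pi_add_int[of "frac x" "\<lfloor>x\<rfloor>"] by (simp add: frac_def)

lemma cis_2pi_eq_iff: "cis (2 * pi * x) = cis (2 * pi * y) \<longleftrightarrow> frac x = frac y"
proof
  assume "cis (2 * pi * x) = cis (2 * pi * y)"
  then have "sin (2 * pi * x) = sin (2 * pi * y) \<and> cos (2 * pi * x) = cos (2 * pi * y)"
    by (simp add: complex_eq_iff)
  then obtain n :: int where "2 * pi * x = 2 * pi * y + 2 * pi * n"
    unfolding sin_cos_eq_iff by blast
  then have "2 * pi * x = 2 * pi * (y + of_int n)" by (simp add: algebra_simps)
  then have "x = y + of_int n" by simp
  then show "frac x = frac y" by simp
next
  assume "frac x = frac y"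
  then show "cis (2 * pi * x) = cis (2 * pi * y)" by (metis cis_2pi_frac)
qed

lemma frac_eq_imp_Ints: "frac x = frac y \<Longrightarrow> x - y \<in> \<int>"
  by (metis frac_eqE Ints_of_int add_diff_cancel_left')

lemma Ints_valued_constant:
  fixes g :: "real \<Rightarrow> real"
  assumes "connected A" "continuous_on A g" "\<And>x. x \<in> A \<Longrightarrow> g x \<in> \<int>"
  shows "\<exists>c. \<forall>x\<in>A. g x = c"
proof -
  have "g constant_on A"
  proof (rule continuous_discrete_range_constant[OF assms(1,2)])
    fix x assume x: "x \<in> A"
    have "1 \<le> norm (g y - g x)" if "y \<in> A" "g y \<noteq> g x" for y
      using Ints_nonzero_abs_ge1[of "g y - g x"] assms(3)[OF x] assms(3)[OF that(1)] that(2) by simp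
    then show "\<exists>e>0. \<forall>y. y \<in> A \<and> g y \<noteq> g x \<longrightarrow> e \<le> norm (g y - g x)"
      by (intro exI[of _ 1]) auto
  qed
  then show ?thesis by (auto simp: constant_on_def)
qed

text \<open>Composed with the exponential parametrization, \<open>f\<close> becomes a nowhere
  vanishing map on the contractible line and has a continuous logarithm. Its values have modulus 1,
  so the imaginary part divided by \<open>2 * pi\<close> is the lift; its increment over a period is
  continuous and integer valued, hence constant.\<close>

lemma circle_lift_exists:
  assumes "continuous_map circle circle f"
  shows "\<exists>(F :: real \<Rightarrow> real) (d :: int). continuous_on UNIV F \<and> (\<forall>x. F (x + 1) = F x + of_int d) \<and>
    (\<forall>x. frac (F x) = f (frac x))"
proof -
  define \<phi> where "\<phi> x = cis (2 * pi * f (frac x))" for x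
  \<comment> \<open>Continuity on the circle is tested after composing with the quotient map
    \<open>frac\<close>, where the jump of \<open>frac\<close> disappears under the
    exponential.\<close>
  have "continuous_map circle euclidean (\<lambda>x. cis (2 * pi * x))"
  proof -
    have "continuous_on UNIV (\<lambda>x::real. cis (2 * pi * x))" by (intro continuous_intros)
    then have "continuous_map euclidean euclidean ((\<lambda>x. cis (2 * pi * x)) \<circ> frac)"
      by (simp add: o_def cis_2pi_frac)
    then show ?thesis
      using continuous_compose_quotient_map_eq[OF quotient_map_frac] by blast
  qed
  moreover have "continuous_map euclidean circle (f \<circ> frac)"
    using assms quotient_imp_continuous_map[OF quotient_map_frac] continuous_map_compose by blast
  ultimately have "continuous_map euclidean euclidean ((\<lambda>x. cis (2 * pi * x)) \<circ> (f \<circ> frac))"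
    by (rule continuous_map_compose[rotated])
  then have c\<phi>: "continuous_on UNIV \<phi>" by (simp add: \<phi>_def[abs_def] o_def)
  obtain g where g: "continuous_on UNIV g" "\<And>x. \<phi> x = exp (g x)"
  proof (rule continuous_logarithm_on_contractible[OF c\<phi>])
    show "contractible (UNIV :: real set)" by (simp add: convex_imp_contractible)
    show "\<phi> z \<noteq> 0" for z by (simp add: \<phi>_def)
  qed auto
  define F where "F x = Im (g x) / (2 * pi)" for x
  have "continuous_on UNIV F"
    unfolding F_def[abs_def] by (intro continuous_intros g(1)) auto
  have cisF: "cis (2 * pi * F x) = cis (2 * pi * f (frac x))" for x
  proof -
    have n: "norm (exp (g x)) = 1" using g(2)[of x] by (metis \<phi>_def norm_cis)
    then have "Re (g x) = 0" by simp
    then have "exp (g x) = cis (Im (g x))" by (simp add: exp_eq_polar)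
    then show ?thesis using g(2)[of x] by (simp add: F_def \<phi>_def)
  qed
  have fr: "frac (F x) = f (frac x)" for x
  proof -
    have "f (frac x) \<in> {0..<1}"
      using assms frac_lt_1[of x] by (auto simp: continuous_map_def Pi_iff)
    then have "frac (f (frac x)) = f (frac x)" by (rule frac_eq_id)
    then show ?thesis using cisF cis_2pi_eq_iff by metis
  qed
  have "\<exists>c. \<forall>x\<in>UNIV. F (x + 1) - F x = c"
  proof (rule Ints_valued_constant)
    show "continuous_on UNIV (\<lambda>x. F (x + 1) - F x)"
      using \<open>continuous_on UNIV F\<close>
      by (intro continuous_intros continuous_on_compose2[of UNIV F UNIV "\<lambda>x. x + 1"]) auto
    show "F (x + 1) - F x \<in> \<int>" for x
    proof (rule frac_eq_imp_Ints)
      have "frac (x + 1) = frac x" using frac_add_of_int_right[of x 1] by simp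
      then show "frac (F (x + 1)) = frac (F x)" by (simp add: fr)
    qed
  qed auto
  then obtain c where c: "\<And>x. F (x + 1) - F x = c" by blast
  have "c \<in> \<int>"
  proof -
    have "frac (0 + 1 :: real) = frac 0" by simp
    then have "F (0 + 1) - F 0 \<in> \<int>" by (intro frac_eq_imp_Ints) (simp add: fr)
    then show ?thesis using c[of 0] by simp
  qed
  then obtain d :: int where "c = of_int d" by (auto elim: Ints_cases)
  then have "F (x + 1) = F x + of_int d" for x using c[of x] by (simp add: algebra_simps)
  then show ?thesis
    by (intro exI[of _ F] exI[of _ d] conjI allI \<open>continuous_on UNIV F\<close> fr)
qed

section \<open>From the circle to periodic sets and smooth lifts\<close>

lemma sets_circle_measure_iff: "A \<in> sets circle_measure \<longleftrightarrow> A \<in> sets borel \<and> A \<subseteq> {0..<1}"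
  unfolding circle_measure_def by (subst sets_restrict_space_iff) auto

lemma measure_circle_measure: "A \<in> sets circle_measure \<Longrightarrow> measure circle_measure A = mu A"
proof -
  assume "A \<in> sets circle_measure"
  then have A: "A \<subseteq> {0..<1}" by (simp add: sets_circle_measure_iff)
  then have "measure circle_measure A = measure lborel A"
    unfolding circle_measure_def by (intro measure_restrict_space) auto
  then show ?thesis using A by (simp add: mu_def Int_absorb2)
qed

lemma prob_space_circle_measure: "prob_space circle_measure"
  by (rule prob_spaceI) (simp add: circle_measure_def emeasure_restrict_space space_restrict_space)

lemma borel_vimage_frac:
  assumes "A \<in> sets borel"
  shows "frac -` A \<in> sets (borel :: real measure)"
proof -
  have "(frac :: real \<Rightarrow> real) \<in> borel_measurable borel"
    unfolding frac_def by measurable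
  then show ?thesis using measurable_sets[of frac borel borel A] assms by simp
qed

lemma periodic_vimage_frac: "periodic (frac -` A)"
  using frac_add_of_int_right[of "_::real" 1] by (simp add: periodic_def)

lemma openin_circle_interval:
  "openin circle {x \<in> {0..<1}. \<exists>k::int. x + of_int k \<in> {a<..<b}}"
proof -
  have "frac -` {x \<in> {0..<1}. \<exists>k::int. x + of_int k \<in> {a<..<b}} = (\<Union>k::int. {a - of_int k<..<b - of_int k})"
  proof (intro antisym subsetI)
    fix y assume "y \<in> frac -` {x \<in> {0..<1}. \<exists>k::int. x + of_int k \<in> {a<..<b}}"
    then obtain k :: int where "frac y + of_int k \<in> {a<..<b}" by auto
    then have "y \<in> {a - of_int (k - \<lfloor>y\<rfloor>)<..<b - of_int (k - \<lfloor>y\<rfloor>)}" by (auto simp: frac_def)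
    then show "y \<in> (\<Union>k::int. {a - of_int k<..<b - of_int k})" by blast
  next
    fix y assume "y \<in> (\<Union>k::int. {a - of_int k<..<b - of_int k})"
    then obtain k :: int where "y \<in> {a - of_int k<..<b - of_int k}" by blast
    then have "frac y + of_int (k + \<lfloor>y\<rfloor>) \<in> {a<..<b}" by (auto simp: frac_def)
    then show "y \<in> frac -` {x \<in> {0..<1}. \<exists>k::int. x + of_int k \<in> {a<..<b}}"
      using frac_lt_1[of y] by (auto intro!: exI[of _ "k + \<lfloor>y\<rfloor>"] simp del: of_int_add)
  qed
  then show ?thesis by (auto simp: openin_circle)
qed

lemma circle_lift_of_C_lambda:
  assumes "f \<in> C_lambda" and mix: "topologically_mixing circle f"
  shows "\<exists>F d. circle_lift F d \<and> (\<forall>x. frac (F x) = f (frac x))"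
proof -
  have "continuous_map circle circle f" using assms(1) by (simp add: C_lambda_def)
  from circle_lift_exists[OF this] obtain F :: "real \<Rightarrow> real" and d :: int
    where "continuous_on UNIV F \<and> (\<forall>x. F (x + 1) = F x + of_int d) \<and> (\<forall>x. frac (F x) = f (frac x))"
    by (elim exE)
  then have F: "continuous_on UNIV F" "\<And>x. F (x + 1) = F x + of_int d" "\<And>x. frac (F x) = f (frac x)"
    by auto
  have Fn: "frac ((F ^^ n) x) = (f ^^ n) (frac x)" for n x
    by (induction n) (simp_all add: F(3))
  have mp: "emeasure circle_measure (f -` A \<inter> {0..<1}) = emeasure circle_measure A"
    and ms: "f -` A \<inter> {0..<1} \<in> sets circle_measure" if "A \<in> sets circle_measure" for A
    using assms(1) that measurable_sets[of f circle_measure circle_measure A]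
    by (auto simp: C_lambda_def measure_preserving_map_def)
  have "circle_lift F d"
  proof
    show "mu (F -` E) = mu E" if E: "E \<in> sets borel" "periodic E" for E
    proof -
      define A where "A = E \<inter> {0..<1}"
      have A: "A \<in> sets circle_measure" using E by (simp add: A_def sets_circle_measure_iff)
      have eq: "F -` E \<inter> {0..<1} = f -` A \<inter> {0..<1}"
      proof -
        have "F x \<in> E \<longleftrightarrow> f x \<in> A" if "x \<in> {0..<1}" for x
        proof -
          have "F x \<in> E \<longleftrightarrow> frac (F x) \<in> E" using periodic_frac[OF E(2)] by simp
          also have "\<dots> \<longleftrightarrow> frac (F x) \<in> A" using frac_lt_1[of "F x"] by (simp add: A_def)
          also have "\<dots> \<longleftrightarrow> f x \<in> A" using frac_eq_id[OF that] by (simp add: F(3))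
          finally show ?thesis .
        qed
        then show ?thesis by blast
      qed
      have "measure circle_measure (f -` A \<inter> {0..<1}) = measure circle_measure A"
        using mp[OF A] by (simp add: measure_def)
      then have "mu (f -` A \<inter> {0..<1}) = mu A"
        using measure_circle_measure[OF A] measure_circle_measure[OF ms[OF A]] by simp
      moreover have "mu (F -` E) = mu (f -` A \<inter> {0..<1})"
        unfolding mu_def eq by (simp add: Int_assoc)
      moreover have "mu A = mu E" by (simp add: mu_def A_def Int_assoc)
      ultimately show ?thesis by simp
    qed
    fix a b c e :: real assume ab: "a < b" and ce: "c < e"
    define U where "U a b = {x \<in> {0..<1}. \<exists>k::int. x + of_int k \<in> {a<..<b}}" for a b :: real
    have ne: "U a b \<noteq> {}" if "a < b" for a b
    proof -
      have "frac ((a + b) / 2) + of_int \<lfloor>(a + b) / 2\<rfloor> \<in> {a<..<b}" using that by (simp add: frac_def)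
      then have "frac ((a + b) / 2) \<in> U a b" using frac_lt_1 unfolding U_def by (auto simp del: of_int_add)
      then show ?thesis by blast
    qed
    have "openin circle (U a b)" "openin circle (U c e)"
      unfolding U_def by (rule openin_circle_interval)+
    then obtain n0 where n0: "\<And>n. n \<ge> n0 \<Longrightarrow> (f ^^ n) ` U a b \<inter> U c e \<noteq> {}"
      using mix ne[OF ab] ne[OF ce] unfolding topologically_mixing_def by meson
    have "\<exists>x\<in>{a<..<b}. \<exists>k::int. (F ^^ n) x + of_int k \<in> {c<..<e}" if n: "n \<ge> n0" for n
    proof -
      obtain x where x: "x \<in> U a b" "(f ^^ n) x \<in> U c e" using n0[OF n] by blast
      obtain k :: int where k: "x + of_int k \<in> {a<..<b}" using x(1) by (auto simp: U_def)
      obtain l :: int where l: "(f ^^ n) x + of_int l \<in> {c<..<e}" using x(2) by (auto simp: U_def)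
      have "frac (x + of_int k) = x" using x(1) by (simp add: U_def)
      then have "(f ^^ n) x = frac ((F ^^ n) (x + of_int k))" using Fn[of n "x + of_int k"] by simp
      then have "(F ^^ n) (x + of_int k) + of_int (l - \<lfloor>(F ^^ n) (x + of_int k)\<rfloor>) \<in> {c<..<e}"
        using l by (simp add: frac_def)
      then show ?thesis using k by blast
    qed
    then show "\<exists>n0. \<forall>n\<ge>n0. \<exists>x\<in>{a<..<b}. \<exists>k::int. (F ^^ n) x + of_int k \<in> {c<..<e}" by blast
  qed (use F in auto)
  then show ?thesis by (intro exI[of _ F] exI[of _ d] conjI allI F(3))
qed

text \<open>On the open piece \<open>F - g\<close> is continuous and integer valued, hence constant,
  so \<open>F\<close> inherits the derivatives of \<open>g\<close>. The bounds come from compactness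
  of the closed piece.\<close>

lemma lift_deriv_on_piece:
  assumes F: "continuous_on UNIV F" and ab: "a < b" and g: "C2_on a b g"
    and eq: "\<And>x. x \<in> {a<..<b} \<Longrightarrow> frac (F x) = frac (g x)"
  shows "\<exists>K\<ge>0. \<exists>\<kappa>\<ge>0. (\<forall>x\<in>{a<..<b}. (F has_real_derivative deriv F x) (at x) \<and> \<bar>deriv F x\<bar> \<le> K) \<and>
    (\<forall>x\<in>{a<..<b}. \<forall>y\<in>{a<..<b}. \<bar>deriv F x - deriv F y\<bar> \<le> \<kappa> * \<bar>x - y\<bar>)"
proof -
  obtain g' g'' where g': "\<And>x. x \<in> {a..b} \<Longrightarrow> (g has_real_derivative g' x) (at x within {a..b})"
    and g'': "\<And>x. x \<in> {a..b} \<Longrightarrow> (g' has_real_derivative g'' x) (at x within {a..b})"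
    and cg'': "continuous_on {a..b} g''"
    using g unfolding C2_on_def by blast
  have cg': "continuous_on {a..b} g'" using g'' by (rule DERIV_continuous_on)
  have cg: "continuous_on {a..b} g" using g' by (rule DERIV_continuous_on)
  have bdd: "\<exists>B\<ge>0. \<forall>x\<in>{a..b}. \<bar>u x\<bar> \<le> B" if "continuous_on {a..b} u" for u :: "real \<Rightarrow> real"
  proof -
    have "bounded (u ` {a..b})" by (intro compact_imp_bounded compact_continuous_image that) simp
    then obtain B where "\<forall>x\<in>{a..b}. \<bar>u x\<bar> \<le> B" by (auto simp: bounded_iff)
    then show ?thesis by (intro exI[of _ "max B 0"]) auto
  qed
  obtain K where K: "K \<ge> 0" "\<And>x. x \<in> {a..b} \<Longrightarrow> \<bar>g' x\<bar> \<le> K" using bdd[OF cg'] by blast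
  obtain \<kappa> where \<kappa>: "\<kappa> \<ge> 0" "\<And>x. x \<in> {a..b} \<Longrightarrow> \<bar>g'' x\<bar> \<le> \<kappa>" using bdd[OF cg''] by blast
  have "\<exists>c. \<forall>x\<in>{a<..<b}. F x - g x = c"
  proof (rule Ints_valued_constant)
    show "continuous_on {a<..<b} (\<lambda>x. F x - g x)"
      by (intro continuous_intros continuous_on_subset[OF F] continuous_on_subset[OF cg]) auto
    show "F x - g x \<in> \<int>" if "x \<in> {a<..<b}" for x
      using eq[OF that] by (rule frac_eq_imp_Ints)
  qed simp
  then obtain c where c: "\<And>x. x \<in> {a<..<b} \<Longrightarrow> F x = g x + c" by (auto simp: algebra_simps)
  have d: "(F has_real_derivative g' x) (at x)" if x: "x \<in> {a<..<b}" for x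
  proof -
    have "(g has_real_derivative g' x) (at x)"
      using g'[of x] x at_within_Icc_at[of a x b] by simp
    then have "((\<lambda>x. g x + c) has_real_derivative g' x) (at x)"
      by (auto intro!: derivative_eq_intros)
    then show ?thesis
      by (rule has_field_derivative_transform_within_open[OF _ open_greaterThanLessThan x]) (simp add: c)
  qed
  then have dF: "deriv F x = g' x" if "x \<in> {a<..<b}" for x
    using that by (intro DERIV_imp_deriv)
  have lip: "\<bar>g' x - g' y\<bar> \<le> \<kappa> * \<bar>x - y\<bar>" if "x \<in> {a<..<b}" "y \<in> {a<..<b}" for x y
  proof -
    have *: "\<bar>g' q - g' p\<bar> \<le> \<kappa> * (q - p)" if "p \<le> q" "p \<in> {a<..<b}" "q \<in> {a<..<b}" for p q
    proof (rule abs_diff_le_of_deriv_bound[of "{}"])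
      show "continuous_on {p..q} g'" using cg' that by (rule_tac continuous_on_subset) auto
      fix t assume "t \<in> {p<..<q} - {}"
      then have "t \<in> {a<..<b}" using that by auto
      then show "(g' has_real_derivative g'' t) (at t) \<and> \<bar>g'' t\<bar> \<le> \<kappa>"
        using g''[of t] at_within_Icc_at[of a t b] \<kappa>(2)[of t] by simp
    qed (use that \<kappa> in auto)
    show ?thesis using *[of x y] *[of y x] that by (cases "x \<le> y") auto
  qed
  show ?thesis
    using K \<kappa>(1) d dF lip by (intro exI[of _ K] conjI exI[of _ \<kappa>]) auto
qed

lemma partition_locate:
  fixes t :: "nat \<Rightarrow> real"
  assumes "t 0 \<le> x" "x < t m"
  shows "\<exists>i<m. t i \<le> x \<and> x < t (Suc i)"
  using assms(2)
proof (induction m)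
  case 0
  then show ?case using assms(1) by simp
next
  case (Suc m)
  then show ?case by (cases "x < t m") (auto intro: less_SucI)
qed

lemma smooth_lift_of_piecewise_C2:
  assumes lift: "circle_lift F d" and F: "\<And>x. frac (F x) = f (frac x)" and pc: "piecewise_C2 f"
  shows "\<exists>S h K \<kappa>. smooth_lift F d S h K \<kappa>"
proof -
  interpret circle_lift F d by (rule lift)
  obtain m t where t: "\<And>i. i < m \<Longrightarrow> t i < t (Suc i)" "t m = t 0 + 1"
    and pieces: "\<And>i. i < m \<Longrightarrow> \<exists>g. C2_on (t i) (t (Suc i)) g \<and> (\<forall>x\<in>{t i<..<t (Suc i)}. f (frac x) = frac (g x))"
    using pc unfolding piecewise_C2_def by blast
  have m: "m \<ge> 1" using t(2) by (cases m) auto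
  have "\<exists>K\<ge>0. \<exists>\<kappa>\<ge>0. (\<forall>x\<in>{t i<..<t (Suc i)}. (F has_real_derivative deriv F x) (at x) \<and> \<bar>deriv F x\<bar> \<le> K) \<and>
    (\<forall>x\<in>{t i<..<t (Suc i)}. \<forall>y\<in>{t i<..<t (Suc i)}. \<bar>deriv F x - deriv F y\<bar> \<le> \<kappa> * \<bar>x - y\<bar>)" if i: "i < m" for i
  proof -
    obtain g where g: "C2_on (t i) (t (Suc i)) g" "\<And>x. x \<in> {t i<..<t (Suc i)} \<Longrightarrow> f (frac x) = frac (g x)"
      using pieces[OF i] by blast
    show ?thesis by (rule lift_deriv_on_piece[OF cont t(1)[OF i] g(1)]) (simp add: F g(2))
  qed
  then obtain Ki \<kappa>i where Ki: "\<And>i. i < m \<Longrightarrow> Ki i \<ge> 0" and \<kappa>i: "\<And>i. i < m \<Longrightarrow> \<kappa>i i \<ge> 0"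
    and dF: "\<And>i x. i < m \<Longrightarrow> x \<in> {t i<..<t (Suc i)} \<Longrightarrow> (F has_real_derivative deriv F x) (at x) \<and> \<bar>deriv F x\<bar> \<le> Ki i"
    and dlip: "\<And>i x y. i < m \<Longrightarrow> x \<in> {t i<..<t (Suc i)} \<Longrightarrow> y \<in> {t i<..<t (Suc i)} \<Longrightarrow> \<bar>deriv F x - deriv F y\<bar> \<le> \<kappa>i i * \<bar>x - y\<bar>"
    by metis
  \<comment> \<open>Sums dominate the bounds of all pieces at once; the 2 provides the
    \<open>K \<ge> 2\<close> demanded by \<open>smooth_lift\<close>.\<close>
  define K where "K = 2 + (\<Sum>i<m. Ki i)"
  define \<kappa> where "\<kappa> = (\<Sum>i<m. \<kappa>i i)"
  have K: "K \<ge> 2" "Ki i \<le> K" if "i < m" for i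
  proof -
    have "Ki i \<le> (\<Sum>i<m. Ki i)" using that Ki by (intro member_le_sum) auto
    then show "Ki i \<le> K" by (simp add: K_def)
    have "0 \<le> (\<Sum>i<m. Ki i)" using Ki by (intro sum_nonneg) auto
    then show "K \<ge> 2" by (simp add: K_def)
  qed
  have \<kappa>: "\<kappa>i i \<le> \<kappa>" if "i < m" for i
    unfolding \<kappa>_def using that \<kappa>i by (intro member_le_sum) auto
  define S where "S = {x. \<exists>i<m. \<exists>k::int. x = t i + of_int k}"
  have tS: "t i + of_int k \<in> S" if "i \<le> m" for i and k :: int
  proof (cases "i = m")
    case True
    then have eq: "t i + of_int k = t 0 + of_int (k + 1)" using t(2) by simp
    have "t 0 + of_int (k + 1) \<in> S" unfolding S_def using m by (intro CollectI exI[of _ 0] conjI exI[of _ "k + 1"]) auto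
    then show ?thesis by (simp only: eq)
  next
    case False
    then show ?thesis
      unfolding S_def using that by (intro CollectI exI[of _ i] conjI exI[of _ k]) auto
  qed
  have loc: "\<exists>i<m. \<exists>k::int. x + of_int k \<in> {t i<..<t (Suc i)}" if x: "x \<notin> S" for x
  proof -
    define k where "k = - \<lfloor>x - t 0\<rfloor>"
    have "t 0 \<le> x + of_int k" "x + of_int k < t m" unfolding k_def t(2) by linarith+
    then obtain i where i: "i < m" "t i \<le> x + of_int k" "x + of_int k < t (Suc i)"
      using partition_locate[of t "x + of_int k" m] by blast
    have "t i \<noteq> x + of_int k"
    proof
      assume "t i = x + of_int k"
      then have "x = t i + of_int (- k)" by simp
      then show False using x tS[of i "- k"] i(1) by simp
    qed
    then show ?thesis using i by (intro exI[of _ i] conjI exI[of _ k]) auto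
  qed
  \<comment> \<open>Differentiability is known on one copy of each piece and is carried to the
    others by the relation between \<open>F\<close> and integer translations.\<close>
  have shift: "(F has_real_derivative deriv F (x + of_int k)) (at x)"
    if "(F has_real_derivative deriv F (x + of_int k)) (at (x + of_int k))" for x and k :: int
  proof -
    have "((\<lambda>s. F (s + of_int k)) has_real_derivative deriv F (x + of_int k)) (at x)"
      using that by (simp add: DERIV_shift)
    then have "((\<lambda>s. F (s + of_int k) - of_int (d * k)) has_real_derivative deriv F (x + of_int k)) (at x)"
      by (auto intro!: derivative_eq_intros)
    moreover have "(\<lambda>s. F (s + of_int k) - of_int (d * k)) = F"
      using funpow_add_int[of 1] by (auto simp: fun_eq_iff)
    ultimately show ?thesis by simp
  qed
  have dshift: "(F has_real_derivative deriv F x) (at x) \<and> deriv F x = deriv F (x + of_int k)"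
    if "i < m" "x + of_int k \<in> {t i<..<t (Suc i)}" for i x and k :: int
    using shift[OF conjunct1[OF dF[OF that]]] DERIV_imp_deriv by metis
  have "smooth_lift F d S (deriv F) K \<kappa>"
  proof
    show "periodic S"
    proof -
      have "x + of_int j \<in> S" if "x \<in> S" for x and j :: int
      proof -
        obtain i k where i: "i < m" "x = t i + of_int k" using \<open>x \<in> S\<close> by (auto simp: S_def)
        then have eq: "x + of_int j = t i + of_int (k + j)" by simp
        show ?thesis unfolding eq using i(1) by (intro tS) simp
      qed
      from this[of _ 1] this[of "_ + 1" "-1"] show ?thesis by (auto simp: periodic_def)
    qed
    show "finite (S \<inter> {u..v})" for u v
    proof (rule finite_subset)
      show "finite (\<Union>i<m. (\<lambda>k. t i + of_int k) ` {\<lceil>u - t i\<rceil>..\<lfloor>v - t i\<rfloor>})" by simp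
      show "S \<inter> {u..v} \<subseteq> (\<Union>i<m. (\<lambda>k. t i + of_int k) ` {\<lceil>u - t i\<rceil>..\<lfloor>v - t i\<rfloor>})"
      proof
        fix x assume "x \<in> S \<inter> {u..v}"
        then obtain i and k :: int where ik: "i < m" "x = t i + of_int k" "u \<le> x" "x \<le> v" by (auto simp: S_def)
        then have "k \<in> {\<lceil>u - t i\<rceil>..\<lfloor>v - t i\<rfloor>}" by (simp add: ceiling_le_iff le_floor_iff algebra_simps)
        then show "x \<in> (\<Union>i<m. (\<lambda>k. t i + of_int k) ` {\<lceil>u - t i\<rceil>..\<lfloor>v - t i\<rfloor>})" using ik by blast
      qed
    qed
    show "S \<noteq> {}" using tS[of 0 0] by auto
    show "2 \<le> K" using K(1)[of 0] m by simp
    show "0 \<le> \<kappa>" unfolding \<kappa>_def using \<kappa>i by (intro sum_nonneg) auto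
    show "(F has_real_derivative deriv F x) (at x)" if x: "x \<notin> S" for x
      using loc[OF x] dshift by blast
    show "\<bar>deriv F x\<bar> \<le> K" if x: "x \<notin> S" for x
    proof -
      obtain i k where i: "i < m" "x + of_int k \<in> {t i<..<t (Suc i)}" using loc[OF x] by blast
      have "\<bar>deriv F (x + of_int k)\<bar> \<le> Ki i" using dF[OF i] by blast
      then show ?thesis using K(2)[OF i(1)] dshift[OF i] by simp
    qed
    show "\<bar>deriv F x - deriv F y\<bar> \<le> \<kappa> * \<bar>x - y\<bar>" if av: "{min x y..max x y} \<inter> S = {}" for x y
    proof -
      have "x \<in> {min x y..max x y}" by auto
      then have "x \<notin> S" using av by blast
      then obtain i k where i: "i < m" "x + of_int k \<in> {t i<..<t (Suc i)}" using loc by blast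
      \<comment> \<open>Neither translated end of the piece containing \<open>x\<close> lies on the
        segment, so the segment cannot leave that piece and one Lipschitz constant applies.\<close>
      have nS: "t i + of_int (- k) \<notin> {min x y..max x y}" "t (Suc i) + of_int (- k) \<notin> {min x y..max x y}"
        using tS[of i "- k"] tS[of "Suc i" "- k"] i(1) av by auto
      then have "y + of_int k \<in> {t i<..<t (Suc i)}"
        using i(2) by (auto simp: min_def max_def split: if_splits)
      then have "\<bar>deriv F x - deriv F y\<bar> \<le> \<kappa>i i * \<bar>x - y\<bar>"
        using dlip[OF i(1) i(2), of "y + of_int k"] dshift[OF i] dshift[OF i(1), of y k] by simp
      also have "\<dots> \<le> \<kappa> * \<bar>x - y\<bar>" using \<kappa>[OF i(1)] by (intro mult_right_mono) auto
      finally show ?thesis .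
    qed
  qed
  then show ?thesis by blast
qed

lemma measure_exact_circle:
  assumes f: "f \<in> C_lambda" and pc: "piecewise_C2 f" and mix: "topologically_mixing circle f"
  shows "measure_exact circle_measure f"
proof -
  obtain F d where "circle_lift F d \<and> (\<forall>x. frac (F x) = f (frac x))"
    using circle_lift_of_C_lambda[OF f mix] by (elim exE)
  then have lift: "circle_lift F d" and F: "\<And>x. frac (F x) = f (frac x)" by auto
  obtain S h K \<kappa> where "smooth_lift F d S h K \<kappa>"
    using smooth_lift_of_piecewise_C2[OF lift F pc] by (elim exE)
  then interpret smooth_lift F d S h K \<kappa> .
  have Fn: "frac ((F ^^ n) x) = (f ^^ n) (frac x)" for n x
    by (induction n) (simp_all add: F)
  show ?thesis
    unfolding measure_exact_def
  proof
    fix A assume "A \<in> (\<Inter>n. {(f ^^ n) -` B \<inter> space circle_measure |B. B \<in> sets circle_measure})"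
    then have "\<exists>B. B \<in> sets circle_measure \<and> A = (f ^^ n) -` B \<inter> {0..<1}" for n
      unfolding space_circle_measure by blast
    then obtain B where B: "\<And>n. B n \<in> sets circle_measure" "\<And>n. A = (f ^^ n) -` B n \<inter> {0..<1}" by metis
    have A: "A \<in> sets circle_measure"
      using B(1)[of 0] B(2)[of 0] sets.sets_into_space[OF B(1)[of 0]] by (simp add: Int_absorb2)
    \<comment> \<open>The full lift of \<open>A\<close>: it is a tail set for \<open>F\<close>, with
      the lifts of the sets \<open>B n\<close> as its witnesses.\<close>
    define A' where "A' = frac -` A"
    have A'I: "A' \<inter> {0..<1} = A" "- A' \<inter> {0..<1} = {0..<1} - A"
      using A by (auto simp: A'_def sets_circle_measure_iff)
    have A'b: "A' \<in> sets borel" using A by (simp add: A'_def borel_vimage_frac sets_circle_measure_iff)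
    have eq: "A' = (F ^^ n) -` (frac -` B n)" for n
    proof -
      have "frac y \<in> A \<longleftrightarrow> frac ((F ^^ n) y) \<in> B n" for y
        using B(2)[of n] frac_lt_1[of y] by (auto simp: Fn)
      then show ?thesis by (auto simp: A'_def)
    qed
    have "mu A' = 0 \<or> mu (- A') = 0"
    proof (cases "mu A' > 0")
      case True
      then have "mu (- A') = 0"
        by (rule smooth_tail_trivial[where B = "\<lambda>n. frac -` B n", OF A'b])
          (use B(1) eq in \<open>simp_all add: borel_vimage_frac periodic_vimage_frac sets_circle_measure_iff\<close>)
      then show ?thesis by simp
    next
      case False
      then show ?thesis using mu_nonneg[of A'] by simp
    qed
    moreover have "measure circle_measure A = mu A'" "measure circle_measure ({0..<1} - A) = mu (- A')"
    proof -
      have "{0..<1} - A \<in> sets circle_measure" using A by (metis sets.compl_sets space_circle_measure)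
      moreover have "mu A = mu A'" "mu ({0..<1} - A) = mu (- A')"
      proof -
        have "A \<inter> {0..<1} = A" "({0..<1} - A) \<inter> {0..<1} = {0..<1} - A"
          using A by (auto simp: sets_circle_measure_iff)
        then show "mu A = mu A'" "mu ({0..<1} - A) = mu (- A')" by (simp_all only: mu_def A'I)
      qed
      ultimately show "measure circle_measure A = mu A'" "measure circle_measure ({0..<1} - A) = mu (- A')"
        using A measure_circle_measure by simp_all
    qed
    ultimately show "measure circle_measure A * measure circle_measure (space circle_measure - A) = 0"
      by auto
  qed
qed

theorem theorem4:
  fixes f :: "real \<Rightarrow> real"
  assumes "f \<in> C_lambda"
    and "piecewise_C2 f"
    and "topologically_mixing circle f"
  shows "measure_exact circle_measure f \<and> strongly_mixing circle_measure f
    \<and> weakly_mixing circle_measure f"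
proof -
  have exact: "measure_exact circle_measure f"
    using measure_exact_circle assms by blast
  have "measure_preserving_map circle_measure f" using assms(1) by (simp add: C_lambda_def)
  then have "strongly_mixing circle_measure f"
    using prob_space.exact_imp_strongly_mixing[OF prob_space_circle_measure] exact by blast
  then show ?thesis using exact strongly_imp_weakly_mixing by blast
qed

end
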